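(* Suppose that the pregeometry $\mathbb G=\{\mathcal G_n:n\in\mathbb N\}$ is polynomially $k$-saturated for every $k\in\mathbb N$. Then for every $L_{rel}$-sentence $\varphi$, the sequence $\delta^{\mathbb C}_n(\varphi)$ converges to $0$ or to $1$ as $n\to\infty$, and the sequence $\delta^{\mathbb S}_n(\varphi)$ converges to $0$ or to $1$ as $n\to\infty$.
   Context: Fix an integer $l\ge 2$. Let $V_{pre}$ be a (possibly infinite) vocabulary, $V_{col}=\{P_1,\dots,P_l\}$ a set of unary relation symbols (colours), and $V_{rel}$ a finite nonempty set of relation symbols each of arity at least $2$; the three vocabularies are pairwise disjoint, and $\rho$ is the maximal arity of a symbol in $V_{rel}$. $L_{pre}$, $L_{rel}$, $L$ are the first-order languages with vocabularies $V_{pre}$, $V_{pre}\cup V_{rel}$, $V_{pre}\cup V_{col}\cup V_{rel}$. $\mathcal M\restriction L'$ denotes a reduct; for $A\subseteq M$, $\mathcal M\restriction A$ denotes the substructure generated by $A$. A pregeometry is a pair $(A,\mathrm{cl})$, $\mathrm{cl}:\mathcal P(A)\to\mathcal P(A)$, such that for all $X,Y\subseteq A$, $a,b\in A$: $X\subseteq \mathrm{cl}(X)$; $Y\subseteq\mathrm{cl}(X)\Rightarrow \mathrm{cl}(Y)\subseteq \mathrm{cl}(X)$; $a\in \mathrm{cl}(X\cup\{b\})\setminus\mathrm{cl}(X)\Rightarrow b\in\mathrm{cl}(X\cup\{a\})$; $\mathrm{cl}(X)=\bigcup\{\mathrm{cl}(X_0):X_0\subseteq X\text{ finite}\}$. Closed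 sets are called subspaces; $\dim(X)=\min\{|Y|:Y\subseteq X, X\subseteq\mathrm{cl}(Y)\}$. Fix $L_{pre}$-formulas $\theta_m(x_1,\dots,x_{m+1})$, $m\in\mathbb N$. For any structure $\mathcal A$ interpreting $V_{pre}$ let $a\in \mathrm{cl}_{\mathcal A}(\{b_1,\dots,b_m\})$ iff $\mathcal A\models\theta_m(b_1,\dots,b_m,a)$, and $a\in\mathrm{cl}_{\mathcal A}(B)$ iff $a\in\mathrm{cl}_{\mathcal A}(B_0)$ for some finite $B_0\subseteq B$. $\mathbb G=\{\mathcal G_n:n\in\mathbb N\}$ is a set of finite $L_{pre}$-structures with each $(G_n,\mathrm{cl}_{\mathcal G_n})$ a pregeometry. A closed substructure is a substructure with closed universe. Standing assumptions: (A1) there is $f:\mathbb N\to\mathbb N$ with $|\mathrm{cl}_{\mathcal G_n}(X)|\le f(\dim X)$ for all $n$, $X\subseteq G_n$, and every closed subset of $G_n$ is the universe of a substructure of $\mathcal G_n$; (A2) if $\mathcal A$ is a closed substructure of $\mathcal G_n$ then $\mathrm{cl}_{\mathcal A}(X)=\mathrm{cl}_{\mathcal G_n}(X)$ for all $X\subseteq A$; (A3) every closed substructure of any $\mathcal G_n$ is isomorphic to some $\mathcal G_m$, $\dim(G_n)\to\infty$, and the substructure of $\mathcal G_n$ on $\mathrm{cl}_{\mathcal G_n}(\emptyset)$ is isomorphic to $\mathcal G_0$; (A4) for each $n$ there is a quantifier-free $L_{pre}$-formula $\chi_{\mathcal G_n}(x_1,\dots,x_{|G_n|})$ such that every $L_{pre}$-structure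 $\mathcal A$ for which $(A,\mathrm{cl}_{\mathcal A})$ is a pregeometry and which satisfies $\chi_{\mathcal G_n}$ under some enumeration of $A$ is isomorphic to $\mathcal G_n$. An $L$-structure $\mathcal M$ with $\mathcal M\restriction L_{pre}=\mathcal G_n$ (write $\mathrm{cl}=\mathrm{cl}_{\mathcal G_n}$) is $l$-coloured if: (C1) $\mathcal M\models P_1(a)\vee\dots\vee P_l(a)$ iff $a\notin\mathrm{cl}(\emptyset)$; (C2) no $R\in V_{rel}$ holds of a tuple from $\mathrm{cl}(\emptyset)$; (C3) if $a,b\notin\mathrm{cl}(\emptyset)$, $a\in\mathrm{cl}(\{b\})$ and $i\neq j$ then $\mathcal M\not\models P_i(a)\wedge P_j(b)$; (C4) if $R\in V_{rel}$ and $\mathcal M\models R(a_1,\dots,a_m)$ there are $b,c\in\mathrm{cl}(\{a_1,\dots,a_m\})\setminus\mathrm{cl}(\emptyset)$ such that no $P_k$ holds of both. It is strongly $l$-coloured if also (C5) whenever $\mathcal M\models R(a_1,\dots,a_m)$ with $R\in V_{rel}$, any $b,c\in\mathrm{cl}(\{a_1,\dots,a_m\})\setminus\mathrm{cl}(\emptyset)$ with $b\notin\mathrm{cl}(\{c\})$ share no $P_k$. An $L_{rel}$-structure is (strongly) $l$-colourable if it has a (strongly) $l$-coloured expansion to $L$. $\mathbb K_n$ ($\mathbb{SK}_n$) is the set of $l$-coloured (strongly $l$-coloured) $\mathcal M$ with $\mathcal M\restriction L_{pre}=\mathcal G_n$; $\mathbb C_n$ ($\mathbb S_n$) is the set of $l$-colourable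 (strongly $l$-colourable) $L_{rel}$-structures with $L_{pre}$-reduct $\mathcal G_n$. Measures: for an $L$-structure $\mathcal M$ and $d\in\mathbb N$, $\mathcal M\restriction d$ has the same universe and $V_{pre}$-interpretations as $\mathcal M$, and a tuple $\bar a$ is in the interpretation of $R\in V_{col}\cup V_{rel}$ iff $\bar a\in R^{\mathcal M}$ and $\dim(\bar a)\le d$. Let $\mathbb K_n\restriction d=\{\mathcal M\restriction d:\mathcal M\in\mathbb K_n\}$. $\mathbb P_{n,0}$ is the uniform measure on $\mathbb K_n\restriction 0$; for $1\le r\le\rho$ and $\mathcal M\in\mathbb K_n\restriction r$, $\mathbb P_{n,r}(\mathcal M)=\mathbb P_{n,r-1}(\mathcal M\restriction(r-1))/|\{\mathcal M'\in\mathbb K_n\restriction r:\mathcal M'\restriction(r-1)=\mathcal M\restriction(r-1)\}|$; $\delta^{\mathbb K}_n=\mathbb P_{n,\rho}$. $\delta^{\mathbb{SK}}_n$ is defined identically with $\mathbb{SK}_n$ in place of $\mathbb K_n$. For $X\subseteq\mathbb C_n$, $\delta^{\mathbb C}_n(X)=\delta^{\mathbb K}_n(\{\mathcal M\in\mathbb K_n:\mathcal M\restriction L_{rel}\in X\})$; for $Y\subseteq\mathbb S_n$, $\delta^{\mathbb S}_n(Y)=\delta^{\mathbb{SK}}_n(\{\mathcal M\in\mathbb{SK}_n:\mathcal M\restriction L_{rel}\in Y\})$. For a sentence $\varphi$, $\delta^{\mathbb C}_n(\varphi)=\delta^{\mathbb C}_n(\{\mathcal M\in\mathbb C_n:\mathcal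 M\models\varphi\})$, similarly for $\delta^{\mathbb S}_n$. For $k\in\mathbb N$, $\mathbb G$ is polynomially $k$-saturated if there are natural numbers $\lambda_n$ with $\lambda_n\to\infty$ and a polynomial $P$ such that for every $n$: $\lambda_n\le|G_n|\le P(\lambda_n)$, and whenever $\mathcal A$ is a closed substructure of $\mathcal G_n$ and there are a structure $\mathcal G$ isomorphic to a member of $\mathbb G$ and closed substructures $\mathcal A\subsetneq\mathcal B$ of $\mathcal G$ with $\dim(A)+1=\dim(B)\le k$, then there are closed substructures $\mathcal B_1,\dots,\mathcal B_{\lambda_n}$ of $\mathcal G_n$ with $B_i\cap B_j=A$ for $i\neq j$, each isomorphic to $\mathcal B$ via an isomorphism fixing $A$ pointwise. *)

theory Defs
  imports "HOL-Analysis.Analysis" "HOL-Computational_Algebra.Polynomial"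
begin

section \<open>First-order logic\<close>

text \<open>Every symbol carries its arity; constants are function symbols of arity 0.  A vocabulary is
  a set of symbols.\<close>

datatype 's symbol =
    is_fun: FunSym (sym_name: 's) (arity: nat)
  | is_rel: RelSym (sym_name: 's) (arity: nat)

datatype 's trm = Var nat | App "'s symbol" "'s trm list"

datatype 's form =
    Fls
  | Eq "'s trm" "'s trm"
  | Atom "'s symbol" "'s trm list"
  | Neg "'s form"
  | Conj "'s form" "'s form"
  | All nat "'s form"

fun trm_over :: "'s symbol set \<Rightarrow> 's trm \<Rightarrow> bool" where
  "trm_over V (Var x) = True"
| "trm_over V (App f ts) =
     (f \<in> V \<and> is_fun f \<and> length ts = arity f \<and> (\<forall>t\<in>set ts. trm_over V t))"

fun form_over :: "'s symbol set \<Rightarrow> 's form \<Rightarrow> bool" where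
  "form_over V Fls = True"
| "form_over V (Eq s t) = (trm_over V s \<and> trm_over V t)"
| "form_over V (Atom R ts) =
     (R \<in> V \<and> is_rel R \<and> length ts = arity R \<and> (\<forall>t\<in>set ts. trm_over V t))"
| "form_over V (Neg \<phi>) = form_over V \<phi>"
| "form_over V (Conj \<phi> \<psi>) = (form_over V \<phi> \<and> form_over V \<psi>)"
| "form_over V (All x \<phi>) = form_over V \<phi>"

fun trm_vars :: "'s trm \<Rightarrow> nat set" where
  "trm_vars (Var x) = {x}"
| "trm_vars (App f ts) = (\<Union>t\<in>set ts. trm_vars t)"

fun free_vars :: "'s form \<Rightarrow> nat set" where
  "free_vars Fls = {}"
| "free_vars (Eq s t) = trm_vars s \<union> trm_vars t"
| "free_vars (Atom R ts) = (\<Union>t\<in>set ts. trm_vars t)"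
| "free_vars (Neg \<phi>) = free_vars \<phi>"
| "free_vars (Conj \<phi> \<psi>) = free_vars \<phi> \<union> free_vars \<psi>"
| "free_vars (All x \<phi>) = free_vars \<phi> - {x}"

fun quantifier_free :: "'s form \<Rightarrow> bool" where
  "quantifier_free (Neg \<phi>) = quantifier_free \<phi>"
| "quantifier_free (Conj \<phi> \<psi>) = (quantifier_free \<phi> \<and> quantifier_free \<psi>)"
| "quantifier_free (All x \<phi>) = False"
| "quantifier_free _ = True"

definition sentence_over :: "'s symbol set \<Rightarrow> 's form \<Rightarrow> bool" where
  "sentence_over V \<phi> \<longleftrightarrow> form_over V \<phi> \<and> free_vars \<phi> = {}"

record ('s, 'u) fo_struct =
  univ :: "'u set"
  fun_of :: "'s symbol \<Rightarrow> 'u list \<Rightarrow> 'u"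
  rel_of :: "'s symbol \<Rightarrow> 'u list set"

definition tuples :: "'u set \<Rightarrow> nat \<Rightarrow> 'u list set" where
  "tuples A m = {xs. set xs \<subseteq> A \<and> length xs = m}"

text \<open>The values outside the vocabulary and outside the universe are normalised, so that two
  structures over the same vocabulary are equal as elements of the type iff they are equal as
  structures; counting structures depends on this.  The universe may be empty: this is needed
  when the closure of the empty set is empty.\<close>

definition is_struct :: "'s symbol set \<Rightarrow> ('s, 'u) fo_struct \<Rightarrow> bool" where
  "is_struct V M \<longleftrightarrow>
     (\<forall>f xs. if f \<in> V \<and> is_fun f \<and> xs \<in> tuples (univ M) (arity f)
             then fun_of M f xs \<in> univ M else fun_of M f xs = undefined) \<and>
     (\<forall>R. if R \<in> V \<and> is_rel R
          then rel_of M R \<subseteq> tuples (univ M) (arity R) else rel_of M R = {})"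

fun eval :: "('s, 'u) fo_struct \<Rightarrow> (nat \<Rightarrow> 'u) \<Rightarrow> 's trm \<Rightarrow> 'u" where
  "eval M e (Var x) = e x"
| "eval M e (App f ts) = fun_of M f (map (eval M e) ts)"

fun sat :: "('s, 'u) fo_struct \<Rightarrow> (nat \<Rightarrow> 'u) \<Rightarrow> 's form \<Rightarrow> bool" where
  "sat M e Fls = False"
| "sat M e (Eq s t) = (eval M e s = eval M e t)"
| "sat M e (Atom R ts) = (map (eval M e) ts \<in> rel_of M R)"
| "sat M e (Neg \<phi>) = (\<not> sat M e \<phi>)"
| "sat M e (Conj \<phi> \<psi>) = (sat M e \<phi> \<and> sat M e \<psi>)"
| "sat M e (All x \<phi>) = (\<forall>a\<in>univ M. sat M (e(x := a)) \<phi>)"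

text \<open>A formula $\varphi(x_1,\dots,x_m)$ has its free variables among \<open>0, \<dots>, m - 1\<close>; the variable
  \<open>i\<close> stands for $x_{i+1}$ and is assigned the \<open>i\<close>-th entry of the list.\<close>

definition holds :: "('s, 'u) fo_struct \<Rightarrow> 's form \<Rightarrow> 'u list \<Rightarrow> bool" where
  "holds M \<phi> xs \<longleftrightarrow> sat M (\<lambda>i. if i < length xs then xs ! i else undefined) \<phi>"

definition reduct :: "'s symbol set \<Rightarrow> ('s, 'u) fo_struct \<Rightarrow> ('s, 'u) fo_struct" where
  "reduct V M = \<lparr> univ = univ M,
                  fun_of = (\<lambda>f. if f \<in> V then fun_of M f else (\<lambda>_. undefined)),
                  rel_of = (\<lambda>R. if R \<in> V then rel_of M R else {}) \<rparr>"

definition substructure ::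
    "'s symbol set \<Rightarrow> ('s, 'u) fo_struct \<Rightarrow> ('s, 'u) fo_struct \<Rightarrow> bool" where
  "substructure V A M \<longleftrightarrow>
     is_struct V A \<and> univ A \<subseteq> univ M \<and>
     (\<forall>f\<in>V. is_fun f \<longrightarrow> (\<forall>xs\<in>tuples (univ A) (arity f). fun_of A f xs = fun_of M f xs)) \<and>
     (\<forall>R\<in>V. is_rel R \<longrightarrow> rel_of A R = rel_of M R \<inter> tuples (univ A) (arity R))"

definition isomorphism ::
    "'s symbol set \<Rightarrow> ('u \<Rightarrow> 'v) \<Rightarrow> ('s, 'u) fo_struct \<Rightarrow> ('s, 'v) fo_struct \<Rightarrow> bool" where
  "isomorphism V h M N \<longleftrightarrow>
     bij_betw h (univ M) (univ N) \<and>
     (\<forall>f\<in>V. is_fun f \<longrightarrow>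
        (\<forall>xs\<in>tuples (univ M) (arity f). h (fun_of M f xs) = fun_of N f (map h xs))) \<and>
     (\<forall>R\<in>V. is_rel R \<longrightarrow>
        (\<forall>xs\<in>tuples (univ M) (arity R). xs \<in> rel_of M R \<longleftrightarrow> map h xs \<in> rel_of N R))"

definition isomorphic ::
    "'s symbol set \<Rightarrow> ('s, 'u) fo_struct \<Rightarrow> ('s, 'v) fo_struct \<Rightarrow> bool" where
  "isomorphic V M N \<longleftrightarrow> (\<exists>h. isomorphism V h M N)"


section \<open>Pregeometries\<close>

definition pregeometry :: "'u set \<Rightarrow> ('u set \<Rightarrow> 'u set) \<Rightarrow> bool" where
  "pregeometry A c \<longleftrightarrow>
     (\<forall>X\<subseteq>A. c X \<subseteq> A) \<and>
     (\<forall>X\<subseteq>A. X \<subseteq> c X) \<and>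
     (\<forall>X\<subseteq>A. \<forall>Y\<subseteq>A. Y \<subseteq> c X \<longrightarrow> c Y \<subseteq> c X) \<and>
     (\<forall>X\<subseteq>A. \<forall>a\<in>A. \<forall>b\<in>A. a \<in> c (X \<union> {b}) - c X \<longrightarrow> b \<in> c (X \<union> {a})) \<and>
     (\<forall>X\<subseteq>A. c X = \<Union> {c X0 | X0. X0 \<subseteq> X \<and> finite X0})"

text \<open>Only used for finite \<open>X\<close>.\<close>

definition pdim :: "('u set \<Rightarrow> 'u set) \<Rightarrow> 'u set \<Rightarrow> nat" where
  "pdim c X = (LEAST m. \<exists>Y\<subseteq>X. finite Y \<and> card Y = m \<and> X \<subseteq> c Y)"

text \<open>The closure operator defined by the formulas $\theta_m(x_1,\dots,x_{m+1})$.  That the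
  formulas decide membership in $\mathrm{cl}(\{b_1,\dots,b_m\})$ independently of the way the set
  is listed is part of \<open>theta_pregeometry\<close>.\<close>

definition cl :: "(nat \<Rightarrow> 's form) \<Rightarrow> ('s, 'u) fo_struct \<Rightarrow> 'u set \<Rightarrow> 'u set" where
  "cl \<theta> M B =
     {a \<in> univ M. \<exists>bs. set bs \<subseteq> B \<and> holds M (\<theta> (length bs)) (bs @ [a])}"

definition theta_pregeometry :: "(nat \<Rightarrow> 's form) \<Rightarrow> ('s, 'u) fo_struct \<Rightarrow> bool" where
  "theta_pregeometry \<theta> M \<longleftrightarrow>
     (\<forall>bs a. set bs \<subseteq> univ M \<and> a \<in> univ M \<longrightarrow>
        (a \<in> cl \<theta> M (set bs) \<longleftrightarrow> holds M (\<theta> (length bs)) (bs @ [a]))) \<and>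
     pregeometry (univ M) (cl \<theta> M)"

definition closed_in :: "(nat \<Rightarrow> 's form) \<Rightarrow> ('s, 'u) fo_struct \<Rightarrow> 'u set \<Rightarrow> bool" where
  "closed_in \<theta> M X \<longleftrightarrow> X \<subseteq> univ M \<and> cl \<theta> M X = X"

definition closed_substructure ::
    "'s symbol set \<Rightarrow> (nat \<Rightarrow> 's form) \<Rightarrow> ('s, 'u) fo_struct \<Rightarrow> ('s, 'u) fo_struct \<Rightarrow> bool" where
  "closed_substructure V \<theta> A M \<longleftrightarrow> substructure V A M \<and> closed_in \<theta> M (univ A)"

text \<open>Abstract structures (\<open>\<G>\<close> here, and \<open>A\<close> in the assumption \<open>characterised\<close> below) range over
  structures on the type \<open>'u\<close>.  Nothing is lost: they are finite, and \<open>'u\<close> is infinite because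
  the dimensions of the \<open>G n\<close> tend to infinity.  A member of $\mathbb G$ isomorphic to \<open>\<G>\<close> is
  given by its index \<open>m\<close>.\<close>

definition polynomially_saturated ::
    "'s symbol set \<Rightarrow> (nat \<Rightarrow> 's form) \<Rightarrow> (nat \<Rightarrow> ('s, 'u) fo_struct) \<Rightarrow> nat \<Rightarrow> bool" where
  "polynomially_saturated V \<theta> G k \<longleftrightarrow>
     (\<exists>(lam :: nat \<Rightarrow> nat) (P :: real poly).
        filterlim lam at_top sequentially \<and>
        (\<forall>n. lam n \<le> card (univ (G n)) \<and> real (card (univ (G n))) \<le> poly P (real (lam n)) \<and>
          (\<forall>A B \<G> m.
             closed_substructure V \<theta> A (G n) \<and>
             is_struct V \<G> \<and> isomorphic V \<G> (G m) \<and>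
             closed_substructure V \<theta> A \<G> \<and> closed_substructure V \<theta> B \<G> \<and>
             univ A \<subset> univ B \<and>
             pdim (cl \<theta> \<G>) (univ A) + 1 = pdim (cl \<theta> \<G>) (univ B) \<and>
             pdim (cl \<theta> \<G>) (univ B) \<le> k \<longrightarrow>
             (\<exists>BB :: nat \<Rightarrow> ('s, 'u) fo_struct.
                (\<forall>i\<in>{1..lam n}. closed_substructure V \<theta> (BB i) (G n) \<and>
                   (\<exists>h. isomorphism V h B (BB i) \<and> (\<forall>a\<in>univ A. h a = a))) \<and>
                (\<forall>i\<in>{1..lam n}. \<forall>j\<in>{1..lam n}. i \<noteq> j \<longrightarrow>
                   univ (BB i) \<inter> univ (BB j) = univ A)))))"


section \<open>Coloured structures\<close>

text \<open>The colours are \<open>P 1, \<dots>, P l\<close>.\<close>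

definition Vcol :: "nat \<Rightarrow> (nat \<Rightarrow> 's symbol) \<Rightarrow> 's symbol set" where
  "Vcol l P = P ` {1..l}"

definition share_colour ::
    "nat \<Rightarrow> (nat \<Rightarrow> 's symbol) \<Rightarrow> ('s, 'u) fo_struct \<Rightarrow> 'u \<Rightarrow> 'u \<Rightarrow> bool" where
  "share_colour l P M b c \<longleftrightarrow> (\<exists>k\<in>{1..l}. [b] \<in> rel_of M (P k) \<and> [c] \<in> rel_of M (P k))"

definition coloured ::
    "nat \<Rightarrow> (nat \<Rightarrow> 's symbol) \<Rightarrow> 's symbol set \<Rightarrow> (nat \<Rightarrow> 's form) \<Rightarrow> ('s, 'u) fo_struct \<Rightarrow> bool" where
  "coloured l P Vrel \<theta> M \<longleftrightarrow>
     (\<forall>a\<in>univ M. (\<exists>i\<in>{1..l}. [a] \<in> rel_of M (P i)) \<longleftrightarrow> a \<notin> cl \<theta> M {}) \<and>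
     (\<forall>R\<in>Vrel. \<forall>as\<in>rel_of M R. \<not> set as \<subseteq> cl \<theta> M {}) \<and>
     (\<forall>a\<in>univ M - cl \<theta> M {}. \<forall>b\<in>univ M - cl \<theta> M {}. \<forall>i\<in>{1..l}. \<forall>j\<in>{1..l}.
        a \<in> cl \<theta> M {b} \<and> i \<noteq> j \<longrightarrow> \<not> ([a] \<in> rel_of M (P i) \<and> [b] \<in> rel_of M (P j))) \<and>
     (\<forall>R\<in>Vrel. \<forall>as\<in>rel_of M R.
        \<exists>b\<in>cl \<theta> M (set as) - cl \<theta> M {}. \<exists>c\<in>cl \<theta> M (set as) - cl \<theta> M {}.
          \<not> share_colour l P M b c)"

definition strongly_coloured ::
    "nat \<Rightarrow> (nat \<Rightarrow> 's symbol) \<Rightarrow> 's symbol set \<Rightarrow> (nat \<Rightarrow> 's form) \<Rightarrow> ('s, 'u) fo_struct \<Rightarrow> bool" where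
  "strongly_coloured l P Vrel \<theta> M \<longleftrightarrow>
     coloured l P Vrel \<theta> M \<and>
     (\<forall>R\<in>Vrel. \<forall>as\<in>rel_of M R.
        \<forall>b\<in>cl \<theta> M (set as) - cl \<theta> M {}. \<forall>c\<in>cl \<theta> M (set as) - cl \<theta> M {}.
          b \<notin> cl \<theta> M {c} \<longrightarrow> \<not> share_colour l P M b c)"

text \<open>Below, \<open>col\<close> is \<open>coloured l P Vrel \<theta>\<close> or \<open>strongly_coloured l P Vrel \<theta>\<close>, and \<open>G\<close> is a single
  structure: \<open>expansions\<close> gives $\mathbb K_n$ and $\mathbb{SK}_n$, \<open>colourables\<close> gives
  $\mathbb C_n$ and $\mathbb S_n$.\<close>

definition expansions ::
    "nat \<Rightarrow> 's symbol set \<Rightarrow> (nat \<Rightarrow> 's symbol) \<Rightarrow> 's symbol set \<Rightarrow>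
     (('s, 'u) fo_struct \<Rightarrow> bool) \<Rightarrow> ('s, 'u) fo_struct \<Rightarrow> ('s, 'u) fo_struct set" where
  "expansions l Vpre P Vrel col G =
     {M. is_struct (Vpre \<union> Vcol l P \<union> Vrel) M \<and> reduct Vpre M = G \<and> col M}"

definition colourables ::
    "nat \<Rightarrow> 's symbol set \<Rightarrow> (nat \<Rightarrow> 's symbol) \<Rightarrow> 's symbol set \<Rightarrow>
     (('s, 'u) fo_struct \<Rightarrow> bool) \<Rightarrow> ('s, 'u) fo_struct \<Rightarrow> ('s, 'u) fo_struct set" where
  "colourables l Vpre P Vrel col G =
     {N. is_struct (Vpre \<union> Vrel) N \<and> reduct Vpre N = G \<and>
         (\<exists>M. is_struct (Vpre \<union> Vcol l P \<union> Vrel) M \<and> reduct (Vpre \<union> Vrel) M = N \<and> col M)}"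


section \<open>Measures\<close>

text \<open>Here \<open>W\<close> is the set of colours and relation symbols in question; the dimension is that
  of the pregeometry of the reduct of \<open>M\<close>, as the \<open>\<theta> m\<close> only mention its symbols.\<close>

definition dim_restrict ::
    "'s symbol set \<Rightarrow> (nat \<Rightarrow> 's form) \<Rightarrow> nat \<Rightarrow> ('s, 'u) fo_struct \<Rightarrow> ('s, 'u) fo_struct" where
  "dim_restrict W \<theta> d M =
     M\<lparr> rel_of := (\<lambda>R. if R \<in> W then {as \<in> rel_of M R. pdim (cl \<theta> M) (set as) \<le> d}
                        else rel_of M R) \<rparr>"

text \<open>\<open>cond_weight W \<theta> K r M\<close> is $\mathbb P_{n,r}(\mathcal M)$, the probability of the point
  \<open>M \<in> dim_restrict W \<theta> r ` K\<close>.\<close>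

primrec cond_weight ::
    "'s symbol set \<Rightarrow> (nat \<Rightarrow> 's form) \<Rightarrow> ('s, 'u) fo_struct set \<Rightarrow> nat \<Rightarrow>
     ('s, 'u) fo_struct \<Rightarrow> real" where
  "cond_weight W \<theta> K 0 M = 1 / real (card (dim_restrict W \<theta> 0 ` K))"
| "cond_weight W \<theta> K (Suc r) M =
     cond_weight W \<theta> K r (dim_restrict W \<theta> r M) /
     real (card {M' \<in> dim_restrict W \<theta> (Suc r) ` K.
                   dim_restrict W \<theta> r M' = dim_restrict W \<theta> r M})"

definition max_arity :: "'s symbol set \<Rightarrow> nat" where
  "max_arity Vrel = Max (arity ` Vrel)"

text \<open>$\delta^{\mathbb K}_n$ and $\delta^{\mathbb{SK}}_n$, for a set \<open>X\<close> of members of \<open>K\<close>.\<close>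

definition delta_coloured ::
    "nat \<Rightarrow> (nat \<Rightarrow> 's symbol) \<Rightarrow> 's symbol set \<Rightarrow> (nat \<Rightarrow> 's form) \<Rightarrow>
     ('s, 'u) fo_struct set \<Rightarrow> ('s, 'u) fo_struct set \<Rightarrow> real" where
  "delta_coloured l P Vrel \<theta> K X =
     (\<Sum>M\<in>X. cond_weight (Vcol l P \<union> Vrel) \<theta> K (max_arity Vrel) M)"

text \<open>The measure of a set \<open>X\<close> of colourable structures, where \<open>K = expansions \<dots> col G\<close>.\<close>

definition delta_colourable ::
    "nat \<Rightarrow> 's symbol set \<Rightarrow> (nat \<Rightarrow> 's symbol) \<Rightarrow> 's symbol set \<Rightarrow> (nat \<Rightarrow> 's form) \<Rightarrow>
     (('s, 'u) fo_struct \<Rightarrow> bool) \<Rightarrow> ('s, 'u) fo_struct \<Rightarrow> ('s, 'u) fo_struct set \<Rightarrow> real" where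
  "delta_colourable l Vpre P Vrel \<theta> col G X =
     (let K = expansions l Vpre P Vrel col G
      in delta_coloured l P Vrel \<theta> K {M \<in> K. reduct (Vpre \<union> Vrel) M \<in> X})"

definition delta_C ::
    "nat \<Rightarrow> 's symbol set \<Rightarrow> (nat \<Rightarrow> 's symbol) \<Rightarrow> 's symbol set \<Rightarrow> (nat \<Rightarrow> 's form) \<Rightarrow>
     (nat \<Rightarrow> ('s, 'u) fo_struct) \<Rightarrow> nat \<Rightarrow> 's form \<Rightarrow> real" where
  "delta_C l Vpre P Vrel \<theta> G n \<phi> =
     delta_colourable l Vpre P Vrel \<theta> (coloured l P Vrel \<theta>) (G n)
       {N \<in> colourables l Vpre P Vrel (coloured l P Vrel \<theta>) (G n). holds N \<phi> []}"

definition delta_S ::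
    "nat \<Rightarrow> 's symbol set \<Rightarrow> (nat \<Rightarrow> 's symbol) \<Rightarrow> 's symbol set \<Rightarrow> (nat \<Rightarrow> 's form) \<Rightarrow>
     (nat \<Rightarrow> ('s, 'u) fo_struct) \<Rightarrow> nat \<Rightarrow> 's form \<Rightarrow> real" where
  "delta_S l Vpre P Vrel \<theta> G n \<phi> =
     delta_colourable l Vpre P Vrel \<theta> (strongly_coloured l P Vrel \<theta>) (G n)
       {N \<in> colourables l Vpre P Vrel (strongly_coloured l P Vrel \<theta>) (G n). holds N \<phi> []}"


section \<open>Standing assumptions\<close>

text \<open>In \<open>characterised\<close>, \<open>\<eta>\<close> is $\chi_{\mathcal G_n}$.  Only the implication from \<open>\<eta>\<close> to isomorphism
  is assumed; that \<open>G n\<close> itself satisfies \<open>\<eta>\<close> is not.\<close>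

locale coloured_pregeometries =
  fixes l :: nat
    and Vpre :: "'s symbol set"
    and P :: "nat \<Rightarrow> 's symbol"
    and Vrel :: "'s symbol set"
    and \<theta> :: "nat \<Rightarrow> 's form"
    and G :: "nat \<Rightarrow> ('s, 'u) fo_struct"
  assumes two_colours: "l \<ge> 2"
    and colours: "inj_on P {1..l}" "\<And>i. i \<in> {1..l} \<Longrightarrow> is_rel (P i) \<and> arity (P i) = 1"
    and relations: "finite Vrel" "Vrel \<noteq> {}" "\<And>R. R \<in> Vrel \<Longrightarrow> is_rel R \<and> arity R \<ge> 2"
    and disjoint: "Vpre \<inter> Vcol l P = {}" "Vpre \<inter> Vrel = {}" "Vcol l P \<inter> Vrel = {}"
    and theta: "\<And>m. form_over Vpre (\<theta> m) \<and> free_vars (\<theta> m) \<subseteq> {..m}"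
    and structures: "\<And>n. is_struct Vpre (G n) \<and> finite (univ (G n))"
    and pregeometries: "\<And>n. theta_pregeometry \<theta> (G n)"
    and uniformly_bounded:
      "\<exists>f :: nat \<Rightarrow> nat. \<forall>n. \<forall>X\<subseteq>univ (G n).
         card (cl \<theta> (G n) X) \<le> f (pdim (cl \<theta> (G n)) X)"
    and closed_sets:
      "\<And>n X. closed_in \<theta> (G n) X \<Longrightarrow> \<exists>A. substructure Vpre A (G n) \<and> univ A = X"
    and closure_in_substructures:
      "\<And>n A X. closed_substructure Vpre \<theta> A (G n) \<Longrightarrow> X \<subseteq> univ A \<Longrightarrow>
         cl \<theta> A X = cl \<theta> (G n) X"
    and closed_substructures:
      "\<And>n A. closed_substructure Vpre \<theta> A (G n) \<Longrightarrow> \<exists>m. isomorphic Vpre A (G m)"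
    and dim_tendsto:
      "filterlim (\<lambda>n. pdim (cl \<theta> (G n)) (univ (G n))) at_top sequentially"
    and closure_of_empty:
      "\<And>n. \<exists>A. substructure Vpre A (G n) \<and> univ A = cl \<theta> (G n) {} \<and> isomorphic Vpre A (G 0)"
    and characterised:
      "\<And>n. \<exists>\<eta>. form_over Vpre \<eta> \<and> quantifier_free \<eta> \<and> free_vars \<eta> \<subseteq> {..<card (univ (G n))} \<and>
         (\<forall>A :: ('s, 'u) fo_struct.
            is_struct Vpre A \<and> theta_pregeometry \<theta> A \<and>
            (\<exists>xs. distinct xs \<and> set xs = univ A \<and> length xs = card (univ (G n)) \<and> holds A \<eta> xs)
            \<longrightarrow> isomorphic Vpre A (G n))"

end

theory Submission
  imports Defs
begin

text \<open>The uniform measure on the expansions would favour colourings that allow many tuples.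
  Conditioning by dimension removes this bias: every colouring is equally likely, and so forbidden
  tuples receive coins too. Whether a tuple is allowed depends only on the colours inside its
  closure. Hence the coordinates of a closed set determine the structure on it, and an extension can
  be prescribed locally. If \<open>C\<close> extends \<open>B\<close>, the coordinates of
  \<open>B\<close> are already settled by the given embedding, so only those that \<open>C\<close>
  adds are prescribed. By (A1) there are at most \<open>T\<close> of them, each with at most
  \<open>l\<close> values, which gives \<open>q = 1 - 1 / l ^ T\<close>. The extension to be
  realised lives over some other \<open>G m\<close>. It is first copied into \<open>G n\<close>
  regardless of colours and relations; what remains is a search among the self-embeddings of
  \<open>C\<close> over \<open>B\<close>, in which \<open>m\<close> no longer occurs. Only then are
  the cases counted. A sentence of quantifier rank \<open>d\<close> is decided by extensions of
  dimension at most \<open>d\<close>, since one round of the back-and-forth raises the dimension by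
  at most one.\<close>

text \<open>Choose a colour for every one-dimensional subspace and a coin for every tuple of every
  relation symbol, uniformly and independently, and let \<open>R\<close> hold of the tuples that the colouring
  allows and whose coin shows 1.  This pushes the uniform measure forward to the measure
  $\delta^{\mathbb K}_n$ (or $\delta^{\mathbb{SK}}_n$): no tuple of dimension at most 1 is allowed, and
  given the colouring the conditions on different tuples are independent.  Saturation provides
  $\lambda_n$ copies of a one-dimensional extension of a closed set \<open>B\<close> that are disjoint over \<open>B\<close>, so
  a prescribed expansion of the extension is missed with probability at most $q^{\lambda_n}$ for some
  \<open>q < 1\<close>.  Every extension already occurs inside \<open>G n\<close>, whence the number of cases is
  polynomial in $\lambda_n$, and the extension property holds with probability tending to 1.  Two
  structures with the extension property satisfy the same sentences by a back-and-forth
  argument that starts from the closures of the empty set.\<close>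

section \<open>Pregeometries\<close>

context
  fixes A :: "'a set" and c :: "'a set \<Rightarrow> 'a set"
  assumes pg: "pregeometry A c"
begin

lemma pregeometry_subset: "X \<subseteq> A \<Longrightarrow> c X \<subseteq> A"
  using pg[unfolded pregeometry_def, THEN conjunct1] by simp

lemma pregeometry_extensive: "X \<subseteq> A \<Longrightarrow> X \<subseteq> c X"
  using pg[unfolded pregeometry_def, THEN conjunct2, THEN conjunct1] by simp

lemma pregeometry_least:
  assumes X: "X \<subseteq> A" and Y: "Y \<subseteq> c X"
  shows "c Y \<subseteq> c X"
proof -
  have "Y \<subseteq> A" using Y pregeometry_subset[OF X] by (rule subset_trans)
  then show ?thesis
    using X Y pg[unfolded pregeometry_def, THEN conjunct2, THEN conjunct2, THEN conjunct1] by meson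
qed

lemma pregeometry_mono: "Y \<subseteq> A \<Longrightarrow> X \<subseteq> Y \<Longrightarrow> c X \<subseteq> c Y"
  by (rule pregeometry_least) (auto dest: pregeometry_extensive)

lemma pregeometry_idem: "X \<subseteq> A \<Longrightarrow> c (c X) = c X"
  using pregeometry_extensive[of "c X"] pregeometry_least[of X "c X"] pregeometry_subset[of X] by auto

lemma pregeometry_exchange:
  assumes "X \<subseteq> A" "b \<in> A" "a \<in> c (insert b X)" "a \<notin> c X"
  shows "b \<in> c (insert a X)"
proof -
  have "a \<in> A" using assms pregeometry_subset[of "insert b X"] by auto
  then show ?thesis
    using assms pg[unfolded pregeometry_def, THEN conjunct2, THEN conjunct2, THEN conjunct2, THEN conjunct1]
    by (simp add: Un_commute)
qed

text \<open>Steinitz exchange: a member \<open>x\<close> of \<open>I\<close> outside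
  \<open>Y\<close> is traded for some \<open>y\<close> in \<open>Y\<close>. Independence survives
  and \<open>I - Y\<close> shrinks, which is the induction measure; at the end
  \<open>I \<subseteq> Y\<close>.\<close>

lemma independent_card_le:
  assumes "finite I" "I \<subseteq> A" "\<And>x. x \<in> I \<Longrightarrow> x \<notin> c (I - {x})" "finite Y" "Y \<subseteq> A" "I \<subseteq> c Y"
  shows "card I \<le> card Y"
  using assms
proof (induction "card (I - Y)" arbitrary: I rule: less_induct)
  case less
  show ?case
  proof (cases "I \<subseteq> Y")
    case True
    then show ?thesis using less card_mono by blast
  next
    case False
    then obtain x where x: "x \<in> I" "x \<notin> Y" by auto
    have IA: "I - {x} \<subseteq> A" using less by auto
    \<comment> \<open>Otherwise \<open>x\<close>, which lies in \<open>c Y\<close>, would lie in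
      \<open>c (I - {x})\<close>, against independence.\<close>
    have "\<not> Y \<subseteq> c (I - {x})"
      using pregeometry_least[OF IA] less x by blast
    then obtain y where y: "y \<in> Y" "y \<notin> c (I - {x})" by auto
    have yI: "y \<notin> I" using pregeometry_extensive[OF IA] x y by auto
    have yA: "y \<in> A" using y less by auto
    define I' where "I' = insert y (I - {x})"
    have ind: "z \<notin> c (I' - {z})" if z: "z \<in> I'" for z
    proof (cases "z = y")
      case True
      then show ?thesis using y yI by (simp add: I'_def)
    next
      case False
      then have zI: "z \<in> I" "z \<noteq> x" using z I'_def by auto
      let ?X = "I - {x} - {z}"
      have X: "?X \<subseteq> A" using IA by auto
      have eq: "I' - {z} = insert y ?X" "insert z ?X = I - {x}" using False zI I'_def by auto
      have "z \<notin> c ?X" using less(4)[OF zI(1)] pregeometry_mono[of "I - {z}" ?X] less(3) by blast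
      then show ?thesis using pregeometry_exchange[OF X yA, of z] eq y by metis
    qed
    have I'A: "I' \<subseteq> A" using IA yA I'_def by auto
    have I'Y: "I' \<subseteq> c Y" using less(7) y pregeometry_extensive[OF less(6)] I'_def by auto
    have "I' - Y \<subset> I - Y" using x y I'_def by auto
    then have "card (I' - Y) < card (I - Y)" using less(2) by (meson finite_Diff psubset_card_mono)
    then have "card I' \<le> card Y"
      using less(1)[of I'] ind I'A I'Y less by (simp add: I'_def)
    moreover have "card I' = card I"
      using yI card_Suc_Diff1[OF less(2) x(1)] less(2) by (simp add: I'_def)
    ultimately show ?thesis by simp
  qed
qed

lemma pdim_basis:
  assumes "finite X" "X \<subseteq> A"
  shows "\<exists>Y\<subseteq>X. finite Y \<and> card Y = pdim c X \<and> X \<subseteq> c Y"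
proof -
  have "\<exists>m. \<exists>Y\<subseteq>X. finite Y \<and> card Y = m \<and> X \<subseteq> c Y"
    using assms pregeometry_extensive by blast
  from LeastI_ex[OF this] show ?thesis unfolding pdim_def .
qed

lemma pdim_le: "Y \<subseteq> X \<Longrightarrow> finite Y \<Longrightarrow> X \<subseteq> c Y \<Longrightarrow> pdim c X \<le> card Y"
  unfolding pdim_def by (rule Least_le) blast

lemma pdim_le_card: "finite X \<Longrightarrow> X \<subseteq> A \<Longrightarrow> pdim c X \<le> card X"
  using pdim_le pregeometry_extensive by blast

lemma pdim_closure_le:
  assumes "finite X" "X \<subseteq> A"
  shows "pdim c (c X) \<le> pdim c X"
proof -
  obtain Y where Y: "Y \<subseteq> X" "finite Y" "card Y = pdim c X" "X \<subseteq> c Y"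
    using pdim_basis[OF assms] by blast
  have "c X \<subseteq> c Y" using Y assms pregeometry_least by (meson order_trans)
  then show ?thesis using pdim_le[of Y "c X"] Y pregeometry_extensive[OF assms(2)] by auto
qed

text \<open>Otherwise \<open>Y - {y}\<close> would still span \<open>X\<close>, although
  \<open>Y\<close> has the least possible size.\<close>

lemma pdim_basis_independent:
  assumes "X \<subseteq> A" "Y \<subseteq> X" "finite Y" "card Y = pdim c X" "X \<subseteq> c Y" "y \<in> Y"
  shows "y \<notin> c (Y - {y})"
proof
  assume y: "y \<in> c (Y - {y})"
  have Z: "Y - {y} \<subseteq> A" using assms by auto
  have "Y \<subseteq> c (Y - {y})" using y pregeometry_extensive[OF Z] by auto
  then have "X \<subseteq> c (Y - {y})" using pregeometry_least[OF Z] assms by blast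
  then have "pdim c X \<le> card (Y - {y})" using pdim_le[of "Y - {y}" X] assms by auto
  also have "\<dots> < card Y" using assms(3,6) by (rule card_Diff1_less)
  finally show False using assms by simp
qed

text \<open>A basis \<open>Y\<close> of \<open>B\<close> together with \<open>a\<close> spans, which
  gives the upper bound. It is also independent, so exchange against a basis \<open>Z\<close> of the
  larger closed set gives the lower bound.\<close>

lemma pdim_closure_insert:
  assumes fin: "finite A" and B: "B \<subseteq> A" "c B = B" and a: "a \<in> A" "a \<notin> B"
  shows "pdim c (c (insert a B)) = Suc (pdim c B)"
proof (rule antisym)
  have finB: "finite B" using fin B finite_subset by blast
  obtain Y where Y: "Y \<subseteq> B" "finite Y" "card Y = pdim c B" "B \<subseteq> c Y"
    using pdim_basis[OF finB B(1)] by blast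
  have YA: "Y \<subseteq> A" using Y B by auto
  have aY: "a \<notin> Y" using a Y by auto
  have cY: "c Y \<subseteq> B" using Y B pregeometry_mono[of B Y] by auto
  have aYA: "insert a Y \<subseteq> A" and aB: "insert a B \<subseteq> A" using YA a B by auto
  have sub: "insert a B \<subseteq> c (insert a Y)"
    using pregeometry_extensive[OF aYA] pregeometry_mono[OF aYA, of Y] Y by auto
  have "c (insert a B) \<subseteq> c (insert a Y)" using pregeometry_least[OF aYA sub] .
  moreover have "insert a Y \<subseteq> c (insert a B)" using pregeometry_extensive[OF aB] Y by auto
  ultimately have "pdim c (c (insert a B)) \<le> card (insert a Y)"
    using pdim_le Y by (meson finite_insert)
  then show "pdim c (c (insert a B)) \<le> Suc (pdim c B)" using Y aY by simp
  have cfin: "finite (c (insert a B))" "c (insert a B) \<subseteq> A"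
    using pregeometry_subset[OF aB] fin finite_subset by auto
  obtain Z where Z: "Z \<subseteq> c (insert a B)" "finite Z" "card Z = pdim c (c (insert a B))"
      "c (insert a B) \<subseteq> c Z"
    using pdim_basis[OF cfin] by blast
  have "card (insert a Y) \<le> card Z"
  proof (rule independent_card_le)
    fix z assume z: "z \<in> insert a Y"
    show "z \<notin> c (insert a Y - {z})"
    proof (cases "z = a")
      case True
      then show ?thesis using aY cY a by auto
    next
      case False
      then have zY: "z \<in> Y" using z by auto
      have X: "Y - {z} \<subseteq> A" using YA by auto
      \<comment> \<open>If \<open>z\<close> depended on \<open>a\<close> and \<open>Y - {z}\<close>,
        exchange would put \<open>a\<close> into \<open>c Y\<close>, hence into
        \<open>B\<close>.\<close>
      have "z \<notin> c (Y - {z})" using pdim_basis_independent[OF B(1) Y zY] .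
      moreover have "insert a Y - {z} = insert a (Y - {z})" "insert z (Y - {z}) = Y"
        using False zY by auto
      ultimately show ?thesis using pregeometry_exchange[OF X a(1), of z] cY a by auto
    qed
  qed (use Y Z aYA cfin pregeometry_extensive[OF aB] in auto)
  then show "Suc (pdim c B) \<le> pdim c (c (insert a B))" using Y Z aY by simp
qed

end

lemma pdim_image:
  assumes inj: "inj_on h A" and X: "X \<subseteq> A"
    and c: "\<And>Y. Y \<subseteq> X \<Longrightarrow> c' (h ` Y) = h ` c Y" "\<And>Y. Y \<subseteq> X \<Longrightarrow> c Y \<subseteq> A"
  shows "pdim c' (h ` X) = pdim c X"
proof -
  have "(\<exists>Y\<subseteq>h ` X. finite Y \<and> card Y = m \<and> h ` X \<subseteq> c' Y) \<longleftrightarrow>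
        (\<exists>Y\<subseteq>X. finite Y \<and> card Y = m \<and> X \<subseteq> c Y)" (is "?L \<longleftrightarrow> ?R") for m
  proof
    assume ?L
    then obtain Y where Y: "Y \<subseteq> h ` X" "finite Y" "card Y = m" "h ` X \<subseteq> c' Y" by blast
    then obtain Z where Z: "Z \<subseteq> X" "inj_on h Z" "Y = h ` Z" by (meson subset_image_inj)
    have "X \<subseteq> c Z" using inj X Y Z c[OF Z(1)] by (simp add: inj_on_image_subset_iff)
    then show ?R using Y Z card_image finite_image_iff by metis
  next
    assume ?R
    then obtain Y where Y: "Y \<subseteq> X" "finite Y" "card Y = m" "X \<subseteq> c Y" by blast
    then have "card (h ` Y) = m" using inj X by (metis card_image inj_on_subset)
    then show ?L using Y c(1)[OF Y(1)] by (intro exI[of _ "h ` Y"]) auto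
  qed
  then show ?thesis unfolding pdim_def by simp
qed

section \<open>Embeddings and formulas\<close>

text \<open>A partial isomorphism given by its domain as a bare set: closure of \<open>A\<close>
  under the functions of \<open>M\<close> stands in for carrying a substructure. Maps can thus be
  extended, composed and inverted without building structures, over any vocabulary.\<close>

definition embedding_on ::
    "'s symbol set \<Rightarrow> ('u \<Rightarrow> 'v) \<Rightarrow> 'u set \<Rightarrow> ('s, 'u) fo_struct \<Rightarrow> ('s, 'v) fo_struct \<Rightarrow> bool" where
  "embedding_on V h A M N \<longleftrightarrow>
     inj_on h A \<and>
     (\<forall>f\<in>V. is_fun f \<longrightarrow> (\<forall>xs\<in>tuples A (arity f).
        fun_of M f xs \<in> A \<and> h (fun_of M f xs) = fun_of N f (map h xs))) \<and>
     (\<forall>R\<in>V. is_rel R \<longrightarrow> (\<forall>xs\<in>tuples A (arity R). xs \<in> rel_of M R \<longleftrightarrow> map h xs \<in> rel_of N R))"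

lemma tuples_map: "xs \<in> tuples A m \<Longrightarrow> map h xs \<in> tuples (h ` A) m"
  by (auto simp: tuples_def)

lemma tuples_mono: "A \<subseteq> B \<Longrightarrow> tuples A m \<subseteq> tuples B m"
  by (auto simp: tuples_def)

lemma map_inv_into_map:
  "inj_on h A \<Longrightarrow> xs \<in> tuples A m \<Longrightarrow> map (inv_into A h) (map h xs) = xs"
  by (auto simp: tuples_def intro!: map_idI)

lemma tuples_image: "tuples (h ` A) m = map h ` tuples A m"
proof
  show "tuples (h ` A) m \<subseteq> map h ` tuples A m"
  proof
    fix ys assume ys: "ys \<in> tuples (h ` A) m"
    then have "ys = map h (map (inv_into A h) ys)" "map (inv_into A h) ys \<in> tuples A m"
      by (auto simp: tuples_def f_inv_into_f subset_iff inv_into_into intro!: map_idI[symmetric])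
    then show "ys \<in> map h ` tuples A m" by blast
  qed
qed (use tuples_map in blast)

lemma isomorphism_embedding_on:
  "is_struct V M \<Longrightarrow> isomorphism V h M N \<Longrightarrow> embedding_on V h (univ M) M N \<and> h ` univ M = univ N"
  unfolding is_struct_def isomorphism_def embedding_on_def bij_betw_def by (smt (verit))

lemma embedding_on_isomorphism:
  "embedding_on V h (univ M) M N \<Longrightarrow> h ` univ M = univ N \<Longrightarrow> isomorphism V h M N"
  unfolding isomorphism_def embedding_on_def bij_betw_def by metis

lemma embedding_on_inv:
  assumes "embedding_on V h A M N"
  shows "embedding_on V (inv_into A h) (h ` A) N M"
proof -
  have inj: "inj_on h A" using assms embedding_on_def by blast
  show ?thesis
    unfolding embedding_on_def tuples_image
    using assms map_inv_into_map[OF inj] inj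
    by (auto simp: embedding_on_def inj_on_inv_into simp flip: map_map) (metis imageI inv_into_f_f)+
qed

lemma embedding_on_comp:
  assumes h: "embedding_on V h A M N" and k: "embedding_on V k (h ` A) N M'"
  shows "embedding_on V (k \<circ> h) A M M'"
proof -
  have "inj_on (k \<circ> h) A" using assms by (auto simp: embedding_on_def intro: comp_inj_on)
  then show ?thesis
    using assms tuples_map[of _ A _ h] unfolding embedding_on_def by (simp flip: map_map)
qed

lemma embedding_on_cong:
  assumes "\<And>x. x \<in> A \<Longrightarrow> h x = k x" "embedding_on V h A M N"
  shows "embedding_on V k A M N"
proof -
  have "map h xs = map k xs" if "xs \<in> tuples A m" for xs m
    using that assms by (auto simp: tuples_def)
  moreover have "inj_on k A" using assms by (metis embedding_on_def inj_on_cong)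
  ultimately show ?thesis using assms unfolding embedding_on_def by metis
qed

lemma embedding_on_subset:
  assumes "embedding_on V h A M N" "B \<subseteq> A"
    "\<And>f xs. f \<in> V \<Longrightarrow> is_fun f \<Longrightarrow> xs \<in> tuples B (arity f) \<Longrightarrow> fun_of M f xs \<in> B"
  shows "embedding_on V h B M N"
proof -
  have "inj_on h B" using assms(1,2) unfolding embedding_on_def by (meson inj_on_subset)
  moreover have "xs \<in> tuples A m" if "xs \<in> tuples B m" for xs m
    using that tuples_mono[OF assms(2)] by blast
  ultimately show ?thesis using assms(1,3) unfolding embedding_on_def by simp
qed

lemma eval_embedding_on:
  assumes "embedding_on V h A M N" "trm_over V t"
    and "\<And>x. x \<in> trm_vars t \<Longrightarrow> e x \<in> A \<and> e' x = h (e x)"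
  shows "eval M e t \<in> A \<and> eval N e' t = h (eval M e t)"
  using assms(2,3)
proof (induction t)
  case (App f ts)
  have ts: "eval M e t \<in> A" "eval N e' t = h (eval M e t)" if "t \<in> set ts" for t
    using App that by auto
  have "map (eval M e) ts \<in> tuples A (arity f)" using ts App.prems by (auto simp: tuples_def)
  moreover have "map (eval N e') ts = map h (map (eval M e) ts)" using ts by simp
  moreover have "f \<in> V" "is_fun f" using App.prems by auto
  ultimately show ?case using assms(1) unfolding embedding_on_def by (metis eval.simps(2))
qed simp

section \<open>Back-and-forth systems\<close>

fun quantifier_rank :: "'s form \<Rightarrow> nat" where
  "quantifier_rank (Neg \<phi>) = quantifier_rank \<phi>"
| "quantifier_rank (Conj \<phi> \<psi>) = max (quantifier_rank \<phi>) (quantifier_rank \<psi>)"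
| "quantifier_rank (All x \<phi>) = Suc (quantifier_rank \<phi>)"
| "quantifier_rank _ = 0"

text \<open>\<open>Z q h A\<close> says that \<open>h\<close> can be extended through
  \<open>q\<close> further rounds; each nested quantifier uses up one. Assignments are compared on
  the free variables only, so a quantifier may reassign its variable.\<close>

lemma back_and_forth:
  fixes M :: "('s, 'u) fo_struct" and N :: "('s, 'v) fo_struct"
  assumes emb: "\<And>q h A. Z q h A \<Longrightarrow> embedding_on V h A M N"
    and sub: "\<And>q h A. Z q h A \<Longrightarrow> A \<subseteq> univ M \<and> h ` A \<subseteq> univ N"
    and forward: "\<And>q h A a. Z (Suc q) h A \<Longrightarrow> a \<in> univ M \<Longrightarrow>
      \<exists>h' A'. Z q h' A' \<and> A \<subseteq> A' \<and> (\<forall>x\<in>A. h' x = h x) \<and> a \<in> A'"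
    and backward: "\<And>q h A b. Z (Suc q) h A \<Longrightarrow> b \<in> univ N \<Longrightarrow>
      \<exists>h' A'. Z q h' A' \<and> A \<subseteq> A' \<and> (\<forall>x\<in>A. h' x = h x) \<and> b \<in> h' ` A'"
    and "form_over V \<phi>" "Z q h A" "quantifier_rank \<phi> \<le> q"
    and "\<And>x. x \<in> free_vars \<phi> \<Longrightarrow> e x \<in> A \<and> e' x = h (e x)"
  shows "sat M e \<phi> \<longleftrightarrow> sat N e' \<phi>"
  using assms(5-8)
proof (induction \<phi> arbitrary: q h A e e')
  case (Eq s t)
  have "inj_on h A" using emb[OF Eq.prems(2)] embedding_on_def by blast
  moreover have "eval M e s \<in> A \<and> eval N e' s = h (eval M e s)"
    "eval M e t \<in> A \<and> eval N e' t = h (eval M e t)"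
    using eval_embedding_on[OF emb[OF Eq.prems(2)]] Eq.prems by auto
  ultimately show ?case by (simp add: inj_on_eq_iff)
next
  case (Atom R ts)
  have ts: "eval M e t \<in> A" "eval N e' t = h (eval M e t)" if t: "t \<in> set ts" for t
  proof -
    have "eval M e t \<in> A \<and> eval N e' t = h (eval M e t)"
      by (rule eval_embedding_on[OF emb[OF Atom.prems(2)]]) (use Atom.prems t in auto)
    then show "eval M e t \<in> A" "eval N e' t = h (eval M e t)" by auto
  qed
  have "map (eval M e) ts \<in> tuples A (arity R)" using ts Atom.prems by (auto simp: tuples_def)
  moreover have "map (eval N e') ts = map h (map (eval M e) ts)" using ts by simp
  moreover have "R \<in> V" "is_rel R" using Atom.prems by auto
  ultimately show ?case using emb[OF Atom.prems(2)] unfolding embedding_on_def by (metis sat.simps(3))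
next
  case (Conj \<phi> \<psi>)
  from Conj.IH(1)[OF _ Conj.prems(2), of e e'] Conj.IH(2)[OF _ Conj.prems(2), of e e'] Conj.prems
  show ?case by auto
next
  case (All x \<phi>)
  then obtain q' where q: "q = Suc q'" "quantifier_rank \<phi> \<le> q'" by (cases q) auto
  have Z: "Z (Suc q') h A" using All.prems q by simp
  have step: "sat M (e(x := a)) \<phi> \<longleftrightarrow> sat N (e'(x := h' a)) \<phi>"
    if "Z q' h' A'" "A \<subseteq> A'" "\<forall>x\<in>A. h' x = h x" "a \<in> A'" for h' A' a
  proof (rule All.IH[OF _ that(1) q(2)])
    show "(e(x := a)) y \<in> A' \<and> (e'(x := h' a)) y = h' ((e(x := a)) y)" if "y \<in> free_vars \<phi>" for y
      using All.prems(4)[of y] that \<open>A \<subseteq> A'\<close> \<open>\<forall>x\<in>A. h' x = h x\<close> \<open>a \<in> A'\<close> by auto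
  qed (use All.prems in simp)
  show ?case
  proof
    assume L: "sat M e (All x \<phi>)"
    have "sat N (e'(x := b)) \<phi>" if b: "b \<in> univ N" for b
      using backward[OF Z b] step L sub by (smt (verit) imageE sat.simps(6) subsetD)
    then show "sat N e' (All x \<phi>)" by simp
  next
    assume R: "sat N e' (All x \<phi>)"
    have "sat M (e(x := a)) \<phi>" if a: "a \<in> univ M" for a
      using forward[OF Z a] step R sub by (smt (verit) image_subset_iff sat.simps(6))
    then show "sat M e (All x \<phi>)" by simp
  qed
next
  case (Neg \<phi>)
  then show ?case using Neg.IH[OF _ Neg.prems(2), of e e'] by simp
qed simp

text \<open>A total map never has to be extended, so it is a back-and-forth system by itself for any
  number of rounds.\<close>

lemma sat_isomorphism:
  assumes "embedding_on V h (univ M) M N" "h ` univ M = univ N" "form_over V \<phi>"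
    "\<And>x. x \<in> free_vars \<phi> \<Longrightarrow> e x \<in> univ M \<and> e' x = h (e x)"
  shows "sat M e \<phi> \<longleftrightarrow> sat N e' \<phi>"
  by (rule back_and_forth[where Z = "\<lambda>q k A. k = h \<and> A = univ M" and q = "quantifier_rank \<phi>"])
     (use assms in auto)

lemma eval_reduct: "trm_over V t \<Longrightarrow> eval (reduct V M) e t = eval M e t"
  by (induction t) (auto simp: reduct_def cong: map_cong intro!: arg_cong[of _ _ "fun_of M _"])

lemma sat_reduct: "form_over V \<phi> \<Longrightarrow> sat (reduct V M) e \<phi> \<longleftrightarrow> sat M e \<phi>"
proof (induction \<phi> arbitrary: e)
  case (Atom R ts)
  have "map (eval (reduct V M) e) ts = map (eval M e) ts" using Atom by (simp add: eval_reduct)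
  then show ?case using Atom by (simp add: reduct_def del: map_eq_conv)
qed (auto simp: eval_reduct, auto simp: reduct_def)

lemma cl_reduct: "(\<And>m. form_over V (\<theta> m)) \<Longrightarrow> cl \<theta> (reduct V M) = cl \<theta> M"
  by (auto simp: cl_def holds_def sat_reduct fun_eq_iff) (auto simp: reduct_def)

text \<open>Closure is defined by the formulas \<open>\<theta> m\<close>, and isomorphisms preserve
  the truth of formulas.\<close>

lemma cl_isomorphism:
  assumes th: "\<And>m. form_over V (\<theta> m)" "\<And>m. free_vars (\<theta> m) \<subseteq> {..m}"
    and h: "embedding_on V h (univ M) M N" "h ` univ M = univ N" and X: "X \<subseteq> univ M"
  shows "cl \<theta> N (h ` X) = h ` cl \<theta> M X"
proof -
  have *: "holds M (\<theta> (length bs)) (bs @ [a]) \<longleftrightarrow>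
      holds N (\<theta> (length (map h bs))) (map h bs @ [h a])"
    if "set bs \<subseteq> X" "a \<in> univ M" for bs a
    unfolding holds_def length_map
  proof (rule sat_isomorphism[OF h th(1)])
    fix x assume "x \<in> free_vars (\<theta> (length bs))"
    \<comment> \<open>The set \<open>{..m}\<close> has \<open>m + 1\<close> elements: the indices of
      the entries of \<open>bs\<close> and the last index, which is that of
      \<open>a\<close>.\<close>
    then have "x < length (bs @ [a])" using th(2) by (force simp: less_Suc_eq_le)
    moreover have "map h bs @ [h a] = map h (bs @ [a])" by simp
    moreover have "(bs @ [a]) ! x \<in> univ M"
      using nth_mem[OF calculation(1)] that X by (auto simp: subset_iff)
    ultimately show "(if x < length (bs @ [a]) then (bs @ [a]) ! x else undefined) \<in> univ M \<and>
      (if x < length (map h bs @ [h a]) then (map h bs @ [h a]) ! x else undefined) =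
      h (if x < length (bs @ [a]) then (bs @ [a]) ! x else undefined)"
      by (simp only: length_map nth_map if_True conj_commute)
  qed
  show ?thesis
  proof (intro equalityI subsetI)
    fix b assume "b \<in> cl \<theta> N (h ` X)"
    then obtain bs where b: "b \<in> univ N" "set bs \<subseteq> h ` X" "holds N (\<theta> (length bs)) (bs @ [b])"
      by (auto simp: cl_def)
    obtain a where a: "a \<in> univ M" "b = h a" using b h by auto
    have "bs \<in> tuples (h ` X) (length bs)" using b by (simp add: tuples_def)
    then obtain as where as: "bs = map h as" "set as \<subseteq> X" unfolding tuples_image by (auto simp: tuples_def)
    show "b \<in> h ` cl \<theta> M X" using *[OF as(2) a(1)] a as b by (auto simp: cl_def)
  next
    fix b assume "b \<in> h ` cl \<theta> M X"
    then obtain a bs where b: "b = h a" "a \<in> univ M" "set bs \<subseteq> X" "holds M (\<theta> (length bs)) (bs @ [a])"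
      by (auto simp: cl_def)
    then show "b \<in> cl \<theta> N (h ` X)" using *[OF b(3,2)] h image_mono[OF b(3), of h]
      by (auto simp: cl_def intro!: exI[of _ "map h bs"])
  qed
qed

section \<open>Counting\<close>

text \<open>A function on \<open>I\<close> splits uniquely into its restrictions to the last block
  and to the rest. On the block, \<open>e m\<close> is one of at most \<open>C\<close>
  possibilities, so the share missing it is at most \<open>1 - 1 / C\<close>; as the blocks are
  disjoint, these factors multiply.\<close>

lemma card_avoid_le:
  fixes S :: "'i \<Rightarrow> 'b set" and C :: real
  assumes "finite I" "\<And>i. i \<in> I \<Longrightarrow> finite (S i)"
    and "\<And>j. j < m \<Longrightarrow> J j \<subseteq> I" "\<And>j j'. j < j' \<Longrightarrow> j' < m \<Longrightarrow> J j \<inter> J j' = {}"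
    and "\<And>j i. j < m \<Longrightarrow> i \<in> J j \<Longrightarrow> e j i \<in> S i"
    and "\<And>j. j < m \<Longrightarrow> real (card (PiE (J j) S)) \<le> C" "C \<ge> 1"
  shows "real (card {w \<in> PiE I S. \<forall>j<m. \<exists>i\<in>J j. w i \<noteq> e j i}) \<le> (1 - 1 / C) ^ m * real (card (PiE I S))"
  using assms
proof (induction m arbitrary: I)
  case (Suc m)
  let ?J = "J m" and ?I = "I - J m"
  let ?N = "\<lambda>I m. {w \<in> PiE I S. \<forall>j<m. \<exists>i\<in>J j. w i \<noteq> e j i}"
  let ?E = "\<lambda>i\<in>?J. e m i"
  let ?g = "\<lambda>w. (restrict w ?J, restrict w ?I)"
  have J: "?J \<subseteq> I" using Suc.prems by auto
  have fJ: "finite (PiE ?J S)" "finite (PiE ?I S)" "finite ?J"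
    using Suc.prems J by (auto intro!: finite_PiE intro: finite_subset)
  \<comment> \<open>The prescribed pattern is itself one of the counted functions on the block, so
    exactly one fewer misses it.\<close>
  have E: "?E \<in> PiE ?J S" using Suc.prems by auto
  have sub: "?g ` ?N I (Suc m) \<subseteq> (PiE ?J S - {?E}) \<times> ?N ?I m"
  proof
    fix p assume "p \<in> ?g ` ?N I (Suc m)"
    then obtain w where w: "w \<in> PiE I S" "\<And>j. j < Suc m \<Longrightarrow> \<exists>i\<in>J j. w i \<noteq> e j i" "p = ?g w" by auto
    have 1: "restrict w ?J \<in> PiE ?J S" "restrict w ?I \<in> PiE ?I S" using w J by auto
    have 2: "restrict w ?J \<noteq> ?E" using w(2)[of m] by (metis lessI restrict_apply')
    have 3: "\<exists>i\<in>J j. restrict w ?I i \<noteq> e j i" if j: "j < m" for j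
    proof -
      obtain i where "i \<in> J j" "w i \<noteq> e j i" using w(2)[of j] j by auto
      moreover have "J j \<inter> J m = {}" "J j \<subseteq> I" using Suc.prems(4)[of j m] Suc.prems(3)[of j] j by auto
      ultimately show ?thesis by (intro bexI[of _ i]) auto
    qed
    show "p \<in> (PiE ?J S - {?E}) \<times> ?N ?I m" using 1 2 3 w by auto
  qed
  have inj: "inj_on ?g (PiE I S)"
  proof (rule inj_onI)
    fix w w' assume w: "w \<in> PiE I S" "w' \<in> PiE I S" "?g w = ?g w'"
    show "w = w'"
    proof (rule PiE_ext[OF w(1,2)])
      fix i assume "i \<in> I"
      then show "w i = w' i" using w(3) by (cases "i \<in> ?J") (metis Diff_iff prod.inject restrict_apply')+
    qed
  qed
  have bij: "card (PiE I S) = card (PiE ?J S) * card (PiE ?I S)"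
  proof -
    have "I = ?J \<union> ?I" using J by auto
    then have "(\<Prod>i\<in>I. card (S i)) = (\<Prod>i\<in>?J. card (S i)) * (\<Prod>i\<in>?I. card (S i))"
      using prod.union_disjoint[of ?J ?I "\<lambda>i. card (S i)"] Suc.prems(1) fJ by auto
    then show ?thesis using Suc.prems(1) fJ by (simp add: card_PiE)
  qed
  have posJ: "real (card (PiE ?J S)) \<ge> 1" using E fJ by (metis One_nat_def Suc_leI card_gt_0_iff empty_iff of_nat_1 of_nat_le_iff)
  have "card (?N I (Suc m)) = card (?g ` ?N I (Suc m))"
    by (rule card_image[symmetric], rule inj_on_subset[OF inj]) auto
  also have "\<dots> \<le> card ((PiE ?J S - {?E}) \<times> ?N ?I m)"
    by (rule card_mono[OF _ sub]) (use fJ in auto)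
  also have "\<dots> = (card (PiE ?J S) - 1) * card (?N ?I m)"
    using E fJ by (simp add: card_cartesian_product)
  finally have "real (card (?N I (Suc m))) \<le> real ((card (PiE ?J S) - 1) * card (?N ?I m))"
    by (rule of_nat_mono)
  also have "\<dots> = (real (card (PiE ?J S)) - 1) * real (card (?N ?I m))" using posJ by (simp add: of_nat_diff)
  also have "\<dots> \<le> ((1 - 1 / C) * real (card (PiE ?J S))) * ((1 - 1 / C) ^ m * real (card (PiE ?I S)))"
  proof (rule mult_mono)
    have "real (card (PiE ?J S)) \<le> C" using Suc.prems by auto
    then show "real (card (PiE ?J S)) - 1 \<le> (1 - 1 / C) * real (card (PiE ?J S))"
      using Suc.prems(7) by (simp add: field_simps)
    show "real (card (?N ?I m)) \<le> (1 - 1 / C) ^ m * real (card (PiE ?I S))"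
    proof (rule Suc.IH)
      show "J j \<subseteq> ?I" if "j < m" for j using Suc.prems(3)[of j] Suc.prems(4)[of j m] that by auto
    qed (use Suc.prems in auto)
    show "0 \<le> (1 - 1 / C) * real (card (PiE ?J S))" using Suc.prems(7) by simp
  qed simp
  also have "\<dots> = (1 - 1 / C) ^ Suc m * real (card (PiE I S))" by (simp add: bij)
  finally show ?case .
qed simp

text \<open>Each monomial reduces to the limit of \<open>n * r ^ n\<close>, where \<open>r\<close>
  is the \<open>i\<close>-th root of \<open>q\<close>: its \<open>i\<close>-th power is
  \<open>n ^ i * q ^ n\<close>.\<close>

lemma poly_times_power_tendsto_0:
  fixes q :: real
  assumes "0 \<le> q" "q < 1"
  shows "(\<lambda>n. poly p (real n) * q ^ n) \<longlonglongrightarrow> 0"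
proof -
  have *: "(\<lambda>n. real n ^ i * q ^ n) \<longlonglongrightarrow> 0" for i
  proof (cases "i = 0")
    case True
    then show ?thesis using assms by (simp add: LIMSEQ_realpow_zero)
  next
    case False
    define r where "r = root i q"
    have r: "r ^ i = q" "norm r < 1" using False assms by (auto simp: r_def real_root_pow_pos2)
    have "(\<lambda>n. (real n * r ^ n) ^ i) \<longlonglongrightarrow> 0 ^ i"
      by (intro tendsto_power powser_times_n_limit_0 r)
    moreover have "(real n * r ^ n) ^ i = real n ^ i * q ^ n" for n
      by (simp add: power_mult_distrib mult.commute flip: r(1) power_mult)
    ultimately show ?thesis using False by (simp add: power_0_left)
  qed
  have "(\<lambda>n. \<Sum>i\<le>degree p. coeff p i * (real n ^ i * q ^ n)) \<longlonglongrightarrow> (\<Sum>i\<le>degree p. coeff p i * 0)"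
    by (intro tendsto_intros *)
  then show ?thesis by (simp add: poly_altdef sum_distrib_right mult.assoc)
qed

section \<open>The measures as images of uniform measures\<close>

lemma finite_tuples: "finite A \<Longrightarrow> finite (tuples A m)"
  unfolding tuples_def by (rule finite_lists_length_eq)

lemma is_struct_fun_undefined: "is_struct V M \<Longrightarrow> \<not> (f \<in> V \<and> is_fun f) \<Longrightarrow> fun_of M f xs = undefined"
  unfolding is_struct_def by metis

lemma is_struct_rel_subset: "is_struct V M \<Longrightarrow> rel_of M R \<subseteq> tuples (univ M) (arity R)"
  unfolding is_struct_def by (metis empty_subsetI)

lemma is_struct_rel_empty: "is_struct V M \<Longrightarrow> R \<notin> V \<Longrightarrow> rel_of M R = {}"
  unfolding is_struct_def by metis

context coloured_pregeometries
begin

abbreviation "U n \<equiv> univ (G n)"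
abbreviation "clo n \<equiv> cl \<theta> (G n)"
abbreviation "flat n A \<equiv> closed_in \<theta> (G n) A"

lemma finite_U: "finite (U n)"
  using structures by blast

lemma pregeometry_clo: "pregeometry (U n) (clo n)"
  using pregeometries[of n] by (simp add: theta_pregeometry_def)

lemmas clo_subset = pregeometry_subset[OF pregeometry_clo]
  and clo_extensive = pregeometry_extensive[OF pregeometry_clo]
  and clo_mono = pregeometry_mono[OF pregeometry_clo]
  and clo_least = pregeometry_least[OF pregeometry_clo]
  and clo_idem = pregeometry_idem[OF pregeometry_clo]

lemma flat_clo: "X \<subseteq> U n \<Longrightarrow> flat n (clo n X)"
  unfolding closed_in_def using clo_subset clo_idem by simp

lemma flat_subset: "flat n A \<Longrightarrow> A \<subseteq> U n"
  unfolding closed_in_def by simp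

lemma flat_least: "flat n A \<Longrightarrow> X \<subseteq> A \<Longrightarrow> clo n X \<subseteq> A"
  unfolding closed_in_def using clo_mono by metis

lemma clo_eqI: "X \<subseteq> U n \<Longrightarrow> Y \<subseteq> U n \<Longrightarrow> X \<subseteq> clo n Y \<Longrightarrow> Y \<subseteq> clo n X \<Longrightarrow> clo n X = clo n Y"
  by (intro subset_antisym clo_least)

text \<open>Exchange over the empty set: in the closure of one element, everything outside
  \<open>clo n {}\<close> generates the whole.\<close>

lemma clo_singleton_eq:
  assumes "y \<in> U n" "b \<in> clo n {y}" "b \<notin> clo n {}"
  shows "clo n {b} = clo n {y}"
proof (rule clo_eqI)
  show b: "{b} \<subseteq> U n" using assms clo_subset[of "{y}" n] by auto
  show "{y} \<subseteq> clo n {b}"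
    using pregeometry_exchange[OF pregeometry_clo, of "{}" n y b] assms by auto
qed (use assms in auto)

section \<open>Expansions as a colouring together with a set of tuples\<close>

definition points :: "nat \<Rightarrow> 'u set \<Rightarrow> 'u set set" where
  "points n A = (\<lambda>a. clo n {a}) ` (A - clo n {})"

definition slots :: "'u set \<Rightarrow> ('s symbol \<times> 'u list) set" where
  "slots A = (SIGMA R:Vrel. tuples A (arity R))"

text \<open>A colouring is a function on the one-dimensional subspaces \<open>clo n {a}\<close>.  The flag \<open>s\<close> below
  selects the strong variant.\<close>

definition colourings :: "nat \<Rightarrow> ('u set \<Rightarrow> nat) set" where
  "colourings n = (points n (U n) \<rightarrow>\<^sub>E {1..l})"

text \<open>No compatibility of \<open>x\<close> and \<open>Y\<close> is built in; that the
  colouring permits the tuples is the separate condition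
  \<open>Y \<subseteq> allowed s n x\<close>.\<close>

definition mk :: "nat \<Rightarrow> ('u set \<Rightarrow> nat) \<Rightarrow> ('s symbol \<times> 'u list) set \<Rightarrow> ('s, 'u) fo_struct" where
  "mk n x Y = \<lparr> univ = U n, fun_of = fun_of (G n),
     rel_of = (\<lambda>R. if R \<in> Vrel then {as. (R, as) \<in> Y}
                   else if R \<in> Vcol l P
                   then {[a] |a. a \<in> U n - clo n {} \<and> (\<exists>i\<in>{1..l}. R = P i \<and> x (clo n {a}) = i)}
                   else rel_of (G n) R) \<rparr>"

text \<open>Conditions (C4) and, under the flag, (C5) for one tuple, read off the colouring alone.
  Only points inside the closure of the tuple enter, which makes the condition local.\<close>

definition admissible :: "bool \<Rightarrow> nat \<Rightarrow> ('u set \<Rightarrow> nat) \<Rightarrow> 'u list \<Rightarrow> bool" where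
  "admissible s n x as \<longleftrightarrow>
     (\<exists>b\<in>clo n (set as) - clo n {}. \<exists>b'\<in>clo n (set as) - clo n {}. x (clo n {b}) \<noteq> x (clo n {b'})) \<and>
     (s \<longrightarrow> (\<forall>b\<in>clo n (set as) - clo n {}. \<forall>b'\<in>clo n (set as) - clo n {}.
        b \<notin> clo n {b'} \<longrightarrow> x (clo n {b}) \<noteq> x (clo n {b'})))"

definition allowed :: "bool \<Rightarrow> nat \<Rightarrow> ('u set \<Rightarrow> nat) \<Rightarrow> ('s symbol \<times> 'u list) set" where
  "allowed s n x = {(R, as) \<in> slots (U n). admissible s n x as}"

abbreviation "Lang \<equiv> Vpre \<union> Vcol l P \<union> Vrel"
abbreviation "W \<equiv> Vcol l P \<union> Vrel"

definition coloured_variant :: "bool \<Rightarrow> ('s, 'u) fo_struct \<Rightarrow> bool" where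
  "coloured_variant s = (if s then strongly_coloured l P Vrel \<theta> else coloured l P Vrel \<theta>)"

abbreviation "Exps s n \<equiv> expansions l Vpre P Vrel (coloured_variant s) (G n)"

lemma finite_slots: "finite A \<Longrightarrow> finite (slots A)"
  unfolding slots_def using relations(1) finite_tuples by auto

lemma finite_allowed: "finite (allowed s n x)"
  by (rule finite_subset[OF _ finite_slots[OF finite_U[of n]]]) (auto simp: allowed_def)

lemma finite_points: "finite A \<Longrightarrow> finite (points n A)"
  unfolding points_def by simp

lemma finite_colourings: "finite (colourings n)"
  unfolding colourings_def using finite_points[OF finite_U] by (intro finite_PiE) auto

lemma colourings_nonempty: "colourings n \<noteq> {}"
  unfolding colourings_def using two_colours by (auto simp: PiE_eq_empty_iff)

lemma colour_in: "x \<in> colourings n \<Longrightarrow> a \<in> U n - clo n {} \<Longrightarrow> x (clo n {a}) \<in> {1..l}"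
  unfolding colourings_def points_def by blast

lemma univ_mk [simp]: "univ (mk n x Y) = U n"
  and fun_of_mk [simp]: "fun_of (mk n x Y) = fun_of (G n)"
  by (simp_all add: mk_def)

lemma rel_of_mk_rel: "R \<in> Vrel \<Longrightarrow> rel_of (mk n x Y) R = {as. (R, as) \<in> Y}"
  by (simp add: mk_def)

lemma P_eq_iff: "i \<in> {1..l} \<Longrightarrow> j \<in> {1..l} \<Longrightarrow> P i = P j \<longleftrightarrow> i = j"
  using colours(1) by (rule inj_on_eq_iff)

lemma P_Vcol: "i \<in> {1..l} \<Longrightarrow> P i \<in> Vcol l P"
  by (simp add: Vcol_def)

lemma P_notin: "i \<in> {1..l} \<Longrightarrow> P i \<notin> Vrel" "i \<in> {1..l} \<Longrightarrow> P i \<notin> Vpre"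
  using disjoint P_Vcol by blast+

lemma W_not_fun: "R \<in> W \<Longrightarrow> \<not> is_fun R"
proof -
  assume "R \<in> W"
  then have "is_rel R" using relations(3) colours(2) by (auto simp: Vcol_def)
  then show "\<not> is_fun R" by (cases R) auto
qed

lemma rel_of_mk_col:
  assumes "i \<in> {1..l}"
  shows "rel_of (mk n x Y) (P i) = {[a] |a. a \<in> U n - clo n {} \<and> x (clo n {a}) = i}"
  using assms by (auto simp: mk_def P_Vcol P_notin P_eq_iff)

lemma rel_of_mk_pre: "R \<notin> W \<Longrightarrow> rel_of (mk n x Y) R = rel_of (G n) R"
  by (simp add: mk_def)

lemma rel_of_G_W: "R \<in> W \<Longrightarrow> rel_of (G n) R = {}"
  using is_struct_rel_empty[of Vpre "G n" R] structures[of n] disjoint by blast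

lemma reduct_mk: "reduct Vpre (mk n x Y) = G n"
proof -
  have "fun_of (G n) f = (\<lambda>_. undefined)" if "f \<notin> Vpre" for f
    using structures[of n] that is_struct_fun_undefined by (metis (no_types) ext)
  moreover have "rel_of (G n) R = {}" if "R \<notin> Vpre" for R
    using structures[of n] that is_struct_rel_empty by metis
  moreover have "rel_of (mk n x Y) R = rel_of (G n) R" if "R \<in> Vpre" for R
    using that disjoint by (intro rel_of_mk_pre) auto
  ultimately show ?thesis unfolding reduct_def by (auto intro!: fo_struct.equality simp: fun_eq_iff)
qed

lemma cl_expansion: "reduct Vpre M = G n \<Longrightarrow> cl \<theta> M = clo n"
  using cl_reduct[of Vpre \<theta> M] theta by auto

lemma cl_mk [simp]: "cl \<theta> (mk n x Y) = clo n"
  by (rule cl_expansion[OF reduct_mk])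

lemma is_struct_mk: "Y \<subseteq> slots (U n) \<Longrightarrow> is_struct Lang (mk n x Y)"
proof -
  assume Y: "Y \<subseteq> slots (U n)"
  have "if f \<in> Lang \<and> is_fun f \<and> xs \<in> tuples (U n) (arity f)
        then fun_of (G n) f xs \<in> U n else fun_of (G n) f xs = undefined" for f xs
    using structures[of n] W_not_fun unfolding is_struct_def by (metis Un_iff)
  moreover have "if R \<in> Lang \<and> is_rel R
        then rel_of (mk n x Y) R \<subseteq> tuples (U n) (arity R) else rel_of (mk n x Y) R = {}" for R
  proof -
    consider "R \<in> Vrel" | i where "i \<in> {1..l}" "R = P i" | "R \<notin> W" unfolding Vcol_def by blast
    then show ?thesis
    proof cases
      case 1
      then show ?thesis using Y relations(3) by (auto simp: rel_of_mk_rel slots_def)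
    next
      case 2
      then show ?thesis using colours(2)[of i] P_Vcol[of i] rel_of_mk_col[of i n x Y] by (auto simp: tuples_def)
    next
      case 3
      then show ?thesis using structures[of n] unfolding rel_of_mk_pre[OF 3] is_struct_def by (metis Un_iff)
    qed
  qed
  ultimately show ?thesis unfolding is_struct_def by simp
qed

lemma share_colour_mk:
  assumes "x \<in> colourings n" "b \<in> U n - clo n {}" "b' \<in> U n - clo n {}"
  shows "share_colour l P (mk n x Y) b b' \<longleftrightarrow> x (clo n {b}) = x (clo n {b'})"
  using assms colour_in[OF assms(1,2)] unfolding share_colour_def
  by (auto simp: rel_of_mk_col simp del: atLeastAtMost_iff)

text \<open>Condition (C2) as a consequence of (C4): the closure of such a tuple is
  \<open>clo n {}\<close>, which has no coloured element.\<close>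

lemma admissible_not_subset: "admissible s n x as \<Longrightarrow> set as \<subseteq> clo n {} \<Longrightarrow> False"
  using clo_least[of "{}" n "set as"] unfolding admissible_def by auto

text \<open>(C1) and (C3) hold for every \<open>mk\<close> because colours are attached to
  one-dimensional subspaces. (C4) and (C5) are admissibility, and (C2) follows from (C4).\<close>

lemma coloured_variant_mk_iff:
  assumes x: "x \<in> colourings n" and Y: "Y \<subseteq> slots (U n)"
  shows "coloured_variant s (mk n x Y) \<longleftrightarrow> Y \<subseteq> allowed s n x"
proof -
  let ?M = "mk n x Y"
  have sub: "clo n (set as) - clo n {} \<subseteq> U n - clo n {}" if "(R, as) \<in> Y" for R as
    using that Y clo_subset[of "set as" n] by (auto simp: slots_def tuples_def)
  have 1: "\<forall>a\<in>univ ?M. (\<exists>i\<in>{1..l}. [a] \<in> rel_of ?M (P i)) \<longleftrightarrow> a \<notin> cl \<theta> ?M {}"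
    using colour_in[OF x] by (auto simp: rel_of_mk_col simp del: atLeastAtMost_iff)
  have 2: "\<forall>a\<in>univ ?M - cl \<theta> ?M {}. \<forall>b\<in>univ ?M - cl \<theta> ?M {}. \<forall>i\<in>{1..l}. \<forall>j\<in>{1..l}.
        a \<in> cl \<theta> ?M {b} \<and> i \<noteq> j \<longrightarrow> \<not> ([a] \<in> rel_of ?M (P i) \<and> [b] \<in> rel_of ?M (P j))"
  proof (intro ballI impI)
    fix a b i j
    assume *: "a \<in> univ ?M - cl \<theta> ?M {}" "b \<in> univ ?M - cl \<theta> ?M {}" "i \<in> {1..l}" "j \<in> {1..l}"
      "a \<in> cl \<theta> ?M {b} \<and> i \<noteq> j"
    then have "clo n {a} = clo n {b}" using clo_singleton_eq[of b n a] by simp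
    then show "\<not> ([a] \<in> rel_of ?M (P i) \<and> [b] \<in> rel_of ?M (P j))"
      using * by (simp add: rel_of_mk_col del: atLeastAtMost_iff)
  qed
  have sh: "share_colour l P ?M b b' \<longleftrightarrow> x (clo n {b}) = x (clo n {b'})"
    if "(R, as) \<in> Y" "b \<in> clo n (set as) - clo n {}" "b' \<in> clo n (set as) - clo n {}" for R as b b'
    by (rule share_colour_mk[OF x]) (use sub that in blast)+
  have Yrel: "(\<forall>R\<in>Vrel. \<forall>as\<in>rel_of ?M R. Q as) \<longleftrightarrow> (\<forall>(R, as)\<in>Y. Q as)" for Q
    using Y by (auto simp: rel_of_mk_rel slots_def)
  have main: "coloured_variant s ?M \<longleftrightarrow> (\<forall>(R, as)\<in>Y. \<not> set as \<subseteq> clo n {}) \<and> (\<forall>(R, as)\<in>Y.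
     \<exists>b\<in>clo n (set as) - clo n {}. \<exists>b'\<in>clo n (set as) - clo n {}. \<not> share_colour l P ?M b b') \<and>
     (s \<longrightarrow> (\<forall>(R, as)\<in>Y. \<forall>b\<in>clo n (set as) - clo n {}. \<forall>b'\<in>clo n (set as) - clo n {}.
        b \<notin> clo n {b'} \<longrightarrow> \<not> share_colour l P ?M b b'))"
    unfolding coloured_variant_def coloured_def strongly_coloured_def using 1 2 by (simp add: Yrel)
  have "\<dots> \<longleftrightarrow> (\<forall>(R, as)\<in>Y. admissible s n x as)" (is "?A \<and> ?B \<and> ?C \<longleftrightarrow> ?D")
  proof
    assume L: "?A \<and> ?B \<and> ?C"
    show ?D
    proof clarify
      fix R as assume RY: "(R, as) \<in> Y"
      show "admissible s n x as"
        using L RY sh[OF RY] unfolding admissible_def by (simp add: Ball_def Bex_def) blast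
    qed
  next
    assume D: ?D
    have "\<not> set as \<subseteq> clo n {} \<and>
      (\<exists>b\<in>clo n (set as) - clo n {}. \<exists>b'\<in>clo n (set as) - clo n {}. \<not> share_colour l P ?M b b') \<and>
      (s \<longrightarrow> (\<forall>b\<in>clo n (set as) - clo n {}. \<forall>b'\<in>clo n (set as) - clo n {}.
        b \<notin> clo n {b'} \<longrightarrow> \<not> share_colour l P ?M b b'))" if RY: "(R, as) \<in> Y" for R as
    proof -
      have adm: "admissible s n x as" using D RY by auto
      from adm[unfolded admissible_def] sh[OF RY] admissible_not_subset[OF adm] show ?thesis
        by (simp add: Ball_def Bex_def) blast
    qed
    then show "?A \<and> ?B \<and> ?C" by blast
  qed
  then show ?thesis using main Y by (auto simp: allowed_def)
qed

lemma expansion_is_mk: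
  assumes "M \<in> Exps s n"
  shows "\<exists>x\<in>colourings n. \<exists>Y\<subseteq>slots (U n). M = mk n x Y"
proof -
  have outcome: "is_struct Lang M" and red: "reduct Vpre M = G n" and "coloured_variant s M"
    using assms by (auto simp: expansions_def)
  then have col: "coloured l P Vrel \<theta> M"
    by (auto simp: coloured_variant_def strongly_coloured_def split: if_splits)
  have univ: "univ M = U n" using arg_cong[OF red, of univ] by (simp add: reduct_def)
  have fn: "(\<lambda>f. if f \<in> Vpre then fun_of M f else (\<lambda>_. undefined)) = fun_of (G n)"
    using arg_cong[OF red, of fun_of] by (simp add: reduct_def)
  have rl: "(\<lambda>R. if R \<in> Vpre then rel_of M R else {}) = rel_of (G n)"
    using arg_cong[OF red, of rel_of] by (simp add: reduct_def)
  have cl: "cl \<theta> M = clo n" by (rule cl_expansion[OF red])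
  have ex: "\<forall>a\<in>U n. (\<exists>i\<in>{1..l}. [a] \<in> rel_of M (P i)) \<longleftrightarrow> a \<notin> clo n {}"
    using col[unfolded coloured_def, THEN conjunct1] by (simp only: univ cl)
  have uq: "\<forall>a\<in>U n - clo n {}. \<forall>b\<in>U n - clo n {}. \<forall>i\<in>{1..l}. \<forall>j\<in>{1..l}.
        a \<in> clo n {b} \<and> i \<noteq> j \<longrightarrow> \<not> ([a] \<in> rel_of M (P i) \<and> [b] \<in> rel_of M (P j))"
    using col[unfolded coloured_def, THEN conjunct2, THEN conjunct2, THEN conjunct1]
    by (simp only: univ cl)
  \<comment> \<open>(C1) makes the choice possible; by (C3) the colour is unique, and equal for
    elements of the same one-dimensional subspace.\<close>
  define f where "f a = (SOME i. i \<in> {1..l} \<and> [a] \<in> rel_of M (P i))" for a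
  have f: "f a \<in> {1..l} \<and> [a] \<in> rel_of M (P (f a))" if "a \<in> U n - clo n {}" for a
    unfolding f_def by (rule someI_ex) (use ex that in blast)
  have f_eq: "f a = f b" if "a \<in> U n - clo n {}" "b \<in> U n - clo n {}" "a \<in> clo n {b}" for a b
    using uq that f[OF that(1)] f[OF that(2)] by blast
  \<comment> \<open>The function \<open>f\<close> descends to one-dimensional subspaces, whatever
    representative is picked.\<close>
  define x where "x = (\<lambda>p\<in>points n (U n). f (SOME a. a \<in> U n - clo n {} \<and> p = clo n {a}))"
  have x: "x (clo n {a}) = f a" if a: "a \<in> U n - clo n {}" for a
  proof -
    have p: "clo n {a} \<in> points n (U n)" using a by (auto simp: points_def)
    define b where "b = (SOME b. b \<in> U n - clo n {} \<and> clo n {a} = clo n {b})"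
    have "b \<in> U n - clo n {} \<and> clo n {a} = clo n {b}"
      unfolding b_def by (rule someI_ex) (use a in blast)
    moreover from this have "b \<in> clo n {a}" using clo_extensive[of "{b}" n] by auto
    ultimately have "f b = f a" using f_eq a by blast
    then show ?thesis unfolding x_def using p b_def by simp
  qed
  have xc: "x \<in> colourings n"
    unfolding colourings_def
  proof (rule PiE_I)
    fix p assume "p \<in> points n (U n)"
    then obtain a where "a \<in> U n - clo n {}" "p = clo n {a}" by (auto simp: points_def)
    then show "x p \<in> {1..l}" using x f by auto
  qed (simp add: x_def)
  have relW: "rel_of M R \<subseteq> tuples (U n) (arity R)" if "R \<in> W" for R
    using is_struct_rel_subset[OF outcome, of R] by (simp add: univ)
  define Y where "Y = {(R, as). R \<in> Vrel \<and> as \<in> rel_of M R}"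
  have Y: "Y \<subseteq> slots (U n)" using relW by (auto simp: Y_def slots_def)
  have colM: "rel_of M (P i) = {[a] |a. a \<in> U n - clo n {} \<and> x (clo n {a}) = i}" if i: "i \<in> {1..l}" for i
  proof (intro equalityI subsetI)
    fix as assume as: "as \<in> rel_of M (P i)"
    then have "as \<in> tuples (U n) 1" using relW[of "P i"] P_Vcol[OF i] colours(2)[OF i] by auto
    then obtain a where a: "as = [a]" "a \<in> U n" by (auto simp: tuples_def length_Suc_conv)
    then have a': "a \<in> U n - clo n {}" using ex as i by auto
    have "a \<in> clo n {a}" using clo_extensive[of "{a}" n] a by auto
    then have "f a = i" using uq f[OF a'] a' as a(1) i by metis
    then show "as \<in> {[a] |a. a \<in> U n - clo n {} \<and> x (clo n {a}) = i}" using a a' x by auto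
  next
    fix as assume "as \<in> {[a] |a. a \<in> U n - clo n {} \<and> x (clo n {a}) = i}"
    then show "as \<in> rel_of M (P i)" using x f by auto
  qed
  have "M = mk n x Y"
  proof (rule fo_struct.equality)
    show "fun_of M = fun_of (mk n x Y)"
    proof (intro ext)
      fix g xs
      show "fun_of M g xs = fun_of (mk n x Y) g xs"
      proof (cases "g \<in> Vpre")
        case True
        then show ?thesis using fun_cong[OF fn, of g] by simp
      next
        case False
        then have "\<not> (g \<in> Lang \<and> is_fun g)"
          using W_not_fun by blast
        then have "fun_of M g xs = undefined" using is_struct_fun_undefined[OF outcome] by metis
        then show ?thesis using False fun_cong[OF fn, of g] by (metis fun_of_mk)
      qed
    qed
    show "rel_of M = rel_of (mk n x Y)"
    proof
      fix R
      consider "R \<in> Vrel" | i where "i \<in> {1..l}" "R = P i" | "R \<notin> W" unfolding Vcol_def by blast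
      then show "rel_of M R = rel_of (mk n x Y) R"
      proof cases
        case 1
        then show ?thesis by (simp add: rel_of_mk_rel Y_def)
      next
        case 2
        then show ?thesis using rel_of_mk_col colM by simp
      next
        case 3
        have "rel_of M R = {}" if "R \<notin> Vpre" using is_struct_rel_empty[OF outcome] 3 that by blast
        then show ?thesis using fun_cong[OF rl, of R] unfolding rel_of_mk_pre[OF 3] by (auto split: if_splits)
      qed
    qed
  qed (simp_all add: univ)
  then show ?thesis using xc Y by blast
qed

lemma allowed_subset: "allowed s n x \<subseteq> slots (U n)"
  by (auto simp: allowed_def)

lemma expansions_eq: "Exps s n = {mk n x Y |x Y. x \<in> colourings n \<and> Y \<subseteq> allowed s n x}"
proof (intro equalityI subsetI)
  fix M assume M: "M \<in> Exps s n"
  then obtain x Y where xY: "x \<in> colourings n" "Y \<subseteq> slots (U n)" "M = mk n x Y"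
    using expansion_is_mk by blast
  moreover have "coloured_variant s M" using M by (simp add: expansions_def)
  ultimately show "M \<in> {mk n x Y |x Y. x \<in> colourings n \<and> Y \<subseteq> allowed s n x}"
    using coloured_variant_mk_iff by blast
next
  fix M assume "M \<in> {mk n x Y |x Y. x \<in> colourings n \<and> Y \<subseteq> allowed s n x}"
  then obtain x Y where xY: "x \<in> colourings n" "Y \<subseteq> allowed s n x" "M = mk n x Y" by blast
  then have "Y \<subseteq> slots (U n)" using allowed_subset by blast
  then show "M \<in> Exps s n"
    using xY coloured_variant_mk_iff is_struct_mk reduct_mk by (simp add: expansions_def)
qed

lemma mk_eq_iff:
  assumes "x \<in> colourings n" "x' \<in> colourings n" "Y \<subseteq> slots (U n)" "Y' \<subseteq> slots (U n)"
  shows "mk n x Y = mk n x' Y' \<longleftrightarrow> x = x' \<and> Y = Y'"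
proof
  assume eq: "mk n x Y = mk n x' Y'"
  have rel: "rel_of (mk n x Y) R = rel_of (mk n x' Y') R" for R using eq by simp
  have "x p = x' p" if p: "p \<in> points n (U n)" for p
  proof -
    obtain a where a: "a \<in> U n - clo n {}" "p = clo n {a}" using p by (auto simp: points_def)
    have i: "x p \<in> {1..l}" using colour_in[OF assms(1)] a by auto
    have "[a] \<in> rel_of (mk n x' Y') (P (x p))"
      using rel[of "P (x p)"] a unfolding rel_of_mk_col[OF i] by auto
    then show ?thesis using a unfolding rel_of_mk_col[OF i] by auto
  qed
  then have "x = x'" using assms(1,2) unfolding colourings_def by (rule PiE_ext[rotated 2])
  moreover have "(R, as) \<in> Y \<longleftrightarrow> (R, as) \<in> Y'" for R as
  proof (cases "R \<in> Vrel")
    case True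
    then show ?thesis using rel[of R] by (auto simp: rel_of_mk_rel)
  qed (use assms in \<open>auto simp: slots_def\<close>)
  ultimately show "x = x' \<and> Y = Y'" by auto
qed simp

section \<open>Restriction by dimension and the conditional weights\<close>

abbreviation "dimn n as \<equiv> pdim (clo n) (set as)"

definition upto_dim :: "nat \<Rightarrow> nat \<Rightarrow> ('s symbol \<times> 'u list) set \<Rightarrow> ('s symbol \<times> 'u list) set" where
  "upto_dim n r Y = {(R, as) \<in> Y. dimn n as \<le> r}"

lemma slots_set: "(R, as) \<in> slots A \<Longrightarrow> R \<in> Vrel \<and> set as \<subseteq> A \<and> length as = arity R"
  by (auto simp: slots_def tuples_def)

text \<open>In dimension at most 1 all elements of the closure outside \<open>clo n {}\<close> span
  the same subspace, so they have one colour, against (C4).\<close>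

lemma two_le_dimn:
  assumes "admissible s n x as" "set as \<subseteq> U n"
  shows "2 \<le> dimn n as"
proof (rule ccontr)
  assume "\<not> 2 \<le> dimn n as"
  then have d: "dimn n as \<le> 1" by simp
  obtain Y where Y: "Y \<subseteq> set as" "finite Y" "card Y = dimn n as" "set as \<subseteq> clo n Y"
    using pdim_basis[OF pregeometry_clo _ assms(2)] by auto
  have YU: "Y \<subseteq> U n" using Y assms by auto
  have sub: "clo n (set as) \<subseteq> clo n Y" by (rule clo_least[OF YU Y(4)])
  obtain b b' where b: "b \<in> clo n (set as) - clo n {}" "b' \<in> clo n (set as) - clo n {}"
    "x (clo n {b}) \<noteq> x (clo n {b'})"
    using assms(1) unfolding admissible_def by blast
  show False
  proof (cases "Y = {}")
    case True
    then show False using sub b by auto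
  next
    case False
    then have "card Y = 1" using Y d card_gt_0_iff[of Y] by linarith
    then obtain y where y: "Y = {y}" by (auto simp: card_1_singleton_iff)
    then have "clo n {b} = clo n {y}" "clo n {b'} = clo n {y}"
      using clo_singleton_eq[of y n] sub b YU by auto
    then show False using b by simp
  qed
qed

lemma dimn_zero:
  assumes "set as \<subseteq> U n" "dimn n as = 0"
  shows "set as \<subseteq> clo n {}"
  using pdim_basis[OF pregeometry_clo _ assms(1)] assms(2) by auto

lemma upto_dim_1: "upto_dim n (Suc 0) (allowed s n x) = {}"
  using two_le_dimn[of s n x] by (fastforce simp: upto_dim_def allowed_def dest: slots_set)

lemma upto_dim_max:
  assumes "Y \<subseteq> slots (U n)"
  shows "upto_dim n (max_arity Vrel) Y = Y"
proof -
  have "dimn n as \<le> max_arity Vrel" if "(R, as) \<in> Y" for R as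
  proof -
    have R: "R \<in> Vrel" "set as \<subseteq> U n" "length as = arity R" using that assms slots_set by blast+
    have "dimn n as \<le> card (set as)" by (rule pdim_le_card[OF pregeometry_clo]) (use R in auto)
    also have "\<dots> \<le> arity R" using R card_length[of as] by simp
    also have "\<dots> \<le> max_arity Vrel" using R relations by (simp add: max_arity_def)
    finally show ?thesis .
  qed
  then show ?thesis by (auto simp: upto_dim_def)
qed

lemma max_arity_ge_2: "2 \<le> max_arity Vrel"
proof -
  obtain R where R: "R \<in> Vrel" using relations by auto
  then have "arity R \<le> max_arity Vrel" using relations by (simp add: max_arity_def)
  then show ?thesis using relations(3)[OF R] by simp
qed

text \<open>A single element has dimension at most 1, so from level 1 on the whole colouring
  survives and only tuples are dropped; hence the level \<open>Suc r\<close>.\<close>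

lemma dim_restrict_Suc:
  assumes "Y \<subseteq> slots (U n)"
  shows "dim_restrict W \<theta> (Suc r) (mk n x Y) = mk n x (upto_dim n (Suc r) Y)"
proof -
  have "(if R \<in> W then {as \<in> rel_of (mk n x Y) R. dimn n as \<le> Suc r} else rel_of (mk n x Y) R) =
    rel_of (mk n x (upto_dim n (Suc r) Y)) R" for R
  proof -
    consider "R \<in> Vrel" | i where "i \<in> {1..l}" "R = P i" | "R \<notin> W" unfolding Vcol_def by blast
    then show ?thesis
    proof cases
      case 1
      then show ?thesis by (auto simp: rel_of_mk_rel upto_dim_def)
    next
      case 2
      have "pdim (clo n) {a} \<le> Suc r" if "a \<in> U n" for a
        using pdim_le_card[OF pregeometry_clo, of "{a}" n] that by simp
      then show ?thesis using 2 P_Vcol[of i] by (auto simp: rel_of_mk_col simp del: atLeastAtMost_iff)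
    next
      case 3
      then show ?thesis using rel_of_mk_pre[OF 3] by simp
    qed
  qed
  then show ?thesis unfolding dim_restrict_def cl_mk by (intro fo_struct.equality) auto
qed

text \<open>Coloured elements lie outside \<open>clo n {}\<close> and so have positive dimension,
  and allowed tuples have dimension at least 2; nothing is left at level 0.\<close>

lemma dim_restrict_0:
  assumes "Y \<subseteq> allowed s n x"
  shows "dim_restrict W \<theta> 0 (mk n x Y) = G n"
proof -
  have "(if R \<in> W then {as \<in> rel_of (mk n x Y) R. dimn n as \<le> 0} else rel_of (mk n x Y) R) =
    rel_of (G n) R" for R
  proof -
    consider "R \<in> Vrel" | i where "i \<in> {1..l}" "R = P i" | "R \<notin> W" unfolding Vcol_def by blast
    then show ?thesis
    proof cases
      case 1
      have "2 \<le> dimn n as" if "(R, as) \<in> Y" for as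
        using that assms two_le_dimn[of s n x as] slots_set by (fastforce simp: allowed_def)
      then show ?thesis using 1 rel_of_G_W[of R n] by (force simp: rel_of_mk_rel)
    next
      case 2
      have "a \<in> clo n {}" if "a \<in> U n" "pdim (clo n) {a} = 0" for a
        using dimn_zero[of "[a]" n] that by simp
      then show ?thesis using 2 P_Vcol[of i] rel_of_G_W[of R n]
        by (auto simp: rel_of_mk_col simp del: atLeastAtMost_iff)
    next
      case 3
      then show ?thesis using rel_of_mk_pre[OF 3] by simp
    qed
  qed
  then show ?thesis unfolding dim_restrict_def cl_mk by (intro fo_struct.equality) auto
qed

lemma upto_dim_subset: "upto_dim n r Y \<subseteq> Y"
  by (auto simp: upto_dim_def)

lemma upto_dim_mono: "Y \<subseteq> Z \<Longrightarrow> upto_dim n r Y \<subseteq> upto_dim n r Z"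
  by (auto simp: upto_dim_def)

lemma upto_dim_upto_dim: "r \<le> r' \<Longrightarrow> upto_dim n r (upto_dim n r' Y) = upto_dim n r Y"
  by (auto simp: upto_dim_def)

lemma allowed_slots: "Y \<subseteq> allowed s n x \<Longrightarrow> Y \<subseteq> slots (U n)"
  using allowed_subset by blast

lemma dim_restrict_image_Suc:
  "dim_restrict W \<theta> (Suc r) ` Exps s n =
     {mk n x (upto_dim n (Suc r) Y) |x Y. x \<in> colourings n \<and> Y \<subseteq> allowed s n x}"
proof -
  have "dim_restrict W \<theta> (Suc r) (mk n x Y) = mk n x (upto_dim n (Suc r) Y)"
    if "Y \<subseteq> allowed s n x" for x Y
    by (rule dim_restrict_Suc[OF allowed_slots[OF that]])
  then show ?thesis unfolding expansions_eq by (auto simp: image_iff) metis+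
qed

text \<open>Level 0 offers a single structure and level 1 the free choice of a colouring. Each later
  level contributes a factor 2 for every allowed tuple of exactly that dimension, and the exponents
  add up. The induction starts at level 1, where the exponent is 0.\<close>

lemma cond_weight_mk:
  assumes "x \<in> colourings n" "Y \<subseteq> allowed s n x"
  shows "cond_weight W \<theta> (Exps s n) (Suc r) (mk n x (upto_dim n (Suc r) Y)) =
    1 / (real (card (colourings n)) * 2 ^ card (upto_dim n (Suc r) (allowed s n x)))"
  using assms
proof (induction r arbitrary: Y)
  case 0
  let ?M = "mk n x (upto_dim n (Suc 0) Y)"
  have emp: "upto_dim n (Suc 0) Y = {}" if "Y \<subseteq> allowed s n x" for Y x
    using upto_dim_1 upto_dim_mono[OF that] by blast
  have d0: "dim_restrict W \<theta> 0 (mk n x {}) = G n" for x by (rule dim_restrict_0[of _ s]) simp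
  have im0: "dim_restrict W \<theta> 0 ` Exps s n = {G n}"
    unfolding expansions_eq using colourings_nonempty[of n] dim_restrict_0[of _ s n]
    by (auto simp: image_iff) (metis empty_subsetI)
  have "{M' \<in> dim_restrict W \<theta> (Suc 0) ` Exps s n. dim_restrict W \<theta> 0 M' = dim_restrict W \<theta> 0 ?M} =
    (\<lambda>x. mk n x {}) ` colourings n"
    unfolding dim_restrict_image_Suc using emp[OF 0(2)] emp d0 by (auto simp: image_iff) (metis empty_subsetI emp)
  moreover have "inj_on (\<lambda>x. mk n x {}) (colourings n)"
    by (rule inj_onI) (simp add: mk_eq_iff)
  ultimately show ?case using im0 by (simp add: card_image upto_dim_1)
next
  case (Suc r)
  let ?A = "allowed s n x"
  \<comment> \<open>The allowed tuples of dimension exactly \<open>Suc (Suc r)\<close>; the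
    structures with a given restriction correspond to the subsets of \<open>?D\<close>.\<close>
  let ?D = "upto_dim n (Suc (Suc r)) ?A - upto_dim n (Suc r) ?A"
  let ?Y = "upto_dim n (Suc r) Y"
  let ?M = "mk n x (upto_dim n (Suc (Suc r)) Y)"
  have sl: "upto_dim n q Z \<subseteq> slots (U n)" if "Z \<subseteq> allowed s n z" for q Z z
    using allowed_slots[OF that] upto_dim_subset by blast
  have dr: "dim_restrict W \<theta> (Suc r) (mk n z (upto_dim n (Suc (Suc r)) Z)) = mk n z (upto_dim n (Suc r) Z)"
    if "Z \<subseteq> allowed s n z" for Z z
    using dim_restrict_Suc[OF sl[OF that]] upto_dim_upto_dim by simp
  have "{M' \<in> dim_restrict W \<theta> (Suc (Suc r)) ` Exps s n.
      dim_restrict W \<theta> (Suc r) M' = dim_restrict W \<theta> (Suc r) ?M} = (\<lambda>Z. mk n x (?Y \<union> Z)) ` Pow ?D"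
    (is "?L = ?R")
  proof (intro equalityI subsetI)
    fix M' assume "M' \<in> ?L"
    then obtain z Z where z: "M' = mk n z (upto_dim n (Suc (Suc r)) Z)" "z \<in> colourings n"
        "Z \<subseteq> allowed s n z" and eq: "dim_restrict W \<theta> (Suc r) M' = dim_restrict W \<theta> (Suc r) ?M"
      unfolding dim_restrict_image_Suc by blast
    have "mk n z (upto_dim n (Suc r) Z) = mk n x ?Y"
      using eq dr[OF z(3)] dr[OF Suc.prems(2)] z(1) by simp
    \<comment> \<open>The lower level already shows all colours, so the colouring cannot differ
      within one fibre.\<close>
    then have zx: "z = x" "upto_dim n (Suc r) Z = ?Y"
      using mk_eq_iff[OF z(2) Suc.prems(1) sl[OF z(3)] sl[OF Suc.prems(2)]] by auto
    let ?Z = "upto_dim n (Suc (Suc r)) Z - upto_dim n (Suc r) Z"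
    have "upto_dim n (Suc (Suc r)) Z = ?Y \<union> ?Z" using zx(2) by (auto simp: upto_dim_def)
    moreover have "?Z \<subseteq> ?D" using z(3) zx(1) by (auto simp: upto_dim_def)
    ultimately show "M' \<in> ?R" using z(1) zx(1) by (intro image_eqI[of _ _ ?Z]) simp_all
  next
    fix M' assume "M' \<in> ?R"
    then obtain Z where Z: "Z \<subseteq> ?D" "M' = mk n x (?Y \<union> Z)" by blast
    have sub: "?Y \<union> Z \<subseteq> ?A" using Z Suc.prems(2) by (auto simp: upto_dim_def)
    have e1: "upto_dim n (Suc (Suc r)) (?Y \<union> Z) = ?Y \<union> Z" using Z by (auto simp: upto_dim_def)
    have e2: "upto_dim n (Suc r) (?Y \<union> Z) = ?Y" using Z by (auto simp: upto_dim_def)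
    have "M' \<in> dim_restrict W \<theta> (Suc (Suc r)) ` Exps s n"
      unfolding dim_restrict_image_Suc using Suc.prems(1) sub e1 Z(2) by (intro CollectI exI[of _ x] exI[of _ "?Y \<union> Z"]) simp
    moreover have "dim_restrict W \<theta> (Suc r) M' = dim_restrict W \<theta> (Suc r) ?M"
      using dr[OF sub] dr[OF Suc.prems(2)] e1 e2 Z(2) by simp
    ultimately show "M' \<in> ?L" by blast
  qed
  moreover have "inj_on (\<lambda>Z. mk n x (?Y \<union> Z)) (Pow ?D)"
  proof (rule inj_onI)
    fix Z Z' assume Z: "Z \<in> Pow ?D" "Z' \<in> Pow ?D" "mk n x (?Y \<union> Z) = mk n x (?Y \<union> Z')"
    have "?D \<subseteq> slots (U n)" using allowed_subset[of s n x] by (auto simp: upto_dim_def)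
    then have "?Y \<union> Z = ?Y \<union> Z'"
      using Z mk_eq_iff[OF Suc.prems(1,1), of "?Y \<union> Z" "?Y \<union> Z'"] sl[OF Suc.prems(2)] by blast
    moreover have "?D \<inter> ?Y = {}" using Suc.prems(2) by (auto simp: upto_dim_def)
    ultimately show "Z = Z'" using Z(1,2) by blast
  qed
  moreover have fin: "finite (upto_dim n q ?A)" for q
    by (rule finite_subset[OF upto_dim_subset finite_allowed])
  ultimately have card: "card {M' \<in> dim_restrict W \<theta> (Suc (Suc r)) ` Exps s n.
      dim_restrict W \<theta> (Suc r) M' = dim_restrict W \<theta> (Suc r) ?M} = 2 ^ card ?D"
    by (simp add: card_image card_Pow)
  have sub: "upto_dim n (Suc r) ?A \<subseteq> upto_dim n (Suc (Suc r)) ?A" by (auto simp: upto_dim_def)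
  have "card (upto_dim n (Suc (Suc r)) ?A) = card (upto_dim n (Suc r) ?A) + card ?D"
    using card_Diff_subset[OF fin sub] card_mono[OF fin sub] by simp
  then show ?case
    using Suc.IH[OF Suc.prems] card dr[OF Suc.prems(2)] by (simp add: power_add)
qed

section \<open>The product space of colours and coins\<close>

definition coord_range :: "'u set + ('s symbol \<times> 'u list) \<Rightarrow> nat set" where
  "coord_range = case_sum (\<lambda>_. {1..l}) (\<lambda>_. {0, 1})"

definition coords :: "nat \<Rightarrow> 'u set \<Rightarrow> ('u set + ('s symbol \<times> 'u list)) set" where
  "coords n A = Inl ` points n A \<union> Inr ` slots A"

definition Omega :: "nat \<Rightarrow> ('u set + ('s symbol \<times> 'u list) \<Rightarrow> nat) set" where
  "Omega n = PiE (coords n (U n)) coord_range"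

definition outcome_colouring :: "nat \<Rightarrow> ('u set + ('s symbol \<times> 'u list) \<Rightarrow> nat) \<Rightarrow> 'u set \<Rightarrow> nat" where
  "outcome_colouring n w = (\<lambda>p\<in>points n (U n). w (Inl p))"

text \<open>Coins of forbidden tuples are tossed and then discarded, so that the set of coordinates
  does not depend on the colouring.\<close>

definition outcome :: "bool \<Rightarrow> nat \<Rightarrow> ('u set + ('s symbol \<times> 'u list) \<Rightarrow> nat) \<Rightarrow> ('s, 'u) fo_struct" where
  "outcome s n w = mk n (outcome_colouring n w) {t \<in> allowed s n (outcome_colouring n w). w (Inr t) = 1}"

lemma outcome_colouring_in: "w \<in> Omega n \<Longrightarrow> outcome_colouring n w \<in> colourings n"
  by (fastforce simp: Omega_def coords_def coord_range_def outcome_colouring_def colourings_def split: sum.splits)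

lemma outcome_in_expansions: "w \<in> Omega n \<Longrightarrow> outcome s n w \<in> Exps s n"
  unfolding expansions_eq outcome_def using outcome_colouring_in by blast

lemma prod_coords:
  assumes "finite A"
  shows "(\<Prod>i\<in>coords n A. f i) = (\<Prod>p\<in>points n A. f (Inl p)) * (\<Prod>t\<in>slots A. f (Inr t))"
  unfolding coords_def using finite_points[OF assms] finite_slots[OF assms]
  by (subst prod.union_disjoint) (auto simp: prod.reindex)

lemma finite_coords: "finite A \<Longrightarrow> finite (coords n A)"
  unfolding coords_def using finite_points finite_slots by auto

lemma card_colourings: "card (colourings n) = l ^ card (points n (U n))"
  unfolding colourings_def using finite_points[OF finite_U] by (simp add: card_PiE)

lemma card_Omega: "card (Omega n) = card (colourings n) * 2 ^ card (slots (U n))"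
  unfolding Omega_def card_colourings
  using finite_coords[OF finite_U, of n n] prod_coords[OF finite_U, of "\<lambda>i. card (coord_range i)" n n]
  by (simp add: card_PiE coord_range_def numeral_2_eq_2)

lemma finite_Omega: "finite (Omega n)"
  unfolding Omega_def using finite_coords[OF finite_U]
  by (intro finite_PiE) (auto simp: coord_range_def split: sum.splits)

lemma card_Omega_pos: "card (Omega n) > 0"
  unfolding card_Omega using finite_colourings colourings_nonempty by (simp add: card_gt_0_iff)

text \<open>The fibre is a box: the points are forced by \<open>x\<close>, the coins of allowed
  tuples by \<open>Y\<close>, and the coins of forbidden tuples are free. Dividing by the size of
  \<open>Omega n\<close> leaves one factor 1/2 for each allowed tuple, as in the conditional weight
  at level \<open>max_arity Vrel\<close>, where no tuple is cut off any more.\<close>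

lemma card_fibre:
  assumes x: "x \<in> colourings n" and Y: "Y \<subseteq> allowed s n x"
  shows "real (card {w \<in> Omega n. outcome s n w = mk n x Y}) / real (card (Omega n)) =
    cond_weight W \<theta> (Exps s n) (max_arity Vrel) (mk n x Y)"
proof -
  define val' where "val' = case_sum (\<lambda>p. {x p})
    (\<lambda>t. if t \<in> allowed s n x then {if t \<in> Y then 1 else 0} else {0, 1 :: nat})"
  have Ys: "Y \<subseteq> slots (U n)" by (rule allowed_slots[OF Y])
  have eq: "outcome s n w = mk n x Y \<longleftrightarrow> outcome_colouring n w = x \<and> {t \<in> allowed s n x. w (Inr t) = 1} = Y"
    if w: "w \<in> Omega n" for w
    unfolding outcome_def
    by (subst mk_eq_iff[OF outcome_colouring_in[OF w] x _ Ys]) (use allowed_subset in auto)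
  have "{w \<in> Omega n. outcome s n w = mk n x Y} = PiE (coords n (U n)) val'"
  proof (intro equalityI subsetI)
    fix w assume "w \<in> {w \<in> Omega n. outcome s n w = mk n x Y}"
    then have w: "w \<in> Omega n" "outcome_colouring n w = x" "{t \<in> allowed s n x. w (Inr t) = 1} = Y" using eq by auto
    show "w \<in> PiE (coords n (U n)) val'"
    proof (rule PiE_I)
      fix i assume i: "i \<in> coords n (U n)"
      have wi: "w i \<in> coord_range i" using w(1) i by (auto simp: Omega_def)
      show "w i \<in> val' i"
      proof (cases i)
        case (Inl p)
        then have "p \<in> points n (U n)" using i by (auto simp: coords_def)
        then show ?thesis using w(2) Inl by (auto simp: val'_def outcome_colouring_def)
      next
        case (Inr t)
        then show ?thesis using w(3) wi by (auto simp: val'_def coord_range_def)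
      qed
    next
      fix i assume "i \<notin> coords n (U n)"
      then show "w i = undefined" using w(1) by (auto simp: Omega_def)
    qed
  next
    fix w assume w: "w \<in> PiE (coords n (U n)) val'"
    have wl: "w (Inl p) = x p" if "p \<in> points n (U n)" for p
      using PiE_mem[OF w, of "Inl p"] that by (auto simp: coords_def val'_def)
    have wr: "w (Inr t) \<in> val' (Inr t)" if "t \<in> slots (U n)" for t
      using PiE_mem[OF w, of "Inr t"] that by (auto simp: coords_def)
    have "w \<in> Omega n" unfolding Omega_def
    proof (rule PiE_I)
      fix i assume i: "i \<in> coords n (U n)"
      show "w i \<in> coord_range i"
      proof (cases i)
        case (Inl p)
        then have "p \<in> points n (U n)" using i by (auto simp: coords_def)
        then show ?thesis using wl[of p] x Inl by (auto simp: coord_range_def colourings_def)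
      next
        case (Inr t)
        then have "t \<in> slots (U n)" using i by (auto simp: coords_def)
        then show ?thesis using wr[of t] Inr by (auto simp: coord_range_def val'_def split: if_splits)
      qed
    next
      fix i assume "i \<notin> coords n (U n)"
      then show "w i = undefined" using w by auto
    qed
    moreover have "outcome_colouring n w = x"
      using x wl by (auto simp: outcome_colouring_def colourings_def intro!: ext)
    moreover have "{t \<in> allowed s n x. w (Inr t) = 1} = Y"
    proof -
      have "w (Inr t) = (if t \<in> Y then 1 else 0)" if "t \<in> allowed s n x" for t
        using wr[of t] that allowed_subset[of s n x] by (auto simp: val'_def split: if_splits)
      then show ?thesis using Y by (auto split: if_splits)
    qed
    ultimately show "w \<in> {w \<in> Omega n. outcome s n w = mk n x Y}" using eq by auto
  qed
  then have "card {w \<in> Omega n. outcome s n w = mk n x Y} = (\<Prod>t\<in>slots (U n). card (val' (Inr t)))"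
    using finite_coords[OF finite_U, of n n] prod_coords[OF finite_U, of "\<lambda>i. card (val' i)" n n]
    by (simp add: card_PiE val'_def)
  also have "\<dots> = (\<Prod>t\<in>slots (U n). if t \<in> allowed s n x then 1 else 2)"
    by (rule prod.cong) (auto simp: val'_def)
  also have "\<dots> = 2 ^ card (slots (U n) - allowed s n x)"
  proof -
    have fin: "finite (slots (U n))" by (rule finite_slots[OF finite_U])
    show ?thesis by (subst prod.If_cases[OF fin]) (simp add: Diff_eq)
  qed
  finally have c: "card {w \<in> Omega n. outcome s n w = mk n x Y} = 2 ^ card (slots (U n) - allowed s n x)" .
  have "card (slots (U n)) = card (slots (U n) - allowed s n x) + card (allowed s n x)"
    using card_Diff_subset[OF finite_allowed allowed_subset] card_mono[OF finite_slots[OF finite_U] allowed_subset]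
    by (metis le_add_diff_inverse2)
  then have O: "real (card (Omega n)) =
    real (card (colourings n)) * 2 ^ card (slots (U n) - allowed s n x) * 2 ^ card (allowed s n x)"
    unfolding card_Omega by (simp add: power_add)
  obtain r where r: "max_arity Vrel = Suc r" using max_arity_ge_2 by (cases "max_arity Vrel") auto
  have "upto_dim n (Suc r) Y = Y" "upto_dim n (Suc r) (allowed s n x) = allowed s n x"
    using upto_dim_max[of _ n] Ys allowed_subset r by metis+
  then show ?thesis unfolding c O r using cond_weight_mk[OF x Y, of r] by simp
qed

lemma delta_coloured_eq:
  "delta_coloured l P Vrel \<theta> (Exps s n) {M \<in> Exps s n. Q M} =
     real (card {w \<in> Omega n. Q (outcome s n w)}) / real (card (Omega n))"
proof -
  let ?T = "{M \<in> Exps s n. Q M}"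
  have finK: "finite (Exps s n)"
  proof (rule finite_subset)
    show "Exps s n \<subseteq> (\<lambda>(x, Y). mk n x Y) ` (colourings n \<times> Pow (slots (U n)))"
      unfolding expansions_eq using allowed_subset by fastforce
    show "finite ((\<lambda>(x, Y). mk n x Y) ` (colourings n \<times> Pow (slots (U n))))"
      using finite_colourings finite_slots[OF finite_U] by simp
  qed
  have "delta_coloured l P Vrel \<theta> (Exps s n) ?T =
    (\<Sum>M\<in>?T. real (card {w \<in> Omega n. outcome s n w = M}) / real (card (Omega n)))"
    unfolding delta_coloured_def
  proof (rule sum.cong)
    fix M assume "M \<in> ?T"
    then obtain x Y where "x \<in> colourings n" "Y \<subseteq> allowed s n x" "M = mk n x Y"
      unfolding expansions_eq by blast
    then show "cond_weight W \<theta> (Exps s n) (max_arity Vrel) M =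
      real (card {w \<in> Omega n. outcome s n w = M}) / real (card (Omega n))"
      using card_fibre by simp
  qed simp
  also have "\<dots> = (\<Sum>M\<in>?T. \<Sum>w\<in>{w \<in> {w \<in> Omega n. Q (outcome s n w)}. outcome s n w = M}. 1) / real (card (Omega n))"
    unfolding sum_divide_distrib
    by (intro sum.cong refl arg_cong2[of _ _ _ _ "(/)"]) (auto intro!: arg_cong[of _ _ card])
  also have "(\<Sum>M\<in>?T. \<Sum>w\<in>{w \<in> {w \<in> Omega n. Q (outcome s n w)}. outcome s n w = M}. 1 :: real) =
    (\<Sum>w\<in>{w \<in> Omega n. Q (outcome s n w)}. 1)"
    by (rule sum.group) (use finite_Omega finK outcome_in_expansions in auto)
  finally show ?thesis by simp
qed

end

section \<open>Embeddings between closed sets\<close>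

lemma substructure_iff_embedding_on_id:
  assumes "is_struct V S" "univ S \<subseteq> univ N"
  shows "substructure V S N \<longleftrightarrow> embedding_on V id (univ S) S N"
proof
  assume "substructure V S N"
  then show "embedding_on V id (univ S) S N"
    unfolding substructure_def embedding_on_def is_struct_def by (auto split: if_splits)
next
  assume R: "embedding_on V id (univ S) S N"
  have "rel_of S R = rel_of N R \<inter> tuples (univ S) (arity R)" if "R \<in> V" "is_rel R" for R
    using R that is_struct_rel_subset[OF assms(1), of R] unfolding embedding_on_def by auto
  then show "substructure V S N"
    using R assms unfolding substructure_def embedding_on_def by auto
qed

lemma substructure_is_struct: "substructure V S N \<Longrightarrow> is_struct V S \<and> univ S \<subseteq> univ N"
  unfolding substructure_def by blast

lemma embedding_on_id_inv: "embedding_on V id A M N \<Longrightarrow> embedding_on V id A N M"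
  using embedding_on_cong[of A "inv_into A id" id] embedding_on_inv[of V id A M N]
  by (simp add: inv_into_f_f[of id, simplified])

text \<open>Renaming of elements. It serves to replace \<open>G m\<close> by an isomorphic structure
  that literally shares a closed set with \<open>G n\<close>.\<close>

definition transport :: "'s symbol set \<Rightarrow> ('u \<Rightarrow> 'v) \<Rightarrow> ('s, 'u) fo_struct \<Rightarrow> ('s, 'v) fo_struct" where
  "transport V h M = \<lparr> univ = h ` univ M,
     fun_of = (\<lambda>f ys. if f \<in> V \<and> is_fun f \<and> ys \<in> tuples (h ` univ M) (arity f)
                      then h (fun_of M f (map (inv_into (univ M) h) ys)) else undefined),
     rel_of = (\<lambda>R. map h ` rel_of M R) \<rparr>"

lemma transport:
  assumes M: "is_struct V M" and inj: "inj_on h (univ M)"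
  shows "is_struct V (transport V h M)" "embedding_on V h (univ M) M (transport V h M)"
proof -
  have fn: "fun_of M f xs \<in> univ M" if "f \<in> V" "is_fun f" "xs \<in> tuples (univ M) (arity f)" for f xs
    using M that unfolding is_struct_def by metis
  have rl: "rel_of M R \<subseteq> tuples (univ M) (arity R)" for R by (rule is_struct_rel_subset[OF M])
  have re: "rel_of M R = {}" if "\<not> (R \<in> V \<and> is_rel R)" for R
    using M that unfolding is_struct_def by metis
  have inv: "map (inv_into (univ M) h) (map h xs) = xs" if "xs \<in> tuples (univ M) m" for xs m
    using map_inv_into_map[OF inj that] .
  show "is_struct V (transport V h M)"
    unfolding is_struct_def
  proof (intro conjI allI)
    fix f ys
    show "if f \<in> V \<and> is_fun f \<and> ys \<in> tuples (univ (transport V h M)) (arity f)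
      then fun_of (transport V h M) f ys \<in> univ (transport V h M)
      else fun_of (transport V h M) f ys = undefined"
      using fn[of f] inv[of _ "arity f"] by (auto simp: transport_def tuples_image simp del: map_map)
  next
    fix R
    show "if R \<in> V \<and> is_rel R
      then rel_of (transport V h M) R \<subseteq> tuples (univ (transport V h M)) (arity R)
      else rel_of (transport V h M) R = {}"
      using rl[of R] re[of R] by (auto simp: transport_def tuples_image)
  qed
  have "map h xs \<in> map h ` rel_of M R \<longleftrightarrow> xs \<in> rel_of M R" if "xs \<in> tuples (univ M) (arity R)" for xs R
  proof
    assume "map h xs \<in> map h ` rel_of M R"
    then obtain ys where ys: "ys \<in> rel_of M R" "map h xs = map h ys" by blast
    then have "ys = xs" using inv[OF that] inv[of ys] rl[of R] by (metis subsetD)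
    then show "xs \<in> rel_of M R" using ys by simp
  qed simp
  then show "embedding_on V h (univ M) M (transport V h M)"
    unfolding embedding_on_def transport_def
    using inj fn inv tuples_map[of _ "univ M" _ h] by (simp del: map_map)
qed

lemma univ_transport [simp]: "univ (transport V h M) = h ` univ M"
  by (simp add: transport_def)

text \<open>Only finitely many values are taken on \<open>A\<close>, so the other elements can be
  sent injectively to fresh ones.\<close>

lemma inj_extension:
  assumes "infinite (UNIV :: 'b set)" "finite U" "A \<subseteq> U" "inj_on h A"
  shows "\<exists>H :: 'a \<Rightarrow> 'b. inj_on H U \<and> (\<forall>x\<in>A. H x = h x)"
proof -
  have "finite (h ` A)" using assms finite_subset by blast
  then have "infinite (UNIV - h ` A)" using assms(1) by (rule Diff_infinite_finite)
  then obtain B where B: "finite B" "card B = card (U - A)" "B \<subseteq> UNIV - h ` A"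
    using infinite_arbitrarily_large by blast
  then obtain g where g: "bij_betw g (U - A) B" using assms(2) finite_same_card_bij[of "U - A" B] by auto
  define H where "H x = (if x \<in> A then h x else g x)" for x
  have "inj_on H U"
  proof (rule inj_onI)
    fix x y assume xy: "x \<in> U" "y \<in> U" "H x = H y"
    have gB: "g z \<in> B" if "z \<in> U - A" for z using g that by (auto simp: bij_betw_def)
    consider "x \<in> A" "y \<in> A" | "x \<in> A" "y \<notin> A" | "x \<notin> A" "y \<in> A" | "x \<notin> A" "y \<notin> A" by blast
    then show "x = y"
    proof cases
      case 1
      then show ?thesis using xy assms(4) by (simp add: H_def inj_on_eq_iff)
    next
      case 2
      then show ?thesis using xy gB[of y] B(3) imageI[of x A h] by (auto simp: H_def)
    next
      case 3
      then show ?thesis using xy gB[of x] B(3) imageI[of y A h] by (auto simp: H_def)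
    next
      case 4
      then show ?thesis using xy g by (auto simp: H_def bij_betw_def inj_on_def)
    qed
  qed
  then show ?thesis unfolding H_def by auto
qed

context coloured_pregeometries
begin

definition emb :: "('u \<Rightarrow> 'u) \<Rightarrow> nat \<Rightarrow> 'u set \<Rightarrow> nat \<Rightarrow> bool" where
  "emb h m A n \<longleftrightarrow> flat m A \<and> flat n (h ` A) \<and> embedding_on Vpre h A (G m) (G n)"

lemma flat_substructure:
  assumes "flat n A"
  obtains S where "closed_substructure Vpre \<theta> S (G n)" "univ S = A" "is_struct Vpre S"
    "embedding_on Vpre id A S (G n)"
proof -
  obtain S where S: "substructure Vpre S (G n)" "univ S = A" using closed_sets[OF assms] by blast
  have st: "is_struct Vpre S" "univ S \<subseteq> U n" using substructure_is_struct[OF S(1)] by auto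
  show ?thesis
    using that[of S] S st assms substructure_iff_embedding_on_id[OF st]
    unfolding closed_substructure_def by simp
qed

lemma flat_fun:
  assumes "flat n A" "f \<in> Vpre" "is_fun f" "xs \<in> tuples A (arity f)"
  shows "fun_of (G n) f xs \<in> A"
proof -
  obtain S where S: "closed_substructure Vpre \<theta> S (G n)" "univ S = A" "is_struct Vpre S"
      "embedding_on Vpre id A S (G n)"
    by (rule flat_substructure[OF assms(1)])
  have "fun_of S f xs \<in> A \<and> id (fun_of S f xs) = fun_of (G n) f (map id xs)"
    using S(4) assms(2-4) unfolding embedding_on_def by blast
  then show ?thesis by (metis id_apply list.map_id)
qed

lemma closed_in_univ: "closed_substructure V \<theta> S M \<Longrightarrow> closed_in \<theta> M (univ S)"
  by (simp add: closed_substructure_def)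

lemma embI_substructures:
  assumes "closed_substructure Vpre \<theta> S (G m)" "closed_substructure Vpre \<theta> T (G n)"
    "embedding_on Vpre h (univ S) S T" "h ` univ S = univ T"
  shows "emb h m (univ S) n"
proof -
  have S: "embedding_on Vpre id (univ S) S (G m)"
    using assms(1) substructure_iff_embedding_on_id substructure_is_struct
    unfolding closed_substructure_def by blast
  have T: "embedding_on Vpre id (h ` univ S) T (G n)"
    using assms(2,4) substructure_iff_embedding_on_id substructure_is_struct
    unfolding closed_substructure_def by metis
  have "embedding_on Vpre (id \<circ> (h \<circ> id)) (univ S) (G m) (G n)"
    by (rule embedding_on_comp[OF embedding_on_comp[OF embedding_on_id_inv[OF S]]]) (use assms T in simp_all)
  then show ?thesis unfolding emb_def using assms closed_in_univ by auto
qed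

lemma emb_substructures:
  assumes "emb h m A n" "closed_substructure Vpre \<theta> S (G m)" "closed_substructure Vpre \<theta> T (G n)"
    "univ S = A" "univ T = h ` A"
  shows "embedding_on Vpre h A S T"
proof -
  have S: "embedding_on Vpre id A S (G m)"
    using assms(2,4) substructure_iff_embedding_on_id substructure_is_struct
    unfolding closed_substructure_def by blast
  have T: "embedding_on Vpre id (h ` A) T (G n)"
    using assms(3,5) substructure_iff_embedding_on_id substructure_is_struct
    unfolding closed_substructure_def by metis
  have "embedding_on Vpre (id \<circ> (h \<circ> id)) A S T"
    by (rule embedding_on_comp[OF embedding_on_comp[OF S]])
      (use assms(1) embedding_on_id_inv[OF T] in \<open>simp_all add: emb_def\<close>)
  then show ?thesis by simp
qed

lemma emb_inj: "emb h m A n \<Longrightarrow> inj_on h A"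
  by (simp add: emb_def embedding_on_def)

lemma emb_flat: "emb h m A n \<Longrightarrow> flat m A" "emb h m A n \<Longrightarrow> flat n (h ` A)"
  by (simp_all add: emb_def)

text \<open>By (A2) closures may be computed in the closed substructures on \<open>A\<close> and on
  its image. The map \<open>h\<close> is an isomorphism between these, and the formulas
  \<open>\<theta> m\<close> are preserved.\<close>

lemma clo_emb:
  assumes h: "emb h m A n" and X: "X \<subseteq> A"
  shows "clo n (h ` X) = h ` clo m X"
proof -
  obtain S where S: "closed_substructure Vpre \<theta> S (G m)" "univ S = A"
      "is_struct Vpre S" "embedding_on Vpre id (A) S (G m)"
    by (rule flat_substructure[OF emb_flat(1)[OF h]])
  obtain T where T: "closed_substructure Vpre \<theta> T (G n)" "univ T = h ` A"
      "is_struct Vpre T" "embedding_on Vpre id (h ` A) T (G n)"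
    by (rule flat_substructure[OF emb_flat(2)[OF h]])
  have E: "embedding_on Vpre h (univ S) S T" using emb_substructures[OF h S(1) T(1) S(2) T(2)] S(2) by simp
  have "cl \<theta> T (h ` X) = h ` cl \<theta> S X"
    by (rule cl_isomorphism[OF _ _ E]) (use theta S T X in auto)
  moreover have "cl \<theta> T (h ` X) = clo n (h ` X)"
    by (rule closure_in_substructures[OF T(1)]) (use T X in auto)
  moreover have "cl \<theta> S X = clo m X" by (rule closure_in_substructures[OF S(1)]) (use S X in simp)
  ultimately show ?thesis by simp
qed

lemma emb_comp: "emb h m A n \<Longrightarrow> emb k n (h ` A) q \<Longrightarrow> emb (k \<circ> h) m A q"
  unfolding emb_def using embedding_on_comp by (simp add: image_comp) blast

lemma emb_inv: "emb h m A n \<Longrightarrow> emb (inv_into A h) n (h ` A) m"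
  unfolding emb_def using embedding_on_inv[of Vpre h A "G m" "G n"]
  by (simp add: embedding_on_def)

lemma clo_empty_flat: "flat n A \<Longrightarrow> clo n {} \<subseteq> A"
  by (rule flat_least) auto

lemma emb_clo_empty:
  assumes "emb h m A n" "a \<in> A"
  shows "h a \<in> clo n {} \<longleftrightarrow> a \<in> clo m {}"
  using clo_emb[OF assms(1), of "{}"] clo_empty_flat[OF emb_flat(1)[OF assms(1)]] emb_inj[OF assms(1)] assms(2)
  by (auto simp: inj_on_image_mem_iff)

lemma emb_clo_singleton: "emb h m A n \<Longrightarrow> a \<in> A \<Longrightarrow> clo n {h a} = h ` clo m {a}"
  using clo_emb[of h m A n "{a}"] by simp

lemma emb_pdim:
  assumes "emb h m A n" "X \<subseteq> A"
  shows "pdim (clo n) (h ` X) = pdim (clo m) X"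
  by (rule pdim_image[OF emb_inj[OF assms(1)] assms(2)])
    (use clo_emb[OF assms(1)] flat_least[OF emb_flat(1)[OF assms(1)]] assms(2) in auto)

text \<open>Admissibility inspects only the closure of the tuple. This stays inside the closed set
  \<open>A\<close>, where \<open>h\<close> respects closure, dependence and colour.\<close>

lemma emb_admissible:
  assumes h: "emb h m A n" and as: "set as \<subseteq> A"
    and col: "\<And>a. a \<in> A - clo m {} \<Longrightarrow> x (clo m {a}) = y (clo n {h a})"
  shows "admissible s m x as \<longleftrightarrow> admissible s n y (map h as)"
proof -
  let ?D = "clo m (set as) - clo m {}"
  have sub: "clo m (set as) \<subseteq> A" by (rule flat_least[OF emb_flat(1)[OF h] as])
  have D: "clo n (set (map h as)) - clo n {} = h ` ?D"
    using clo_emb[OF h as] emb_clo_empty[OF h] sub by auto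
  have mem: "h b \<in> clo n {h b'} \<longleftrightarrow> b \<in> clo m {b'}" if "b \<in> ?D" "b' \<in> ?D" for b b'
  proof -
    have "b \<in> A" "b' \<in> A" using that sub by auto
    moreover have "clo m {b'} \<subseteq> A" by (rule flat_least[OF emb_flat(1)[OF h]]) (use calculation in simp)
    ultimately show ?thesis using emb_clo_singleton[OF h] inj_on_image_mem_iff[OF emb_inj[OF h]] by simp
  qed
  have c: "x (clo m {b}) = y (clo n {h b})" if "b \<in> ?D" for b using col that sub by auto
  show ?thesis unfolding admissible_def D using mem c by simp
qed

text \<open>Turns an embedding of expansions into conditions on single coordinates. No colour holds
  on \<open>clo m {}\<close> or on its image, which leaves the elements outside it.\<close>

lemma embedding_on_mk_iff:
  assumes h: "emb h m A n" and x: "x \<in> colourings m" and y: "y \<in> colourings n"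
  shows "embedding_on Lang h A (mk m x Y) (mk n y Z) \<longleftrightarrow>
    (\<forall>a\<in>A - clo m {}. x (clo m {a}) = y (clo n {h a})) \<and>
    (\<forall>(R, as)\<in>slots A. (R, as) \<in> Y \<longleftrightarrow> (R, map h as) \<in> Z)" (is "?L \<longleftrightarrow> ?C \<and> ?S")
proof -
  have AU: "A \<subseteq> U m" "h ` A \<subseteq> U n" using flat_subset emb_flat[OF h] by blast+
  have pre: "R \<in> Vpre \<Longrightarrow> rel_of (mk m x Y) R = rel_of (G m) R \<and> rel_of (mk n y Z) R = rel_of (G n) R" for R
    using rel_of_mk_pre disjoint by (metis Un_iff disjoint_iff)
  have E: "embedding_on Vpre h A (G m) (G n)" using h emb_def by simp
  have WR: "is_rel R" if "R \<in> W" for R using that relations(3) colours(2) by (auto simp: Vcol_def)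
  have "?L \<longleftrightarrow> (\<forall>R\<in>W. \<forall>xs\<in>tuples A (arity R). xs \<in> rel_of (mk m x Y) R \<longleftrightarrow> map h xs \<in> rel_of (mk n y Z) R)"
    using E pre W_not_fun WR unfolding embedding_on_def by (simp add: ball_Un)
  also have "\<dots> \<longleftrightarrow>
     (\<forall>i\<in>{1..l}. \<forall>a\<in>A. [a] \<in> rel_of (mk m x Y) (P i) \<longleftrightarrow> [h a] \<in> rel_of (mk n y Z) (P i)) \<and>
     (\<forall>R\<in>Vrel. \<forall>xs\<in>tuples A (arity R). xs \<in> rel_of (mk m x Y) R \<longleftrightarrow> map h xs \<in> rel_of (mk n y Z) R)"
  proof -
    have "(\<forall>xs\<in>tuples A 1. Q xs) \<longleftrightarrow> (\<forall>a\<in>A. Q [a])" for Q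
      by (auto simp: tuples_def length_Suc_conv)
    then show ?thesis using colours(2) by (simp add: ball_Un Vcol_def)
  qed
  also have "(\<forall>R\<in>Vrel. \<forall>xs\<in>tuples A (arity R). xs \<in> rel_of (mk m x Y) R \<longleftrightarrow> map h xs \<in> rel_of (mk n y Z) R)
    \<longleftrightarrow> ?S" by (auto simp: rel_of_mk_rel slots_def)
  also have "(\<forall>i\<in>{1..l}. \<forall>a\<in>A. [a] \<in> rel_of (mk m x Y) (P i) \<longleftrightarrow> [h a] \<in> rel_of (mk n y Z) (P i)) \<longleftrightarrow> ?C"
  proof -
    have 1: "[a] \<in> rel_of (mk m x Y) (P i) \<longleftrightarrow> a \<notin> clo m {} \<and> x (clo m {a}) = i"
      "[h a] \<in> rel_of (mk n y Z) (P i) \<longleftrightarrow> a \<notin> clo m {} \<and> y (clo n {h a}) = i"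
      if "i \<in> {1..l}" "a \<in> A" for i a
      using that AU emb_clo_empty[OF h] by (auto simp: rel_of_mk_col simp del: atLeastAtMost_iff)
    have 2: "x (clo m {a}) \<in> {1..l}" if "a \<in> A - clo m {}" for a
      by (rule colour_in[OF x]) (use that AU in auto)
    show ?thesis
    proof
      assume L: "\<forall>i\<in>{1..l}. \<forall>a\<in>A. [a] \<in> rel_of (mk m x Y) (P i) \<longleftrightarrow> [h a] \<in> rel_of (mk n y Z) (P i)"
      show ?C
      proof
        fix a assume a: "a \<in> A - clo m {}"
        then show "x (clo m {a}) = y (clo n {h a})" using L 1[OF 2[OF a], of a] 2[OF a] by auto
      qed
    next
      assume ?C
      then show "\<forall>i\<in>{1..l}. \<forall>a\<in>A. [a] \<in> rel_of (mk m x Y) (P i) \<longleftrightarrow> [h a] \<in> rel_of (mk n y Z) (P i)"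
        using 1 by (metis DiffI)
    qed
  qed
  finally show ?thesis .
qed

lemma embedding_on_mk_pre:
  assumes "flat m A" "flat n (h ` A)" "embedding_on Lang h A (mk m x Y) (mk n y Z)"
  shows "emb h m A n"
proof -
  have pre: "R \<in> Vpre \<Longrightarrow> rel_of (mk m x Y) R = rel_of (G m) R \<and> rel_of (mk n y Z) R = rel_of (G n) R" for R
    using rel_of_mk_pre disjoint by (metis Un_iff disjoint_iff)
  then show ?thesis using assms unfolding emb_def embedding_on_def by (simp add: ball_Un)
qed

section \<open>Saturation\<close>

text \<open>The body of polynomial saturation for one \<open>n\<close>, with \<open>r\<close> copies
  in place of \<open>lam n\<close>: the combinatorics is separated from the asymptotics.\<close>

definition saturated_at :: "nat \<Rightarrow> nat \<Rightarrow> nat \<Rightarrow> bool" where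
  "saturated_at k n r \<longleftrightarrow>
     (\<forall>A B \<G> m.
       closed_substructure Vpre \<theta> A (G n) \<and>
       is_struct Vpre \<G> \<and> isomorphic Vpre \<G> (G m) \<and>
       closed_substructure Vpre \<theta> A \<G> \<and> closed_substructure Vpre \<theta> B \<G> \<and>
       univ A \<subset> univ B \<and>
       pdim (cl \<theta> \<G>) (univ A) + 1 = pdim (cl \<theta> \<G>) (univ B) \<and>
       pdim (cl \<theta> \<G>) (univ B) \<le> k \<longrightarrow>
       (\<exists>BB :: nat \<Rightarrow> ('s, 'u) fo_struct.
          (\<forall>i\<in>{1..r}. closed_substructure Vpre \<theta> (BB i) (G n) \<and>
             (\<exists>h. isomorphism Vpre h B (BB i) \<and> (\<forall>a\<in>univ A. h a = a))) \<and>
          (\<forall>i\<in>{1..r}. \<forall>j\<in>{1..r}. i \<noteq> j \<longrightarrow> univ (BB i) \<inter> univ (BB j) = univ A)))"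

text \<open>A finite type would bound the dimensions of all \<open>G n\<close>, against
  (A3).\<close>

lemma infinite_type: "infinite (UNIV :: 'u set)"
proof
  assume fin: "finite (UNIV :: 'u set)"
  have "pdim (clo n) (U n) \<le> card (UNIV :: 'u set)" for n
    using pdim_le_card[OF pregeometry_clo, of "U n" n] finite_U card_mono[OF fin, of "U n"] by fastforce
  moreover have "\<forall>\<^sub>F n in sequentially. Suc (card (UNIV :: 'u set)) \<le> pdim (clo n) (U n)"
    using dim_tendsto unfolding filterlim_at_top by blast
  ultimately show False
    by (metis (no_types, lifting) Suc_n_not_le_n eventually_sequentially le_trans order_refl)
qed

text \<open>Saturation is applied with \<open>G n\<close> itself as the abstract structure, since
  the extension already lies inside \<open>G n\<close>.\<close>

lemma saturated_disjoint_embeddings: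
  assumes sat: "saturated_at k n r" and B: "flat n B" and a: "a \<in> U n" "a \<notin> B"
    and k: "pdim (clo n) B < k"
  shows "\<exists>h. (\<forall>i\<in>{1..r}. emb (h i) n (clo n (insert a B)) n \<and> (\<forall>b\<in>B. h i b = b)) \<and>
    (\<forall>i\<in>{1..r}. \<forall>j\<in>{1..r}. i \<noteq> j \<longrightarrow>
       h i ` clo n (insert a B) \<inter> h j ` clo n (insert a B) = B)"
proof -
  let ?C = "clo n (insert a B)"
  have BU: "insert a B \<subseteq> U n" using flat_subset[OF B] a by auto
  have dim: "pdim (clo n) ?C = Suc (pdim (clo n) B)"
    by (rule pdim_closure_insert[OF pregeometry_clo finite_U])
      (use B a in \<open>auto simp: closed_in_def\<close>)
  obtain S where S: "closed_substructure Vpre \<theta> S (G n)" "univ S = B"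
      "is_struct Vpre S" "embedding_on Vpre id (B) S (G n)"
    by (rule flat_substructure[OF B])
  obtain T where T: "closed_substructure Vpre \<theta> T (G n)" "univ T = ?C"
      "is_struct Vpre T" "embedding_on Vpre id (?C) T (G n)"
    by (rule flat_substructure[OF flat_clo[OF BU]])
  have "isomorphic Vpre (G n) (G n)"
    unfolding isomorphic_def isomorphism_def by (intro exI[of _ id]) simp
  moreover have "B \<subset> ?C" using clo_extensive[OF BU] a by auto
  ultimately obtain BB where BB: "\<forall>i\<in>{1..r}. closed_substructure Vpre \<theta> (BB i) (G n) \<and>
             (\<exists>h. isomorphism Vpre h T (BB i) \<and> (\<forall>a\<in>B. h a = a))"
      "\<forall>i\<in>{1..r}. \<forall>j\<in>{1..r}. i \<noteq> j \<longrightarrow> univ (BB i) \<inter> univ (BB j) = B"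
    using sat[unfolded saturated_at_def, rule_format, of S "G n" n T] S T structures dim k by auto
  then obtain h where h: "\<And>i. i \<in> {1..r} \<Longrightarrow> isomorphism Vpre (h i) T (BB i) \<and> (\<forall>a\<in>B. h i a = a)"
    by metis
  have e: "embedding_on Vpre (h i) ?C T (BB i) \<and> h i ` ?C = univ (BB i)" if "i \<in> {1..r}" for i
    using isomorphism_embedding_on[OF T(3), of "h i" "BB i"] h[OF that] T(2) by simp
  have "emb (h i) n ?C n" if "i \<in> {1..r}" for i
    using embI_substructures[OF T(1), of "BB i" n "h i"] e[OF that] BB(1) that T(2) by auto
  then show ?thesis using e h BB(2) by (intro exI[of _ h]) auto
qed

text \<open>Saturation asks for an ambient structure that literally contains the base in
  \<open>G n\<close>, whereas the extension sits over \<open>A\<close> in \<open>G m\<close>.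
  Renaming \<open>G m\<close> so that \<open>A\<close> becomes its image under \<open>h\<close>
  meets this demand; one copy of the renamed extension is then enough.\<close>

lemma saturated_extension:
  assumes sat: "saturated_at k n r" "r \<ge> 1" and h: "emb h m A n" and a: "a \<in> U m" "a \<notin> A"
    and k: "pdim (clo m) A < k"
  shows "\<exists>g. (\<forall>x\<in>A. g x = h x) \<and> emb g m (clo m (insert a A)) n"
proof -
  let ?C = "clo m (insert a A)"
  have A: "flat m A" "A \<subseteq> U m" using emb_flat[OF h] flat_subset by auto
  have aU: "insert a A \<subseteq> U m" using A a by auto
  have dim: "pdim (clo m) ?C = Suc (pdim (clo m) A)"
    by (rule pdim_closure_insert[OF pregeometry_clo finite_U])
      (use A a in \<open>auto simp: closed_in_def\<close>)
  have fC: "flat m ?C" by (rule flat_clo[OF aU])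
  have CU: "?C \<subseteq> U m" by (rule flat_subset[OF fC])
  have AC: "A \<subset> ?C" using clo_extensive[OF aU] a by auto
  obtain H where H: "inj_on H (U m)" "\<forall>x\<in>A. H x = h x"
    using inj_extension[OF infinite_type finite_U A(2) emb_inj[OF h]] by blast
  let ?G = "transport Vpre H (G m)"
  have HG: "is_struct Vpre ?G" "embedding_on Vpre H (U m) (G m) ?G"
    using transport[of Vpre "G m" H] structures H by auto
  have HA: "H ` A = h ` A" using H by auto
  have HX: "embedding_on Vpre H X (G m) ?G" if "flat m X" for X
    by (rule embedding_on_subset[OF HG(2) flat_subset[OF that]]) (use that flat_fun in blast)
  have clG: "cl \<theta> ?G (H ` X) = H ` clo m X" if "X \<subseteq> U m" for X
    by (rule cl_isomorphism[of Vpre]) (use theta HG that in auto)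
  have pdG: "pdim (cl \<theta> ?G) (H ` X) = pdim (clo m) X" if "X \<subseteq> U m" for X
    by (rule pdim_image[OF H(1) that]) (use clG clo_subset that in auto)
  have flG: "closed_in \<theta> ?G (H ` X)" if "flat m X" for X
    using that clG[OF flat_subset[OF that]] unfolding closed_in_def by auto
  obtain S where S: "closed_substructure Vpre \<theta> S (G n)" "univ S = h ` A" "is_struct Vpre S"
      "embedding_on Vpre id (h ` A) S (G n)"
    by (rule flat_substructure[OF emb_flat(2)[OF h]])
  \<comment> \<open>Since \<open>H\<close> agrees with \<open>h\<close> on \<open>A\<close>, this
    composite is the identity: the substructure \<open>S\<close> of \<open>G n\<close> is also a
    substructure of the renamed \<open>G m\<close>.\<close>
  have "embedding_on Vpre (H \<circ> (inv_into A h \<circ> id)) (h ` A) S ?G"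
  proof (rule embedding_on_comp[OF embedding_on_comp[OF S(4)]])
    show "embedding_on Vpre (inv_into A h) (id ` h ` A) (G n) (G m)"
      using embedding_on_inv[of Vpre h A "G m" "G n"] h by (simp add: emb_def)
    show "embedding_on Vpre H ((inv_into A h \<circ> id) ` h ` A) (G m) ?G"
      using HX[OF A(1)] emb_inj[OF h] by simp
  qed
  then have "embedding_on Vpre id (h ` A) S ?G"
    by (rule embedding_on_cong[rotated]) (use H emb_inj[OF h] in auto)
  then have SG: "closed_substructure Vpre \<theta> S ?G"
    unfolding closed_substructure_def
    using substructure_iff_embedding_on_id[OF S(3), of ?G] S(2) flG[OF A(1)] image_mono[OF A(2), of H] HA
    by simp
  obtain T where T: "closed_substructure Vpre \<theta> T (G m)" "univ T = ?C" "is_struct Vpre T"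
      "embedding_on Vpre id ?C T (G m)"
    by (rule flat_substructure[OF fC])
  let ?T = "transport Vpre H T"
  have HT: "is_struct Vpre ?T" "embedding_on Vpre H ?C T ?T"
    using transport[OF T(3), of H] inj_on_subset[OF H(1) CU] T(2) by auto
  have "embedding_on Vpre (H \<circ> (id \<circ> inv_into ?C H)) (H ` ?C) ?T ?G"
  proof (rule embedding_on_comp[OF embedding_on_comp[OF embedding_on_inv[OF HT(2)]]])
    have *: "inv_into ?C H ` H ` ?C = ?C" using inj_on_subset[OF H(1) CU] by simp
    show "embedding_on Vpre id (inv_into ?C H ` H ` ?C) T (G m)" using T(4) * by simp
    show "embedding_on Vpre H ((id \<circ> inv_into ?C H) ` H ` ?C) (G m) ?G" using HX[OF fC] * by simp
  qed
  then have "embedding_on Vpre id (H ` ?C) ?T ?G"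
    by (rule embedding_on_cong[rotated]) (auto simp: f_inv_into_f)
  then have TG: "closed_substructure Vpre \<theta> ?T ?G"
    unfolding closed_substructure_def
    using substructure_iff_embedding_on_id[OF HT(1), of ?G] T(2) flG[OF fC] image_mono[OF CU, of H]
    by simp
  have iso: "isomorphic Vpre ?G (G m)"
    unfolding isomorphic_def
    by (rule exI, rule embedding_on_isomorphism[of _ "inv_into (U m) H"])
      (use embedding_on_inv[OF HG(2)] H(1) in simp_all)
  have "univ S \<subset> univ ?T" using AC CU HA S(2) T(2) H(1)
    by (metis image_strict_mono inj_on_subset univ_transport)
  moreover have "pdim (cl \<theta> ?G) (univ S) + 1 = pdim (cl \<theta> ?G) (univ ?T)" "pdim (cl \<theta> ?G) (univ ?T) \<le> k"
    using pdG[OF A(2)] pdG[OF CU] S(2) T(2) HA dim k by auto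
  ultimately obtain BB where BB: "\<forall>i\<in>{1..r}. closed_substructure Vpre \<theta> (BB i) (G n) \<and>
             (\<exists>h. isomorphism Vpre h ?T (BB i) \<and> (\<forall>a\<in>univ S. h a = a))"
    using sat(1)[unfolded saturated_at_def, rule_format, of S ?G m ?T] S(1) SG TG iso HG(1) by blast
  then obtain q where q: "closed_substructure Vpre \<theta> (BB 1) (G n)" "isomorphism Vpre q ?T (BB 1)"
      "\<forall>a\<in>h ` A. q a = a"
    using sat(2) S(2) by fastforce
  have q': "embedding_on Vpre q (H ` ?C) ?T (BB 1)" "q ` H ` ?C = univ (BB 1)"
    using isomorphism_embedding_on[OF HT(1) q(2)] T(2) by auto
  have "emb (q \<circ> H) m (univ T) n"
    by (rule embI_substructures[OF T(1) q(1)]) (use embedding_on_comp[OF HT(2) q'(1)] T(2) q'(2) in auto)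
  moreover have "(q \<circ> H) x = h x" if "x \<in> A" for x using H(2) q(3) that by simp
  ultimately show ?thesis using T(2) by (intro exI[of _ "q \<circ> H"]) auto
qed

section \<open>Extension properties hold almost surely\<close>

text \<open>\<open>M\<close> runs through the expansions of every \<open>G m\<close>. No list of
  isomorphism types is needed, and two structures with the property can be extended against each
  other in both directions.\<close>

definition extension_property :: "bool \<Rightarrow> nat \<Rightarrow> nat \<Rightarrow> ('s, 'u) fo_struct \<Rightarrow> bool" where
  "extension_property s d n N \<longleftrightarrow>
     (\<forall>m M A a h. M \<in> Exps s m \<and> flat m A \<and> flat n (h ` A) \<and> embedding_on Lang h A M N \<and>
        pdim (clo m) A < d \<and> a \<in> U m \<longrightarrow>
        (\<exists>h'. (\<forall>x\<in>A. h' x = h x) \<and> flat n (h' ` clo m (insert a A)) \<and>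
          embedding_on Lang h' (clo m (insert a A)) M N))"

section \<open>Self-embeddings acting on coordinates\<close>

definition shift :: "('u \<Rightarrow> 'u) \<Rightarrow> 'u set + ('s symbol \<times> 'u list) \<Rightarrow> 'u set + ('s symbol \<times> 'u list)" where
  "shift k = map_sum (image k) (map_prod id (map k))"

text \<open>\<open>\<pi>\<close> prescribes the coordinates that \<open>C\<close> adds to
  \<open>B\<close>. Those of \<open>B\<close> are left out because every \<open>k\<close> considered
  fixes \<open>B\<close>, so the choice of \<open>k\<close> cannot affect them.\<close>

definition avoiding :: "nat \<Rightarrow> 'u set \<Rightarrow> 'u set \<Rightarrow> ('u set + ('s symbol \<times> 'u list) \<Rightarrow> nat) \<Rightarrow>
    ('u set + ('s symbol \<times> 'u list) \<Rightarrow> nat) set" where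
  "avoiding n B C \<pi> = {w \<in> Omega n. \<forall>k. emb k n C n \<and> (\<forall>b\<in>B. k b = b) \<longrightarrow>
     (\<exists>t\<in>coords n C - coords n B. w (shift k t) \<noteq> \<pi> t)}"

text \<open>Codes for one-dimensional extensions: the tail spans \<open>B\<close>, and the head,
  lying outside \<open>B\<close>, spans \<open>C\<close> together with it. Counting lists bounds the
  number of extensions polynomially in the size of \<open>U n\<close>.\<close>

definition pointed_lists :: "nat \<Rightarrow> nat \<Rightarrow> 'u list set" where
  "pointed_lists n d = {xs. set xs \<subseteq> U n \<and> length xs \<le> d \<and> xs \<noteq> [] \<and> hd xs \<notin> clo n (set (tl xs))}"

lemma shift_simps [simp]: "shift k (Inl p) = Inl (k ` p)" "shift k (Inr (R, as)) = Inr (R, map k as)"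
  by (simp_all add: shift_def)

lemma coords_Inl: "Inl p \<in> coords n A \<longleftrightarrow> (\<exists>a\<in>A - clo n {}. p = clo n {a})"
  by (auto simp: coords_def points_def)

lemma coords_Inr: "Inr (R, as) \<in> coords n A \<longleftrightarrow> (R, as) \<in> slots A"
  by (auto simp: coords_def)

lemma coords_cases:
  assumes "t \<in> coords n A"
  obtains (point) a where "a \<in> A" "a \<notin> clo n {}" "t = Inl (clo n {a})"
    | (slot) R as where "(R, as) \<in> slots A" "t = Inr (R, as)"
  using assms unfolding coords_def points_def by auto

lemma point_subset: "flat n A \<Longrightarrow> a \<in> A \<Longrightarrow> a \<in> clo n {a} \<and> clo n {a} \<subseteq> A"
  using clo_extensive[of "{a}" n] flat_least[of n A "{a}"] flat_subset[of n A] by auto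

lemma shift_in_coords:
  assumes k: "emb k m C n" and t: "t \<in> coords m C"
  shows "shift k t \<in> coords n (k ` C)"
  using t
proof (cases rule: coords_cases)
  case (point a)
  then show ?thesis
    using emb_clo_singleton[OF k, of a] emb_clo_empty[OF k, of a] by (auto simp: coords_Inl intro!: bexI[of _ "k a"])
next
  case (slot R as)
  then show ?thesis using tuples_map[of as C "arity R" k] by (auto simp: coords_Inr slots_def)
qed

lemma inj_on_shift:
  assumes k: "emb k n C n"
  shows "inj_on (shift k) (coords n C)"
proof (rule inj_onI)
  fix t t' assume t: "t \<in> coords n C" "t' \<in> coords n C" and eq: "shift k t = shift k t'"
  note inj = emb_inj[OF k] and C = emb_flat(1)[OF k]
  show "t = t'"
    using t(1)
  proof (cases rule: coords_cases)
    case (point a)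
    from t(2) show ?thesis
    proof (cases rule: coords_cases)
      case (point b)
      then show ?thesis
        using eq \<open>t = Inl (clo n {a})\<close> point_subset[OF C \<open>a \<in> C\<close>] point_subset[OF C \<open>b \<in> C\<close>]
          inj_on_image_eq_iff[OF inj, of "clo n {a}" "clo n {b}"] by simp
    next
      case (slot R as)
      then show ?thesis using eq \<open>t = Inl (clo n {a})\<close> by simp
    qed
  next
    case (slot R as)
    from t(2) show ?thesis
    proof (cases rule: coords_cases)
      case (point b)
      then show ?thesis using eq \<open>t = Inr (R, as)\<close> by simp
    next
      case (slot R' as')
      then have "R = R'" "map k as = map k as'" using eq \<open>t = Inr (R, as)\<close> by auto
      moreover have "set as \<subseteq> C" "set as' \<subseteq> C"
        using slot \<open>(R, as) \<in> slots C\<close> slots_set by blast+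
      ultimately have "as = as'" using map_inj_on[of k as as'] inj inj_on_subset by (metis Un_subset_iff)
      then show ?thesis using slot \<open>t = Inr (R, as)\<close> \<open>R = R'\<close> by simp
    qed
  qed
qed

text \<open>A common coordinate would involve elements that \<open>k\<close> sends into
  \<open>B\<close>, the intersection of the images. As \<open>k\<close> is injective and fixes
  \<open>B\<close>, those elements would lie in \<open>B\<close> already, and the coordinate would
  not be new.\<close>

lemma shift_images_disjoint:
  assumes k: "emb k n C n" "emb k' n C n" and B: "flat n B" "B \<subseteq> C"
    and fixB: "\<forall>b\<in>B. k b = b" and int: "k ` C \<inter> k' ` C = B"
  shows "shift k ` (coords n C - coords n B) \<inter> shift k' ` (coords n C - coords n B) = {}"
proof (rule equals0I)
  fix i assume "i \<in> shift k ` (coords n C - coords n B) \<inter> shift k' ` (coords n C - coords n B)"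
  then obtain t t' where t: "t \<in> coords n C" "t \<notin> coords n B" "t' \<in> coords n C"
    and eq: "shift k t = shift k' t'" by auto
  note C = emb_flat(1)[OF k(1)]
  have in_B: "a \<in> B" if "a \<in> C" "k a \<in> k' ` C" for a
  proof -
    have b: "k a \<in> B" using that int by blast
    then have "k (k a) = k a" using fixB by blast
    then show "a \<in> B" using emb_inj[OF k(1)] that(1) b B(2) by (metis inj_onD subsetD)
  qed
  show False
    using t(1)
  proof (cases rule: coords_cases)
    case (point a)
    from t(3) show ?thesis
    proof (cases rule: coords_cases)
      case (point b)
      have "k ` clo n {a} = k' ` clo n {b}" using eq point \<open>t = Inl (clo n {a})\<close> by simp
      then have "k a \<in> k' ` C"
        \<comment> \<open>A single shared element is enough here: a point is determined by any
          generator, so one generator in \<open>B\<close> makes it a coordinate of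
          \<open>B\<close>.\<close>
        using point_subset[OF C \<open>a \<in> C\<close>] point_subset[OF C \<open>b \<in> C\<close>] by blast
      then have "a \<in> B" using in_B \<open>a \<in> C\<close> by blast
      then show False using t(2) \<open>t = Inl (clo n {a})\<close> \<open>a \<notin> clo n {}\<close> coords_Inl by blast
    next
      case (slot R as)
      then show False using eq \<open>t = Inl (clo n {a})\<close> by simp
    qed
  next
    case (slot R as)
    from t(3) show ?thesis
    proof (cases rule: coords_cases)
      case (point b)
      then show ?thesis using eq \<open>t = Inr (R, as)\<close> by simp
    next
      case (slot R' as')
      then have "map k as = map k' as'" using eq \<open>t = Inr (R, as)\<close> by auto
      then have im: "k ` set as = k' ` set as'" by (metis list.set_map)
      have "set as \<subseteq> C" "set as' \<subseteq> C"
        using slot \<open>(R, as) \<in> slots C\<close> slots_set by blast+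
      then have "set as \<subseteq> B" using in_B im by blast
      then have "(R, as) \<in> slots B"
        using \<open>(R, as) \<in> slots C\<close> by (auto simp: slots_def tuples_def)
      then show False using t(2) \<open>t = Inr (R, as)\<close> coords_Inr by blast
    qed
  qed
qed

lemma coord_range_shift [simp]: "coord_range (shift k t) = coord_range t"
  by (cases t) (auto simp: coord_range_def shift_def)

lemma coords_mono: "A \<subseteq> B \<Longrightarrow> coords n A \<subseteq> coords n B"
  by (auto simp: coords_def points_def slots_def tuples_def)

lemma finite_coord_range: "finite (coord_range t)"
  by (cases t) (auto simp: coord_range_def)

text \<open>As \<open>l \<ge> 2\<close>, a coin has no more values than a colour.\<close>

lemma card_coord_range_le: "card (coord_range t) \<le> l"
  using two_colours by (cases t) (auto simp: coord_range_def)

lemma card_PiE_coord_range_le: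
  assumes "finite J" "card J \<le> T"
  shows "card (PiE J coord_range) \<le> l ^ T"
proof -
  have "card (PiE J coord_range) = (\<Prod>i\<in>J. card (coord_range i))" using assms by (simp add: card_PiE)
  also have "\<dots> \<le> (\<Prod>i\<in>J. l)" by (rule prod_mono) (simp add: card_coord_range_le)
  also have "\<dots> \<le> l ^ T" using assms two_colours by (simp add: power_increasing)
  finally show ?thesis .
qed

text \<open>The \<open>r\<close> copies of \<open>C\<close> over \<open>B\<close> give disjoint
  blocks of new coordinates, each with at most \<open>l ^ T\<close> assignments; avoiding
  \<open>\<pi>\<close> means missing it on every block.\<close>

lemma card_avoiding_le:
  assumes sat: "saturated_at d n r" and B: "flat n B" "pdim (clo n) B < d"
    and b: "b \<in> U n" "b \<notin> B" and C: "C = clo n (insert b B)"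
    and T: "card (coords n C) \<le> T" and \<pi>: "\<pi> \<in> PiE (coords n C) coord_range"
  shows "real (card (avoiding n B C \<pi>)) \<le> (1 - 1 / real (l ^ T)) ^ r * real (card (Omega n))"
proof -
  obtain k where k: "\<And>i. i \<in> {1..r} \<Longrightarrow> emb (k i) n C n" "\<And>i b. i \<in> {1..r} \<Longrightarrow> b \<in> B \<Longrightarrow> k i b = b"
      "\<And>i j. i \<in> {1..r} \<Longrightarrow> j \<in> {1..r} \<Longrightarrow> i \<noteq> j \<Longrightarrow> k i ` C \<inter> k j ` C = B"
    using saturated_disjoint_embeddings[OF sat B(1) b B(2), folded C] by metis
  have bU: "insert b B \<subseteq> U n" using flat_subset[OF B(1)] b by auto
  have CU: "C \<subseteq> U n" and BC: "B \<subseteq> C" using clo_subset[OF bU] clo_extensive[OF bU] C by auto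
  have finC: "finite (coords n C)" using CU finite_U finite_subset finite_coords by metis
  let ?X = "coords n C - coords n B"
  \<comment> \<open>Blocks are numbered from 0 and copies from 1, hence \<open>Suc j\<close>. The
    pattern \<open>e j\<close> is \<open>\<pi>\<close> carried to the block, which makes sense
    because the shift is injective.\<close>
  define J where "J j = shift (k (Suc j)) ` ?X" for j
  define e where "e j i = \<pi> (inv_into (coords n C) (shift (k (Suc j))) i)" for j i
  have e: "e j (shift (k (Suc j)) t) = \<pi> t" if "j < r" "t \<in> coords n C" for j t
    unfolding e_def using inj_on_shift[OF k(1)[of "Suc j"]] that by simp
  have "avoiding n B C \<pi> \<subseteq> {w \<in> PiE (coords n (U n)) coord_range. \<forall>j<r. \<exists>i\<in>J j. w i \<noteq> e j i}"
  proof
    fix w assume w: "w \<in> avoiding n B C \<pi>"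
    have "\<exists>i\<in>J j. w i \<noteq> e j i" if j: "j < r" for j
    proof -
      have "emb (k (Suc j)) n C n \<and> (\<forall>b\<in>B. k (Suc j) b = b)" using k(1,2)[of "Suc j"] j by auto
      then obtain t where t: "t \<in> ?X" "w (shift (k (Suc j)) t) \<noteq> \<pi> t"
        using w unfolding avoiding_def by blast
      then have "w (shift (k (Suc j)) t) \<noteq> e j (shift (k (Suc j)) t)" using e[OF j] by auto
      then show ?thesis using t(1) unfolding J_def by blast
    qed
    then show "w \<in> {w \<in> PiE (coords n (U n)) coord_range. \<forall>j<r. \<exists>i\<in>J j. w i \<noteq> e j i}"
      using w by (simp add: avoiding_def Omega_def)
  qed
  then have "card (avoiding n B C \<pi>) \<le> card {w \<in> PiE (coords n (U n)) coord_range. \<forall>j<r. \<exists>i\<in>J j. w i \<noteq> e j i}"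
    by (rule card_mono[rotated]) (use finite_Omega[of n] in \<open>auto simp: Omega_def\<close>)
  then have "real (card (avoiding n B C \<pi>)) \<le>
    real (card {w \<in> PiE (coords n (U n)) coord_range. \<forall>j<r. \<exists>i\<in>J j. w i \<noteq> e j i})"
    by (rule of_nat_mono)
  also have "\<dots> \<le> (1 - 1 / real (l ^ T)) ^ r * real (card (PiE (coords n (U n)) coord_range))"
  proof (rule card_avoid_le)
    show "finite (coords n (U n))" by (rule finite_coords[OF finite_U])
    show "J j \<subseteq> coords n (U n)" if j: "j < r" for j
    proof -
      have kj: "emb (k (Suc j)) n C n" using k(1) j by simp
      have "k (Suc j) ` C \<subseteq> U n" using flat_subset[OF emb_flat(2)[OF kj]] .
      then show ?thesis unfolding J_def using shift_in_coords[OF kj] coords_mono by blast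
    qed
    show "J j \<inter> J j' = {}" if "j < j'" "j' < r" for j j'
      unfolding J_def by (rule shift_images_disjoint[OF _ _ B(1) BC]) (use k that in auto)
    show "e j i \<in> coord_range i" if j: "j < r" and i: "i \<in> J j" for j i
    proof -
      obtain t where t: "t \<in> coords n C" "i = shift (k (Suc j)) t" using i unfolding J_def by auto
      then have "e j i = \<pi> t" using e j by simp
      then show ?thesis using \<pi> t by auto
    qed
    show "real (card (PiE (J j) coord_range)) \<le> real (l ^ T)" if "j < r" for j
    proof -
      have "card (J j) \<le> card ?X" unfolding J_def by (rule card_image_le) (use finC in simp)
      also have "\<dots> \<le> card (coords n C)" by (rule card_mono[OF finC]) auto
      finally have "card (J j) \<le> T" using T by simp
      then show ?thesis using card_PiE_coord_range_le[of "J j" T] finC unfolding J_def by simp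
    qed
    show "1 \<le> real (l ^ T)" using two_colours by simp
  qed (simp add: finite_coord_range)
  finally show ?thesis unfolding Omega_def .
qed

lemma outcome_colouring_point:
  "a \<in> U n - clo n {} \<Longrightarrow> outcome_colouring n w (clo n {a}) = w (Inl (clo n {a}))"
  by (auto simp: outcome_colouring_def points_def)

text \<open>Saturation puts a copy of the extension over \<open>h\<close> into \<open>G n\<close>,
  without regard to colours and relations. The pattern of \<open>M\<close> is carried to this copy;
  as \<open>w\<close> does not avoid it, some self-embedding \<open>k\<close> over \<open>B\<close>
  realises it, and composing with \<open>k\<close> repairs the copy.\<close>

lemma extension_property_or_avoiding:
  assumes sat: "saturated_at d n r" "r \<ge> 1" and w: "w \<in> Omega n"
    and avoid: "\<And>xs \<pi>. xs \<in> pointed_lists n d \<Longrightarrow> \<pi> \<in> PiE (coords n (clo n (set xs))) coord_range \<Longrightarrow>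
      w \<notin> avoiding n (clo n (set (tl xs))) (clo n (set xs)) \<pi>"
  shows "extension_property s d n (outcome s n w)"
  unfolding extension_property_def
proof (intro allI impI, elim conjE)
  fix m M A a h
  assume M: "M \<in> Exps s m" and A: "flat m A" "flat n (h ` A)" and h: "embedding_on Lang h A M (outcome s n w)"
    and d: "pdim (clo m) A < d" and a: "a \<in> U m"
  obtain x Y where x: "x \<in> colourings m" "Y \<subseteq> allowed s m x" "M = mk m x Y"
    using M unfolding expansions_eq by blast
  define y where "y = outcome_colouring n w"
  define Z where "Z = {t \<in> allowed s n y. w (Inr t) = 1}"
  have N: "outcome s n w = mk n y Z" by (simp add: outcome_def y_def Z_def)
  have y: "y \<in> colourings n" unfolding y_def by (rule outcome_colouring_in[OF w])
  have hp: "emb h m A n" by (rule embedding_on_mk_pre[OF A]) (use h x(3) N in simp)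
  have hc: "x (clo m {c}) = y (clo n {h c})" if "c \<in> A - clo m {}" for c
    using h embedding_on_mk_iff[OF hp x(1) y] that unfolding x(3) N by blast
  have hr: "(R, as) \<in> Y \<longleftrightarrow> (R, map h as) \<in> Z" if "(R, as) \<in> slots A" for R as
    using h embedding_on_mk_iff[OF hp x(1) y] that unfolding x(3) N by blast
  show "\<exists>h'. (\<forall>x\<in>A. h' x = h x) \<and> flat n (h' ` clo m (insert a A)) \<and>
          embedding_on Lang h' (clo m (insert a A)) M (outcome s n w)"
  proof (cases "a \<in> A")
    case True
    then have "clo m (insert a A) = A" using A(1) by (simp add: closed_in_def insert_absorb)
    then show ?thesis using h A by auto
  next
    case False
    let ?E = "clo m (insert a A)"
    have AU: "A \<subseteq> U m" "insert a A \<subseteq> U m" using flat_subset[OF A(1)] a by auto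
    have AC: "insert a A \<subseteq> ?E" by (rule clo_extensive[OF AU(2)])
    obtain g where g: "\<forall>x\<in>A. g x = h x" "emb g m ?E n"
      using saturated_extension[OF sat hp a False d] by blast
    have gA: "g ` A = h ` A" using g(1) by auto
    have C0: "flat m ?E" by (rule flat_clo[OF AU(2)])
    let ?C = "g ` ?E"
    let ?B = "g ` A"
    \<comment> \<open>The pair \<open>?B\<close>, \<open>?C\<close> needs a code of length at most
      \<open>d\<close>. A basis of \<open>A\<close> preceded by \<open>a\<close> has
      \<open>pdim (clo m) A + 1\<close> elements, and its image under \<open>g\<close> is such a
      code.\<close>
    obtain Yb where Yb: "Yb \<subseteq> A" "finite Yb" "card Yb = pdim (clo m) A" "A \<subseteq> clo m Yb"
      using pdim_basis[OF pregeometry_clo finite_subset[OF AU(1) finite_U] AU(1)] by blast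
    have cYb: "clo m Yb = A" using Yb flat_least[OF A(1)] by blast
    have YbU: "insert a Yb \<subseteq> U m" using Yb AU by auto
    have caYb: "clo m (insert a Yb) = ?E"
    proof (rule clo_eqI[OF YbU AU(2)])
      show "insert a Yb \<subseteq> ?E" using Yb(1) AC by auto
      show "insert a A \<subseteq> clo m (insert a Yb)"
        using clo_extensive[OF YbU] clo_mono[OF YbU, of Yb] Yb(4) by auto
    qed
    obtain ys where ys: "set ys = g ` Yb" "length ys \<le> pdim (clo m) A"
      using finite_distinct_list[of "g ` Yb"] Yb card_image_le[of Yb g] distinct_card
      by (metis finite_imageI)
    let ?xs = "g a # ys"
    have YbE: "Yb \<subseteq> ?E" "insert a Yb \<subseteq> ?E" using Yb(1) AC by blast+
    have ctl: "clo n (set (tl ?xs)) = ?B"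
      using clo_emb[OF g(2) YbE(1)] cYb ys(1) by simp
    have cxs: "clo n (set ?xs) = ?C"
      using clo_emb[OF g(2) YbE(2)] caYb ys(1) by simp
    have gaB: "g a \<notin> ?B" using emb_inj[OF g(2)] AC False by (auto simp: inj_on_def)
    have CU: "?C \<subseteq> U n" using flat_subset[OF emb_flat(2)[OF g(2)]] .
    have "set ?xs \<subseteq> ?C" using ys(1) Yb(1) AC by auto
    then have xs: "?xs \<in> pointed_lists n d"
      unfolding pointed_lists_def using ctl gaB ys(2) d CU by auto
    let ?g' = "inv_into ?E g"
    have g': "emb ?g' n ?C m" by (rule emb_inv[OF g(2)])
    have g'g: "?g' (g c) = c" if "c \<in> ?E" for c using emb_inj[OF g(2)] that by simp
    \<comment> \<open>The colours and relations of \<open>M\<close>, carried to \<open>?C\<close> by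
      way of the inverse of \<open>g\<close>.\<close>
    define \<pi> where "\<pi> = (\<lambda>t\<in>coords n ?C. case t of Inl p \<Rightarrow> x (?g' ` p)
      | Inr (R, as) \<Rightarrow> if (R, map ?g' as) \<in> Y then 1 else 0)"
    have g'c: "?g' ` clo n {g c} = clo m {c}" if "c \<in> ?E" for c
      using emb_clo_singleton[OF g', of "g c"] g'g[OF that] that by simp
    have \<pi>_point: "\<pi> (Inl (clo n {g c})) = x (clo m {c})" if "c \<in> ?E" "c \<notin> clo m {}" for c
    proof -
      have "Inl (clo n {g c}) \<in> coords n ?C"
        using that emb_clo_empty[OF g(2) that(1)] by (auto simp: coords_Inl)
      then show ?thesis by (simp add: \<pi>_def g'c[OF that(1)])
    qed
    have \<pi>_slot: "\<pi> (Inr (R, map g as)) = (if (R, as) \<in> Y then 1 else 0)" if "(R, as) \<in> slots ?E" for R as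
    proof -
      have "Inr (R, map g as) \<in> coords n ?C"
        using that tuples_map[of as ?E "arity R" g] by (auto simp: coords_Inr slots_def)
      moreover have "map ?g' (map g as) = as"
        using that map_inv_into_map[OF emb_inj[OF g(2)], of as] by (auto simp: slots_def)
      ultimately show ?thesis by (simp add: \<pi>_def del: map_map)
    qed
    have "\<pi> \<in> PiE (coords n ?C) coord_range"
    proof (rule PiE_I)
      fix t assume t: "t \<in> coords n ?C"
      then show "\<pi> t \<in> coord_range t"
      proof (cases rule: coords_cases)
        case (point b)
        then obtain c where c: "c \<in> ?E" "b = g c" by blast
        then have "c \<notin> clo m {}" using point emb_clo_empty[OF g(2)] by simp
        then have "x (clo m {c}) \<in> {1..l}"
          using colour_in[OF x(1), of c] c flat_subset[OF C0] by blast
        then show ?thesis using \<pi>_point[OF c(1)] \<open>c \<notin> clo m {}\<close> point c by (simp add: coord_range_def)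
      next
        case (slot R as)
        then show ?thesis using t by (simp add: \<pi>_def coord_range_def)
      qed
    qed (simp add: \<pi>_def)
    then have "w \<notin> avoiding n ?B ?C \<pi>" using avoid[OF xs] ctl cxs by metis
    then obtain k where k: "emb k n ?C n" "\<forall>b\<in>?B. k b = b"
      and kt: "\<And>t. t \<in> coords n ?C \<Longrightarrow> t \<notin> coords n ?B \<Longrightarrow> w (shift k t) = \<pi> t"
      using w unfolding avoiding_def by blast
    let ?h = "k \<circ> g"
    have hh: "emb ?h m ?E n" by (rule emb_comp[OF g(2) k(1)])
    have hA: "?h c = h c" if "c \<in> A" for c using that g(1) k(2) by auto
    have fB: "flat n ?B" using A(2) gA by simp
    have hCU: "?h ` ?E \<subseteq> U n" using flat_subset[OF emb_flat(2)[OF hh]] .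
    have hcol: "x (clo m {c}) = y (clo n {?h c})" if c: "c \<in> ?E - clo m {}" for c
    proof (cases "c \<in> A")
      case True
      then show ?thesis using hc[of c] c hA by simp
    next
      case False
      let ?t = "Inl (clo n {g c}) :: 'u set + ('s symbol \<times> 'u list)"
      have t: "?t \<in> coords n ?C" using c emb_clo_empty[OF g(2)] by (auto simp: coords_Inl)
      \<comment> \<open>Only new coordinates are controlled by \<open>\<pi>\<close>. If the point
        met \<open>?B\<close>, it would be contained in it, and \<open>c\<close> would lie in
        \<open>A\<close>.\<close>
      have "?t \<notin> coords n ?B"
      proof
        assume "?t \<in> coords n ?B"
        then obtain b where "b \<in> ?B" "clo n {g c} = clo n {b}" by (auto simp: coords_Inl)
        then have "g c \<in> ?B"
          using point_subset[OF fB, of b] point_subset[OF emb_flat(2)[OF g(2)], of "g c"] c by blast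
        then show False using False emb_inj[OF g(2)] AC c by (auto simp: inj_on_def)
      qed
      then have "w (shift k ?t) = x (clo m {c})" using kt[OF t] \<pi>_point c by auto
      moreover have "k ` clo n {g c} = clo n {?h c}"
        using emb_clo_singleton[OF k(1), of "g c"] c by simp
      moreover have "?h c \<in> U n - clo n {}"
        using hCU c emb_clo_empty[OF hh, of c] by blast
      ultimately show ?thesis using outcome_colouring_point[of "?h c" n w] by (simp add: y_def)
    qed
    have hrel: "(R, as) \<in> Y \<longleftrightarrow> (R, map ?h as) \<in> Z" if as: "(R, as) \<in> slots ?E" for R as
    proof (cases "set as \<subseteq> A")
      case True
      then have "(R, as) \<in> slots A" using as by (auto simp: slots_def tuples_def)
      moreover have "map ?h as = map h as" using True hA by (intro map_cong) auto
      ultimately show ?thesis using hr by metis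
    next
      case False
      have asC: "set as \<subseteq> ?E" using as slots_set by blast
      let ?t = "Inr (R, map g as) :: 'u set + ('s symbol \<times> 'u list)"
      have t: "?t \<in> coords n ?C"
        using as tuples_map[of as ?E "arity R" g] by (auto simp: coords_Inr slots_def)
      have "?t \<notin> coords n ?B"
      proof
        assume "?t \<in> coords n ?B"
        then have "g ` set as \<subseteq> g ` A" by (auto simp: coords_Inr slots_def tuples_def)
        then show False using False emb_inj[OF g(2)] AC asC by (simp add: inj_on_image_subset_iff)
      qed
      then have wt: "w (Inr (R, map ?h as)) = (if (R, as) \<in> Y then 1 else 0)"
        using kt[OF t] \<pi>_slot[OF as] by simp
      have "(R, map ?h as) \<in> slots (U n)"
        using as hCU tuples_map[of as ?E "arity R" ?h] tuples_mono[OF hCU, of "arity R"]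
        by (auto simp: slots_def simp del: map_map map_comp_map)
      moreover have "admissible s m x as \<longleftrightarrow> admissible s n y (map ?h as)"
        by (rule emb_admissible[OF hh asC]) (rule hcol)
      \<comment> \<open>As \<open>M\<close> is a genuine expansion, a coin prescribed to be 1 is
        never one that \<open>outcome\<close> discards.\<close>
      moreover have "(R, as) \<in> Y \<Longrightarrow> admissible s m x as" using x(2) by (auto simp: allowed_def)
      ultimately show ?thesis using wt unfolding Z_def allowed_def by auto
    qed
    have "embedding_on Lang ?h ?E M (outcome s n w)"
      unfolding x(3) N embedding_on_mk_iff[OF hh x(1) y] using hcol hrel by blast
    then show ?thesis using hA emb_flat(2)[OF hh] by blast
  qed
qed

text \<open>By (A1) the closure of at most \<open>d\<close> elements has bounded size. It therefore
  has boundedly many points, and boundedly many tuples for the finitely many symbols in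
  \<open>Vrel\<close>, uniformly in \<open>n\<close>.\<close>

lemma coords_bounded:
  "\<exists>T. \<forall>n xs. set xs \<subseteq> U n \<and> length xs \<le> d \<longrightarrow> card (coords n (clo n (set xs))) \<le> T"
proof -
  obtain f :: "nat \<Rightarrow> nat" where f: "\<And>n X. X \<subseteq> U n \<Longrightarrow> card (clo n X) \<le> f (pdim (clo n) X)"
    using uniformly_bounded by blast
  \<comment> \<open>The function \<open>f\<close> need not be monotone, so the maximum over all
    dimensions up to \<open>d\<close> is taken.\<close>
  define b where "b = Max (f ` {..d})"
  have "card (coords n (clo n (set xs))) \<le> b + (\<Sum>R\<in>Vrel. b ^ arity R)"
    if xs: "set xs \<subseteq> U n" "length xs \<le> d" for n xs
  proof -
    let ?C = "clo n (set xs)"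
    have "pdim (clo n) (set xs) \<le> d"
      using pdim_le_card[OF pregeometry_clo, of "set xs" n] xs card_length[of xs] by simp
    then have "f (pdim (clo n) (set xs)) \<le> b" unfolding b_def by (intro Max_ge) auto
    then have C: "card ?C \<le> b" using f[OF xs(1)] by simp
    have fin: "finite ?C" using clo_subset[OF xs(1)] finite_U finite_subset by blast
    have "card (points n ?C) \<le> card (?C - clo n {})" unfolding points_def by (rule card_image_le) (use fin in simp)
    also have "\<dots> \<le> card ?C" by (rule card_mono[OF fin]) auto
    finally have p: "card (points n ?C) \<le> b" using C by simp
    have "card (slots ?C) = (\<Sum>R\<in>Vrel. card (tuples ?C (arity R)))"
      unfolding slots_def using relations(1) finite_tuples[OF fin] by (simp add: card_SigmaI)
    also have "\<dots> \<le> (\<Sum>R\<in>Vrel. b ^ arity R)"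
      unfolding tuples_def using C by (intro sum_mono) (simp add: card_lists_length_eq[OF fin] power_mono)
    finally have "card (slots ?C) \<le> (\<Sum>R\<in>Vrel. b ^ arity R)" .
    moreover have "card (coords n ?C) \<le> card (points n ?C) + card (slots ?C)"
      unfolding coords_def
      by (rule order_trans[OF card_Un_le]) (simp add: card_image)
    ultimately show ?thesis using p by simp
  qed
  then show ?thesis by blast
qed

definition failure :: "bool \<Rightarrow> nat \<Rightarrow> nat \<Rightarrow> ('u set + ('s symbol \<times> 'u list) \<Rightarrow> nat) set" where
  "failure s d n = {w \<in> Omega n. \<not> extension_property s d n (outcome s n w)}"

text \<open>A union bound: the number of codes, times the number \<open>l ^ T\<close> of patterns,
  times the share of outcomes that avoid a given pattern.\<close>

lemma card_failure_le:
  assumes sat: "saturated_at d n r" "r \<ge> 1"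
    and T: "\<And>xs. set xs \<subseteq> U n \<Longrightarrow> length xs \<le> d \<Longrightarrow> card (coords n (clo n (set xs))) \<le> T"
  shows "real (card (failure s d n)) \<le>
    real (\<Sum>i\<le>d. card (U n) ^ i) * real (l ^ T) * (1 - 1 / real (l ^ T)) ^ r * real (card (Omega n))"
proof -
  let ?X = "pointed_lists n d"
  let ?P = "\<lambda>xs. PiE (coords n (clo n (set xs))) coord_range"
  let ?F = "\<lambda>xs \<pi>. avoiding n (clo n (set (tl xs))) (clo n (set xs)) \<pi>"
  let ?q = "(1 - 1 / real (l ^ T)) ^ r * real (card (Omega n))"
  have q0: "0 \<le> ?q" using two_colours by (simp add: field_simps)
  have XX: "?X \<subseteq> {xs. set xs \<subseteq> U n \<and> length xs \<le> d}" by (auto simp: pointed_lists_def)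
  have finX: "finite ?X" by (rule finite_subset[OF XX]) (rule finite_lists_length_le[OF finite_U])
  have cX: "card ?X \<le> (\<Sum>i\<le>d. card (U n) ^ i)"
    using card_mono[OF finite_lists_length_le[OF finite_U] XX] card_lists_length_le[OF finite_U, of n d] by simp
  have fin: "finite (coords n (clo n (set xs)))" if "xs \<in> ?X" for xs
    using that clo_subset[of "set xs" n] finite_U finite_subset
    by (intro finite_coords) (auto simp: pointed_lists_def)
  have finP: "finite (?P xs)" if "xs \<in> ?X" for xs
    using fin[OF that] by (intro finite_PiE) (auto simp: finite_coord_range)
  have cP: "card (?P xs) \<le> l ^ T" if "xs \<in> ?X" for xs
    using card_PiE_coord_range_le[OF fin[OF that]] T[of xs] that by (auto simp: pointed_lists_def)
  have finF: "finite (?F xs \<pi>)" for xs \<pi>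
    by (rule finite_subset[OF _ finite_Omega[of n]]) (auto simp: avoiding_def)
  have cF: "real (card (?F xs \<pi>)) \<le> ?q" if xs: "xs \<in> ?X" and \<pi>: "\<pi> \<in> ?P xs" for xs \<pi>
  proof -
    let ?B = "clo n (set (tl xs))"
    obtain b ys where xs': "xs = b # ys" using xs by (cases xs) (auto simp: pointed_lists_def)
    have sub: "set (tl xs) \<subseteq> U n" "set xs \<subseteq> U n" "b \<in> U n" using xs xs' by (auto simp: pointed_lists_def)
    have B: "flat n ?B" by (rule flat_clo[OF sub(1)])
    have "pdim (clo n) ?B \<le> pdim (clo n) (set (tl xs))"
      by (rule pdim_closure_le[OF pregeometry_clo _ sub(1)]) simp
    also have "\<dots> \<le> card (set (tl xs))" by (rule pdim_le_card[OF pregeometry_clo _ sub(1)]) simp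
    also have "\<dots> < d" using card_length[of "tl xs"] xs xs' by (auto simp: pointed_lists_def)
    finally have d: "pdim (clo n) ?B < d" .
    have BU: "insert b ?B \<subseteq> U n" using clo_subset[OF sub(1)] sub(3) by auto
    have "clo n (set xs) = clo n (insert b ?B)"
    proof (rule clo_eqI[OF sub(2) BU])
      show "set xs \<subseteq> clo n (insert b ?B)"
        using clo_extensive[OF BU] clo_extensive[OF sub(1)] xs' by auto
      show "insert b ?B \<subseteq> clo n (set xs)"
        using clo_extensive[OF sub(2)] clo_mono[OF sub(2), of "set (tl xs)"] xs' by auto
    qed
    then show ?thesis
      using card_avoiding_le[OF sat(1) B d sub(3), of "clo n (set xs)" T \<pi>] T[OF sub(2)] xs xs' \<pi>
      by (auto simp: pointed_lists_def)
  qed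
  have "failure s d n \<subseteq> (\<Union>xs\<in>?X. \<Union>\<pi>\<in>?P xs. ?F xs \<pi>)"
  proof
    fix w assume w: "w \<in> failure s d n"
    show "w \<in> (\<Union>xs\<in>?X. \<Union>\<pi>\<in>?P xs. ?F xs \<pi>)"
    proof (rule ccontr)
      assume "w \<notin> (\<Union>xs\<in>?X. \<Union>\<pi>\<in>?P xs. ?F xs \<pi>)"
      then have "extension_property s d n (outcome s n w)"
        using w by (intro extension_property_or_avoiding[OF sat]) (auto simp: failure_def)
      then show False using w by (simp add: failure_def)
    qed
  qed
  then have "card (failure s d n) \<le> card (\<Union>xs\<in>?X. \<Union>\<pi>\<in>?P xs. ?F xs \<pi>)"
    by (rule card_mono[rotated]) (use finX finP finF in blast)
  also have "\<dots> \<le> (\<Sum>xs\<in>?X. \<Sum>\<pi>\<in>?P xs. card (?F xs \<pi>))"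
    by (rule order_trans[OF card_UN_le[OF finX]]) (intro sum_mono card_UN_le finP)
  finally have "real (card (failure s d n)) \<le> (\<Sum>xs\<in>?X. \<Sum>\<pi>\<in>?P xs. real (card (?F xs \<pi>)))"
    by (simp flip: of_nat_sum)
  also have "\<dots> \<le> (\<Sum>xs\<in>?X. real (l ^ T) * ?q)"
  proof (rule sum_mono)
    fix xs assume xs: "xs \<in> ?X"
    have "(\<Sum>\<pi>\<in>?P xs. real (card (?F xs \<pi>))) \<le> real (card (?P xs)) * ?q"
      using sum_bounded_above[of "?P xs" "\<lambda>\<pi>. real (card (?F xs \<pi>))" ?q] cF[OF xs] by simp
    also have "\<dots> \<le> real (l ^ T) * ?q" by (intro mult_right_mono q0 of_nat_mono cP[OF xs])
    finally show "(\<Sum>\<pi>\<in>?P xs. real (card (?F xs \<pi>))) \<le> real (l ^ T) * ?q" .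
  qed
  also have "\<dots> = real (card ?X) * (real (l ^ T) * ?q)" by simp
  also have "\<dots> \<le> real (\<Sum>i\<le>d. card (U n) ^ i) * (real (l ^ T) * ?q)"
    by (intro mult_right_mono of_nat_mono cX mult_nonneg_nonneg q0) simp
  finally show ?thesis by (simp add: mult.assoc)
qed

lemma polynomially_saturated_iff:
  "polynomially_saturated Vpre \<theta> G k \<longleftrightarrow>
    (\<exists>(lam :: nat \<Rightarrow> nat) (P :: real poly). filterlim lam at_top sequentially \<and>
      (\<forall>n. lam n \<le> card (U n) \<and> real (card (U n)) \<le> poly P (real (lam n)) \<and> saturated_at k n (lam n)))"
  unfolding polynomially_saturated_def saturated_at_def by (rule refl)

lemma failure_tendsto_0:
  assumes "polynomially_saturated Vpre \<theta> G d"
  shows "(\<lambda>n. real (card (failure s d n)) / real (card (Omega n))) \<longlonglongrightarrow> 0"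
proof -
  obtain lam and P :: "real poly" where lam: "filterlim lam at_top sequentially"
    and P: "\<And>n. real (card (U n)) \<le> poly P (real (lam n))"
    and sat: "\<And>n. saturated_at d n (lam n)"
    using assms unfolding polynomially_saturated_iff by metis
  obtain T where T: "\<And>n xs. set xs \<subseteq> U n \<Longrightarrow> length xs \<le> d \<Longrightarrow> card (coords n (clo n (set xs))) \<le> T"
    using coords_bounded[of d] by blast
  \<comment> \<open>The number of cases as a polynomial in \<open>lam n\<close>: codes are counted
    by powers of the size of \<open>U n\<close>, which is at most \<open>poly P (lam n)\<close>, and
    \<open>l ^ T\<close> is constant.\<close>
  define Q where "Q = smult (real (l ^ T)) (\<Sum>i\<le>d. P ^ i)"
  define q where "q = 1 - 1 / real (l ^ T)"
  have q: "0 \<le> q" "q < 1" using two_colours by (auto simp: q_def field_simps)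
  have "(\<lambda>n. poly Q (real (lam n)) * q ^ lam n) \<longlonglongrightarrow> 0"
    by (rule filterlim_compose[OF poly_times_power_tendsto_0[OF q] lam])
  moreover have "\<forall>\<^sub>F n in sequentially. norm (real (card (failure s d n)) / real (card (Omega n))) \<le>
      poly Q (real (lam n)) * q ^ lam n"
  proof -
    \<comment> \<open>At least one copy is needed to place the extension in \<open>G n\<close> at
      all.\<close>
    have "\<forall>\<^sub>F n in sequentially. 1 \<le> lam n" using lam unfolding filterlim_at_top by blast
    then show ?thesis
    proof eventually_elim
      case (elim n)
      have "real (card (failure s d n)) \<le>
        real (\<Sum>i\<le>d. card (U n) ^ i) * real (l ^ T) * q ^ lam n * real (card (Omega n))"
        unfolding q_def by (rule card_failure_le[OF sat elim T])
      then have "real (card (failure s d n)) / real (card (Omega n)) \<le>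
        real (\<Sum>i\<le>d. card (U n) ^ i) * real (l ^ T) * q ^ lam n"
        using card_Omega_pos[of n] by (simp add: divide_le_eq)
      also have "\<dots> \<le> (\<Sum>i\<le>d. poly P (real (lam n)) ^ i) * real (l ^ T) * q ^ lam n"
        using P[of n] q by (intro mult_right_mono) (auto intro!: sum_mono power_mono)
      also have "\<dots> = poly Q (real (lam n)) * q ^ lam n"
        by (simp add: Q_def poly_sum mult.commute)
      finally show ?case by simp
    qed
  qed
  ultimately show ?thesis by (rule Lim_null_comparison[rotated])
qed

end

section \<open>The zero-one law\<close>

lemma form_over_mono:
  assumes "V \<subseteq> V'"
  shows "form_over V \<phi> \<Longrightarrow> form_over V' \<phi>"
proof -
  have t: "trm_over V t \<Longrightarrow> trm_over V' t" for t
    using assms by (induction t) auto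
  show "form_over V \<phi> \<Longrightarrow> form_over V' \<phi>"
    using assms t by (induction \<phi>) auto
qed

lemma is_struct_reduct: "is_struct V M \<Longrightarrow> V' \<subseteq> V \<Longrightarrow> is_struct V' (reduct V' M)"
  unfolding is_struct_def reduct_def by (auto split: if_splits)

lemma reduct_reduct: "V' \<subseteq> V \<Longrightarrow> reduct V' (reduct V M) = reduct V' M"
  unfolding reduct_def by (auto simp: fun_eq_iff subset_iff)

context coloured_pregeometries
begin

lemma expansion_univ: "M \<in> Exps s n \<Longrightarrow> univ M = U n"
  unfolding expansions_eq by auto

lemma embedding_on_expansion:
  assumes "M \<in> Exps s m" "N \<in> Exps s n" "flat m A" "flat n (h ` A)" "embedding_on Lang h A M N"
  shows "emb h m A n"
  using assms embedding_on_mk_pre unfolding expansions_eq by auto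

lemma pdim_clo_insert_le:
  assumes "flat n A" "a \<in> U n"
  shows "pdim (clo n) (clo n (insert a A)) \<le> Suc (pdim (clo n) A)"
proof (cases "a \<in> A")
  case True
  then show ?thesis using assms by (simp add: closed_in_def insert_absorb)
next
  case False
  then show ?thesis
    using pdim_closure_insert[OF pregeometry_clo finite_U _ _ assms(2) False] assms(1)
    by (simp add: closed_in_def)
qed

text \<open>By (A3) both closures carry a copy of \<open>G 0\<close>, which gives an isomorphism for
  the pregeometry vocabulary. By (C1) and (C2) the expansions add neither colours nor relations
  there.\<close>

lemma empty_embedding:
  assumes M: "M \<in> Exps s m" and N: "N \<in> Exps s n"
  shows "\<exists>h. h ` clo m {} = clo n {} \<and> embedding_on Lang h (clo m {}) M N"
proof -
  obtain S where S: "substructure Vpre S (G m)" "univ S = clo m {}" "isomorphic Vpre S (G 0)"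
    using closure_of_empty[of m] by blast
  obtain T where T: "substructure Vpre T (G n)" "univ T = clo n {}" "isomorphic Vpre T (G 0)"
    using closure_of_empty[of n] by blast
  obtain f where f: "isomorphism Vpre f S (G 0)" using S(3) isomorphic_def by blast
  obtain g where g: "isomorphism Vpre g T (G 0)" using T(3) isomorphic_def by blast
  have f': "embedding_on Vpre f (clo m {}) S (G 0)" "f ` clo m {} = U 0"
    using isomorphism_embedding_on[of Vpre S f "G 0"] substructure_is_struct[OF S(1)] f S(2) by auto
  have g': "embedding_on Vpre g (clo n {}) T (G 0)" "g ` clo n {} = U 0"
    using isomorphism_embedding_on[of Vpre T g "G 0"] substructure_is_struct[OF T(1)] g T(2) by auto
  let ?h = "inv_into (clo n {}) g \<circ> f"
  have ginv: "embedding_on Vpre (inv_into (clo n {}) g) (f ` clo m {}) (G 0) T"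
    using embedding_on_inv[OF g'(1)] g'(2) f'(2) by simp
  have im: "?h ` clo m {} = clo n {}"
    using f'(2) g' unfolding image_comp[symmetric] embedding_on_def
    by (metis inv_into_image_cancel order_refl)
  have "emb ?h m (univ S) n"
  proof (rule embI_substructures)
    show "closed_substructure Vpre \<theta> S (G m)" "closed_substructure Vpre \<theta> T (G n)"
      unfolding closed_substructure_def using S T flat_clo[of "{}"] by simp_all
    show "embedding_on Vpre ?h (univ S) S T" using embedding_on_comp[OF f'(1) ginv] S(2) by simp
    show "?h ` univ S = univ T" using im S(2) T(2) by simp
  qed
  then have e: "emb ?h m (clo m {}) n" using S(2) by simp
  obtain x Y where x: "x \<in> colourings m" "Y \<subseteq> allowed s m x" "M = mk m x Y"
    using M unfolding expansions_eq by blast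
  obtain y Z where y: "y \<in> colourings n" "Z \<subseteq> allowed s n y" "N = mk n y Z"
    using N unfolding expansions_eq by blast
  have "(R, as) \<notin> Y \<and> (R, map ?h as) \<notin> Z" if as: "(R, as) \<in> slots (clo m {})" for R as
  proof -
    have sub: "set as \<subseteq> clo m {}" using as slots_set by blast
    then have "set (map ?h as) \<subseteq> clo n {}" using im by (metis image_mono list.set_map)
    then have "\<not> admissible s m x as" "\<not> admissible s n y (map ?h as)"
      using sub admissible_not_subset by blast+
    then show ?thesis using x(2) y(2) by (auto simp: allowed_def)
  qed
  then have "embedding_on Lang ?h (clo m {}) M N"
    unfolding x(3) y(3) embedding_on_mk_iff[OF e x(1) y(1)] by blast
  then show ?thesis using im by blast
qed

lemma sat_iff_of_extension_property:
  assumes M: "M \<in> Exps s m" "extension_property s d m M" and N: "N \<in> Exps s n" "extension_property s d n N"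
    and \<phi>: "form_over Lang \<phi>" "free_vars \<phi> = {}" "quantifier_rank \<phi> \<le> d"
  shows "sat M e \<phi> \<longleftrightarrow> sat N e \<phi>"
proof -
  \<comment> \<open>The dimension reached plus the rounds left never exceeds \<open>d\<close>. While
    a round is left, the dimension of \<open>A\<close> is below \<open>d\<close>, so the extension
    property applies.\<close>
  define Z where "Z q h A \<longleftrightarrow> flat m A \<and> flat n (h ` A) \<and> embedding_on Lang h A M N \<and>
    pdim (clo m) A + q \<le> d" for q h A
  obtain h0 where h0: "h0 ` clo m {} = clo n {}" "embedding_on Lang h0 (clo m {}) M N"
    using empty_embedding[OF M(1) N(1)] by blast
  have "pdim (clo m) (clo m {}) = 0"
    using pdim_closure_le[OF pregeometry_clo, of "{}" m] pdim_le_card[OF pregeometry_clo, of "{}" m] by simp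
  then have Z0: "Z d h0 (clo m {})" using h0 flat_clo[of "{}"] by (simp add: Z_def)
  have forward: "\<exists>h' A'. Z q h' A' \<and> A \<subseteq> A' \<and> (\<forall>x\<in>A. h' x = h x) \<and> a \<in> A'"
    if Z: "Z (Suc q) h A" and a: "a \<in> U m" for q h A a
  proof -
    have A: "flat m A" "insert a A \<subseteq> U m" using Z a flat_subset unfolding Z_def by blast+
    obtain h' where "\<forall>x\<in>A. h' x = h x" "flat n (h' ` clo m (insert a A))"
        "embedding_on Lang h' (clo m (insert a A)) M N"
      using N(2)[unfolded extension_property_def, rule_format, of M m A h a] Z a M(1)
      unfolding Z_def by auto
    moreover have "pdim (clo m) (clo m (insert a A)) + q \<le> d"
      using pdim_clo_insert_le[OF A(1) a] Z unfolding Z_def by linarith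
    ultimately have "Z q h' (clo m (insert a A))" using flat_clo[OF A(2)] unfolding Z_def by blast
    then show ?thesis using clo_extensive[OF A(2)] \<open>\<forall>x\<in>A. h' x = h x\<close> by blast
  qed
  have backward: "\<exists>h' A'. Z q h' A' \<and> A \<subseteq> A' \<and> (\<forall>x\<in>A. h' x = h x) \<and> b \<in> h' ` A'"
    if Z: "Z (Suc q) h A" and b: "b \<in> U n" for q h A b
  proof -
    have A: "flat m A" "flat n (h ` A)" "embedding_on Lang h A M N" "pdim (clo m) A + Suc q \<le> d"
      using Z unfolding Z_def by blast+
    have e: "emb h m A n" by (rule embedding_on_expansion[OF M(1) N(1) A(1-3)])
    have inj: "inj_on h A" by (rule emb_inj[OF e])
    have bB: "insert b (h ` A) \<subseteq> U n" using b flat_subset[OF A(2)] by auto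
    have pd: "pdim (clo n) (h ` A) = pdim (clo m) A" using emb_pdim[OF e] by simp
    have "flat m (inv_into A h ` h ` A)" using A(1) inj by simp
    moreover have "pdim (clo n) (h ` A) < d" using pd A(4) by simp
    \<comment> \<open>The roles are exchanged: \<open>M\<close> has the extension property, and the
      inverse of \<open>h\<close> is extended from \<open>N\<close> into \<open>M\<close>.\<close>
    ultimately obtain k where k: "\<forall>x\<in>h ` A. k x = inv_into A h x"
        "flat m (k ` clo n (insert b (h ` A)))"
        "embedding_on Lang k (clo n (insert b (h ` A))) N M"
      using M(2)[unfolded extension_property_def, rule_format, of N n "h ` A" "inv_into A h" b]
        N(1) A(2) embedding_on_inv[OF A(3)] b by blast
    let ?C = "clo n (insert b (h ` A))"
    have ek: "emb k n ?C m" by (rule embedding_on_expansion[OF N(1) M(1) flat_clo[OF bB] k(2,3)])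
    have injk: "inj_on k ?C" by (rule emb_inj[OF ek])
    let ?h = "inv_into ?C k"
    have im: "?h ` k ` ?C = ?C" using injk by simp
    have BC: "insert b (h ` A) \<subseteq> ?C" by (rule clo_extensive[OF bB])
    have kh: "k (h a) = a" if "a \<in> A" for a using k(1) that inj by simp
    have "pdim (clo m) (k ` ?C) + q \<le> d"
      using emb_pdim[OF ek, of ?C] pdim_clo_insert_le[OF A(2) b] pd A(4) by simp
    then have "Z q ?h (k ` ?C)"
      unfolding Z_def using im k(2) flat_clo[OF bB] embedding_on_inv[OF k(3)] by simp
    moreover have "A \<subseteq> k ` ?C" using kh BC by (metis (no_types, lifting) image_eqI image_subset_iff insert_subset subsetI)
    moreover have "?h a = h a" if a: "a \<in> A" for a
      using inv_into_f_f[OF injk, of "h a"] kh[OF a] BC a by auto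
    moreover have "b \<in> ?h ` k ` ?C" using im BC by simp
    ultimately show ?thesis by blast
  qed
  show ?thesis
  proof (rule back_and_forth[where Z = Z, OF _ _ _ _ \<phi>(1) Z0 \<phi>(3)])
    show "embedding_on Lang h A M N" if "Z q h A" for q h A using that Z_def by blast
    show "A \<subseteq> univ M \<and> h ` A \<subseteq> univ N" if "Z q h A" for q h A
      using that flat_subset expansion_univ[OF M(1)] expansion_univ[OF N(1)] unfolding Z_def by metis
  qed (use forward backward expansion_univ[OF M(1)] expansion_univ[OF N(1)] \<phi>(2) in \<open>simp_all\<close>)
qed

text \<open>No colour symbol occurs in \<open>\<phi>\<close>, so an expansion and its reduct agree
  on it, and the event can be read in the product space.\<close>

lemma delta_colourable_sentence:
  assumes \<phi>: "form_over (Vpre \<union> Vrel) \<phi>"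
  shows "delta_colourable l Vpre P Vrel \<theta> (coloured_variant s) (G n)
      {N \<in> colourables l Vpre P Vrel (coloured_variant s) (G n). holds N \<phi> []} =
    real (card {w \<in> Omega n. sat (outcome s n w) (\<lambda>_. undefined) \<phi>}) / real (card (Omega n))"
proof -
  have "reduct (Vpre \<union> Vrel) M \<in> {N \<in> colourables l Vpre P Vrel (coloured_variant s) (G n). holds N \<phi> []} \<longleftrightarrow>
      sat M (\<lambda>_. undefined) \<phi>" if M: "M \<in> Exps s n" for M
  proof -
    have "reduct (Vpre \<union> Vrel) M \<in> colourables l Vpre P Vrel (coloured_variant s) (G n)"
      using M is_struct_reduct[of Lang M "Vpre \<union> Vrel"] reduct_reduct[of Vpre "Vpre \<union> Vrel" M]
      by (auto simp: colourables_def expansions_def)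
    then show ?thesis using sat_reduct[OF \<phi>] by (simp add: holds_def)
  qed
  then have eq: "{M \<in> Exps s n. reduct (Vpre \<union> Vrel) M \<in>
      {N \<in> colourables l Vpre P Vrel (coloured_variant s) (G n). holds N \<phi> []}} =
    {M \<in> Exps s n. sat M (\<lambda>_. undefined) \<phi>}" by blast
  show ?thesis unfolding delta_colourable_def Let_def eq by (rule delta_coloured_eq)
qed

lemma zero_one_law:
  fixes s :: bool
  assumes sat: "\<forall>k. polynomially_saturated Vpre \<theta> G k" and \<phi>: "sentence_over (Vpre \<union> Vrel) \<phi>"
  defines "\<delta> \<equiv> \<lambda>n. delta_colourable l Vpre P Vrel \<theta> (coloured_variant s) (G n)
      {N \<in> colourables l Vpre P Vrel (coloured_variant s) (G n). holds N \<phi> []}"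
  shows "\<delta> \<longlonglongrightarrow> 0 \<or> \<delta> \<longlonglongrightarrow> 1"
proof -
  let ?d = "quantifier_rank \<phi>"
  let ?e = "\<lambda>_. undefined :: 'u"
  let ?p = "\<lambda>n. real (card {w \<in> Omega n. sat (outcome s n w) ?e \<phi>}) / real (card (Omega n))"
  let ?b = "\<lambda>n. real (card (failure s ?d n)) / real (card (Omega n))"
  have fo: "form_over (Vpre \<union> Vrel) \<phi>" "free_vars \<phi> = {}" using \<phi> by (auto simp: sentence_over_def)
  have foL: "form_over Lang \<phi>" by (rule form_over_mono[OF _ fo(1)]) auto
  have \<delta>: "\<delta> = ?p" unfolding \<delta>_def using delta_colourable_sentence[OF fo(1)] by simp
  have b0: "?b \<longlonglongrightarrow> 0" by (rule failure_tendsto_0) (use sat in blast)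
  have finF: "finite (failure s ?d n)" for n unfolding failure_def using finite_Omega by simp
  have agree: "sat (outcome s n w) ?e \<phi> \<longleftrightarrow> sat (outcome s m v) ?e \<phi>"
    if "w \<in> Omega n - failure s ?d n" "v \<in> Omega m - failure s ?d m" for n m w v
    by (rule sat_iff_of_extension_property[OF outcome_in_expansions _ outcome_in_expansions _ foL fo(2) order_refl])
      (use that in \<open>auto simp: failure_def\<close>)
  have "\<forall>\<^sub>F n in sequentially. ?b n < 1" using b0 by (rule order_tendstoD) simp
  then obtain m where m: "?b m < 1" unfolding eventually_sequentially by blast
  then have "card (failure s ?d m) < card (Omega m)"
    using card_Omega_pos[of m] by (simp add: divide_less_eq)
  then have "\<not> Omega m \<subseteq> failure s ?d m"
    using card_mono[OF finF[of m], of "Omega m"] by linarith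
  \<comment> \<open>One good outcome serves as the reference: good outcomes for all \<open>n\<close>
    agree with it on \<open>\<phi>\<close>, so the truth of \<open>\<phi>\<close> there decides
    between the limits 1 and 0.\<close>
  then obtain v where v: "v \<in> Omega m - failure s ?d m" by blast
  show ?thesis
  proof (cases "sat (outcome s m v) ?e \<phi>")
    case True
    have "1 - ?b n \<le> ?p n" for n
    proof -
      have "Omega n \<subseteq> {w \<in> Omega n. sat (outcome s n w) ?e \<phi>} \<union> failure s ?d n"
        using agree[OF _ v] True by blast
      then have "card (Omega n) \<le> card ({w \<in> Omega n. sat (outcome s n w) ?e \<phi>} \<union> failure s ?d n)"
        by (rule card_mono[rotated]) (use finite_Omega finF in simp)
      also have "\<dots> \<le> card {w \<in> Omega n. sat (outcome s n w) ?e \<phi>} + card (failure s ?d n)" by (rule card_Un_le)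
      finally have "real (card (Omega n)) \<le>
          real (card {w \<in> Omega n. sat (outcome s n w) ?e \<phi>}) + real (card (failure s ?d n))"
        by (simp flip: of_nat_add)
      then have "real (card (Omega n)) / real (card (Omega n)) \<le>
          (real (card {w \<in> Omega n. sat (outcome s n w) ?e \<phi>}) + real (card (failure s ?d n))) / real (card (Omega n))"
        by (rule divide_right_mono) simp
      then show ?thesis using card_Omega_pos[of n] by (simp add: add_divide_distrib)
    qed
    moreover have "?p n \<le> 1" for n
      using card_mono[OF finite_Omega[of n], of "{w \<in> Omega n. sat (outcome s n w) ?e \<phi>}"] card_Omega_pos[of n]
      by (simp add: divide_le_eq)
    moreover have "(\<lambda>n. 1 - ?b n) \<longlonglongrightarrow> 1" using tendsto_diff[OF tendsto_const b0, of 1] by simp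
    ultimately have "?p \<longlonglongrightarrow> 1" by (intro tendsto_sandwich[of "\<lambda>n. 1 - ?b n" ?p _ "\<lambda>_. 1"]) auto
    then show ?thesis unfolding \<delta> by blast
  next
    case False
    have "?p n \<le> ?b n" for n
    proof -
      have "{w \<in> Omega n. sat (outcome s n w) ?e \<phi>} \<subseteq> failure s ?d n"
        using agree[OF _ v] False by blast
      then have "card {w \<in> Omega n. sat (outcome s n w) ?e \<phi>} \<le> card (failure s ?d n)"
        by (rule card_mono[OF finF])
      then show ?thesis by (intro divide_right_mono) auto
    qed
    then have "?p \<longlonglongrightarrow> 0" by (intro tendsto_sandwich[of "\<lambda>_. 0" ?p _ ?b] b0) auto
    then show ?thesis unfolding \<delta> by blast
  qed
qed

end

theorem theorem1p1:
  fixes l :: nat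
    and Vpre Vrel :: "'s symbol set"
    and P :: "nat \<Rightarrow> 's symbol"
    and \<theta> :: "nat \<Rightarrow> 's form"
    and G :: "nat \<Rightarrow> ('s, 'u) fo_struct"
  assumes "coloured_pregeometries l Vpre P Vrel \<theta> G"
    and "\<forall>k. polynomially_saturated Vpre \<theta> G k"
  shows "\<forall>\<phi>. sentence_over (Vpre \<union> Vrel) \<phi> \<longrightarrow>
           ((\<lambda>n. delta_C l Vpre P Vrel \<theta> G n \<phi>) \<longlonglongrightarrow> 0 \<or>
            (\<lambda>n. delta_C l Vpre P Vrel \<theta> G n \<phi>) \<longlonglongrightarrow> 1) \<and>
           ((\<lambda>n. delta_S l Vpre P Vrel \<theta> G n \<phi>) \<longlonglongrightarrow> 0 \<or>
            (\<lambda>n. delta_S l Vpre P Vrel \<theta> G n \<phi>) \<longlonglongrightarrow> 1)"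
proof (intro allI impI)
  fix \<phi> :: "'s form"
  assume \<phi>: "sentence_over (Vpre \<union> Vrel) \<phi>"
  interpret coloured_pregeometries l Vpre P Vrel \<theta> G by (rule assms(1))
  from zero_one_law[OF assms(2) \<phi>, of False] zero_one_law[OF assms(2) \<phi>, of True]
  show "((\<lambda>n. delta_C l Vpre P Vrel \<theta> G n \<phi>) \<longlonglongrightarrow> 0 \<or>
            (\<lambda>n. delta_C l Vpre P Vrel \<theta> G n \<phi>) \<longlonglongrightarrow> 1) \<and>
           ((\<lambda>n. delta_S l Vpre P Vrel \<theta> G n \<phi>) \<longlonglongrightarrow> 0 \<or>
            (\<lambda>n. delta_S l Vpre P Vrel \<theta> G n \<phi>) \<longlonglongrightarrow> 1)"
    by (simp add: coloured_variant_def delta_C_def delta_S_def)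
qed

end
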